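(* Let $(\xi,\Theta)$ be a Markov additive process on $\mathbb R\times\mathcal I$ with matrix exponent $F$ and leading eigenvalue $\chi$. Assume that for some $\gamma>0$, $F$ is defined on $[0,\gamma]$, and $\chi(\gamma)<0$. Then the exponential functional $$I(\xi):=\int_0^\infty\mathrm e^{\xi(s)}\mathrm ds$$ has finite moment of order $\gamma$, under any initial distribution of $(\xi,\Theta)$.
   Context: Let $\mathcal I=\{1,\dots,N\}$. A Markov additive process (MAP) $(\xi,\Theta)$ is a regular Feller process in $\mathbb R\times\mathcal I$ with laws $\mathtt P_{x,i}$ (starting from $\xi(0)=x$, $\Theta(0)=i$), cemetery $(-\infty,\dagger)$ and lifetime $\varsigma=\inf\{t>0:\Theta(t)=\dagger\}$ such that, with $(\mathcal G_t)$ its natural filtration, $\mathtt E_{x,i}[f(\xi(t+s)-\xi(t),\Theta(t+s))\mathbf 1_{\{t+s<\varsigma\}}\mid\mathcal G_t]=\mathbf 1_{\{t<\varsigma\}}\mathtt E_{0,\Theta(t)}[f(\xi(s),\Theta(s))\mathbf 1_{\{s<\varsigma\}}]$ for all bounded measurable $f$ and all $s,t\ge0$. The chain $\Theta$ is assumed irreducible and ergodic with intensity matrix $Q=(q_{i,j})$. While $\Theta$ is in state $i$, $\xi$ evolves as a Lévy process $\xi_i$; when $\Theta$ jumps from $i$ to $j\neq i$, $\xi$ makes an additional independent jump distributed as $U_{i,j}$ ($U_{i,i}=0$, and $U_{i,j}=0$ if $q_{i,j}=0$). With $\mathbb E[\mathrm e^{z\xi_i(t)}]=\mathrm e^{\psi_i(z)t}$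 and $G_{i,j}(z)=\mathbb E[\mathrm e^{zU_{i,j}}]$, the matrix exponent is $F(z)=\mathrm{diag}(\psi_1(z),\dots,\psi_N(z))+Q\circ G(z)$ ($\circ$ = entrywise product), so that $\mathtt E_{0,i}[\mathrm e^{z\xi(t)}\mathbf 1_{\{\Theta(t)=j\}}]=(\mathrm e^{F(z)t})_{i,j}$. For real $z$ such that $F(z)$ is well-defined, $\chi(z)$ denotes its leading (Perron–Frobenius) eigenvalue: the real simple eigenvalue larger than the real parts of all other eigenvalues.
   Formalization: "Any initial distribution" fails when E e^{γξ(0)} is infinite (e.g. N=1, ξ(t)=ξ(0)−t, so I(ξ)=e^{ξ(0)}); the finite moment is proved for every deterministic start (x,i) and for every initial distribution with E e^{γξ(0)} finite. *)

theory Defs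
  imports "HOL-Probability.Probability" "HOL-Computational_Algebra.Polynomial"
begin

section \<open>Markov additive processes\<close>

text \<open>
  The modulating space is an arbitrary finite type \<open>'n\<close>, with \<open>N = CARD('n)\<close>. The cemetery is
  \<open>(- \<infinity>, None)\<close>, so \<open>\<xi>\<close> is \<open>ereal\<close>-valued and \<open>\<Theta>\<close> is \<open>'n option\<close>-valued.
  Time is \<open>real\<close>; only nonnegative times are constrained.
\<close>

definition lifetime :: "(real \<Rightarrow> 'a \<Rightarrow> 'n option) \<Rightarrow> 'a \<Rightarrow> ereal" where
  "lifetime \<Theta> \<omega> = Inf (ereal ` {t. 0 < t \<and> \<Theta> t \<omega> = None})"

definition state_space :: "(real \<times> 'n) measure" where
  "state_space = borel \<Otimes>\<^sub>M count_space UNIV"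

definition path_space :: "real set \<Rightarrow> (real \<Rightarrow> ereal \<times> 'n option) measure" where
  "path_space I = (\<Pi>\<^sub>M t\<in>I. borel \<Otimes>\<^sub>M count_space UNIV)"

definition path_on ::
  "real set \<Rightarrow> (real \<Rightarrow> 'a \<Rightarrow> ereal) \<Rightarrow> (real \<Rightarrow> 'a \<Rightarrow> 'n option) \<Rightarrow> 'a \<Rightarrow> real \<Rightarrow> ereal \<times> 'n option"
  where "path_on I \<xi> \<Theta> \<omega> = (\<lambda>t\<in>I. (\<xi> t \<omega>, \<Theta> t \<omega>))"

definition natural_filtration ::
  "'a measure \<Rightarrow> (real \<Rightarrow> 'a \<Rightarrow> ereal) \<Rightarrow> (real \<Rightarrow> 'a \<Rightarrow> 'n option) \<Rightarrow> real \<Rightarrow> 'a measure" where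
  "natural_filtration M \<xi> \<Theta> t =
     vimage_algebra (space M) (path_on {0..t} \<xi> \<Theta>) (path_space {0..t})"

text \<open>\<open>alive_value \<xi> \<Theta> f t \<omega>\<close> is \<open>f (\<xi>(t), \<Theta>(t)) 1{t < \<varsigma>}\<close>.\<close>

definition alive_value ::
  "(real \<Rightarrow> 'a \<Rightarrow> ereal) \<Rightarrow> (real \<Rightarrow> 'a \<Rightarrow> 'n option) \<Rightarrow> (real \<times> 'n \<Rightarrow> real) \<Rightarrow> real \<Rightarrow> 'a \<Rightarrow> real" where
  "alive_value \<xi> \<Theta> f t \<omega> =
     (if ereal t < lifetime \<Theta> \<omega> then f (real_of_ereal (\<xi> t \<omega>), the (\<Theta> t \<omega>)) else 0)"

text \<open>\<open>C\<^sub>0\<close> of the product of the line with the discrete space \<open>'n\<close>.\<close>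

definition C0 :: "(real \<times> 'n \<Rightarrow> real) set" where
  "C0 = {f. \<forall>i. continuous_on UNIV (\<lambda>x. f (x, i)) \<and> ((\<lambda>x. f (x, i)) \<longlongrightarrow> 0) at_infinity}"

definition transition_op ::
  "(real \<Rightarrow> 'n \<Rightarrow> 'a measure) \<Rightarrow> (real \<Rightarrow> 'a \<Rightarrow> ereal) \<Rightarrow> (real \<Rightarrow> 'a \<Rightarrow> 'n option)
    \<Rightarrow> real \<Rightarrow> (real \<times> 'n \<Rightarrow> real) \<Rightarrow> real \<times> 'n \<Rightarrow> real" where
  "transition_op P \<xi> \<Theta> t f = (\<lambda>(x, i). \<integral>\<omega>. alive_value \<xi> \<Theta> f t \<omega> \<partial>P x i)"

locale markov_additive_process =
  fixes M :: "'a measure"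
    and P :: "real \<Rightarrow> 'n::finite \<Rightarrow> 'a measure"
    and \<xi> :: "real \<Rightarrow> 'a \<Rightarrow> ereal"
    and \<Theta> :: "real \<Rightarrow> 'a \<Rightarrow> 'n option"
  assumes kernel: "(\<lambda>(x, i). P x i) \<in> state_space \<rightarrow>\<^sub>M prob_algebra M"
    and measurable_\<xi>: "\<And>t. 0 \<le> t \<Longrightarrow> \<xi> t \<in> M \<rightarrow>\<^sub>M borel"
    and measurable_\<Theta>: "\<And>t. 0 \<le> t \<Longrightarrow> \<Theta> t \<in> M \<rightarrow>\<^sub>M count_space UNIV"
    and start: "\<And>x i. AE \<omega> in P x i. \<xi> 0 \<omega> = ereal x \<and> \<Theta> 0 \<omega> = Some i"
    \<comment> \<open>the process lives in \<open>(\<real> \<times> 'n) \<union> {(- \<infinity>, None)}\<close> and is absorbed in the cemetery\<close>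
    and not_top: "\<And>t \<omega>. 0 \<le> t \<Longrightarrow> \<omega> \<in> space M \<Longrightarrow> \<xi> t \<omega> \<noteq> \<infinity>"
    and cemetery: "\<And>t \<omega>. 0 \<le> t \<Longrightarrow> \<omega> \<in> space M \<Longrightarrow> \<Theta> t \<omega> = None \<longleftrightarrow> \<xi> t \<omega> = - \<infinity>"
    and absorbing: "\<And>s t \<omega>. 0 \<le> s \<Longrightarrow> s \<le> t \<Longrightarrow> \<omega> \<in> space M \<Longrightarrow> \<Theta> s \<omega> = None \<Longrightarrow> \<Theta> t \<omega> = None"
    \<comment> \<open>regularity of the paths: right-continuous, with left limits before the lifetime\<close>
    and right_continuous:
      "\<And>t \<omega>. 0 \<le> t \<Longrightarrow> \<omega> \<in> space M \<Longrightarrow>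
         ((\<lambda>s. \<xi> s \<omega>) \<longlongrightarrow> \<xi> t \<omega>) (at_right t) \<and> (\<forall>\<^sub>F s in at_right t. \<Theta> s \<omega> = \<Theta> t \<omega>)"
    and left_limits:
      "\<And>t \<omega>. 0 < t \<Longrightarrow> \<omega> \<in> space M \<Longrightarrow> ereal t < lifetime \<Theta> \<omega> \<Longrightarrow>
         (\<exists>l. ((\<lambda>s. \<xi> s \<omega>) \<longlongrightarrow> ereal l) (at_left t)) \<and> (\<exists>j. \<forall>\<^sub>F s in at_left t. \<Theta> s \<omega> = Some j)"
    \<comment> \<open>Feller property\<close>
    and feller_C0: "\<And>t f. 0 \<le> t \<Longrightarrow> f \<in> C0 \<Longrightarrow> transition_op P \<xi> \<Theta> t f \<in> C0"
    and feller_continuous: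
      "\<And>f. f \<in> C0 \<Longrightarrow> uniform_limit UNIV (\<lambda>t. transition_op P \<xi> \<Theta> t f) f (at_right 0)"
    \<comment> \<open>Markov additive property\<close>
    and markov_additive:
      "\<And>x i f s t. f \<in> borel_measurable state_space \<Longrightarrow> bounded (range f) \<Longrightarrow> 0 \<le> s \<Longrightarrow> 0 \<le> t \<Longrightarrow>
         AE \<omega> in P x i.
           real_cond_exp (P x i) (natural_filtration M \<xi> \<Theta> t)
             (\<lambda>\<omega>. if ereal (t + s) < lifetime \<Theta> \<omega>
                  then f (real_of_ereal (\<xi> (t + s) \<omega> - \<xi> t \<omega>), the (\<Theta> (t + s) \<omega>)) else 0) \<omega>
           = (if ereal t < lifetime \<Theta> \<omega>
              then \<integral>\<omega>'. alive_value \<xi> \<Theta> f s \<omega>' \<partial>P 0 (the (\<Theta> t \<omega>)) else 0)"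


section \<open>Characteristics: intensity matrix, Levy processes and transition jumps\<close>

text \<open>
  Irreducible intensity matrix. On a finite state space an irreducible continuous-time chain is
  automatically ergodic. Rows sum to zero: killing of the process is carried by the Levy processes
  (possibly killed), i.e. it enters the matrix exponent through \<open>\<psi>\<^sub>i(0) \<le> 0\<close>.
\<close>

definition irreducible_intensity_matrix :: "real^'n^'n \<Rightarrow> bool" where
  "irreducible_intensity_matrix Q \<longleftrightarrow>
     (\<forall>i j. i \<noteq> j \<longrightarrow> 0 \<le> Q $ i $ j) \<and>
     (\<forall>i. (\<Sum>j\<in>UNIV. Q $ i $ j) = 0) \<and>
     (\<forall>i j. (i, j) \<in> {(a, b). a \<noteq> b \<and> 0 < Q $ a $ b}\<^sup>*)"

definition real_path :: "(real \<Rightarrow> 'w \<Rightarrow> real) \<Rightarrow> 'w \<Rightarrow> real \<Rightarrow> real" where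
  "real_path X \<omega> = (\<lambda>t\<in>{0..}. X t \<omega>)"

definition real_path_space :: "(real \<Rightarrow> real) measure" where
  "real_path_space = (\<Pi>\<^sub>M t\<in>{0..}. borel)"

definition levy_process :: "'w measure \<Rightarrow> (real \<Rightarrow> 'w \<Rightarrow> real) \<Rightarrow> bool" where
  "levy_process R X \<longleftrightarrow>
     prob_space R \<and>
     (\<forall>t\<ge>0. X t \<in> borel_measurable R) \<and>
     (\<forall>\<omega>\<in>space R. X 0 \<omega> = 0) \<and>
     (\<forall>\<omega>\<in>space R. \<forall>t\<ge>0. ((\<lambda>s. X s \<omega>) \<longlongrightarrow> X t \<omega>) (at_right t)) \<and>
     (\<forall>\<omega>\<in>space R. \<forall>t>0. \<exists>l. ((\<lambda>s. X s \<omega>) \<longlongrightarrow> l) (at_left t)) \<and>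
     (\<forall>u::nat \<Rightarrow> real. mono u \<and> 0 \<le> u 0 \<longrightarrow>
        prob_space.indep_vars R (\<lambda>_. borel) (\<lambda>n \<omega>. X (u (Suc n)) \<omega> - X (u n) \<omega>) UNIV) \<and>
     (\<forall>s\<ge>0. \<forall>t\<ge>0. distr R borel (\<lambda>\<omega>. X (s + t) \<omega> - X s \<omega>) = distr R borel (X t))"

text \<open>Exponential time of rate \<open>r \<ge> 0\<close>; for \<open>r = 0\<close> it is almost surely infinite.\<close>

definition exponential_time :: "'w measure \<Rightarrow> real \<Rightarrow> ('w \<Rightarrow> ereal) \<Rightarrow> bool" where
  "exponential_time R r T \<longleftrightarrow>
     T \<in> borel_measurable R \<and> (\<forall>\<omega>\<in>space R. 0 \<le> T \<omega>) \<and>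
     (\<forall>t\<ge>0. measure R {\<omega>\<in>space R. ereal t < T \<omega>} = exp (- r * t))"

text \<open>
  The independent ingredients from which a Markov additive process is built. Index \<open>n\<close> is the number
  of jumps the modulating chain has made so far; what happens between the \<open>n\<close>-th and the next jump,
  if the chain is then in state \<open>i\<close>, is governed by a copy \<open>levy n i\<close> of the Levy process, killed at
  time \<open>kill n i\<close>, run for the holding time \<open>hold n i\<close>, after which the chain moves to
  \<open>goto n i\<close> and, if this is \<open>j\<close>, the copy \<open>jump n i j\<close> of \<open>U\<^sub>i\<^sub>j\<close> is added.
\<close>

record ('w, 'n) map_ingredients =
  noise :: "'w measure"
  levy :: "nat \<Rightarrow> 'n \<Rightarrow> real \<Rightarrow> 'w \<Rightarrow> real"
  kill :: "nat \<Rightarrow> 'n \<Rightarrow> 'w \<Rightarrow> ereal"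
  hold :: "nat \<Rightarrow> 'n \<Rightarrow> 'w \<Rightarrow> ereal"
  goto :: "nat \<Rightarrow> 'n \<Rightarrow> 'w \<Rightarrow> 'n"
  jump :: "nat \<Rightarrow> 'n \<Rightarrow> 'n \<Rightarrow> 'w \<Rightarrow> real"

datatype 'n source = Levy nat 'n | Kill nat 'n | Hold nat 'n | Goto nat 'n | Jump nat 'n 'n

fun source_algebra :: "('w, 'n) map_ingredients \<Rightarrow> 'n source \<Rightarrow> 'w measure" where
  "source_algebra W (Levy n i) =
     vimage_algebra (space (noise W)) (real_path (levy W n i)) real_path_space"
| "source_algebra W (Kill n i) = vimage_algebra (space (noise W)) (kill W n i) borel"
| "source_algebra W (Hold n i) = vimage_algebra (space (noise W)) (hold W n i) borel"
| "source_algebra W (Goto n i) = vimage_algebra (space (noise W)) (goto W n i) (count_space UNIV)"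
| "source_algebra W (Jump n i j) = vimage_algebra (space (noise W)) (jump W n i j) borel"

text \<open>
  \<open>k i\<close> is the killing rate of the \<open>i\<close>-th Levy process. The reference copies of \<open>\<xi>\<^sub>i\<close> and
  \<open>U\<^sub>i\<^sub>j\<close> are those with index 0.
\<close>

definition ingredients_for ::
  "real^'n^'n \<Rightarrow> ('n \<Rightarrow> real) \<Rightarrow> ('w, 'n::finite) map_ingredients \<Rightarrow> bool" where
  "ingredients_for Q k W \<longleftrightarrow>
     prob_space (noise W) \<and>
     prob_space.indep_sets (noise W) (\<lambda>c. sets (source_algebra W c)) UNIV \<and>
     (\<forall>i. 0 \<le> k i) \<and>
     (\<forall>n i. levy_process (noise W) (levy W n i) \<and>
            distr (noise W) real_path_space (real_path (levy W n i)) =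
            distr (noise W) real_path_space (real_path (levy W 0 i))) \<and>
     (\<forall>n i. exponential_time (noise W) (k i) (kill W n i)) \<and>
     (\<forall>n i. exponential_time (noise W) (- Q $ i $ i) (hold W n i)) \<and>
     (\<forall>n i. goto W n i \<in> noise W \<rightarrow>\<^sub>M count_space UNIV) \<and>
     (\<forall>n i j. Q $ i $ i < 0 \<and> j \<noteq> i \<longrightarrow>
        measure (noise W) {\<omega>\<in>space (noise W). goto W n i \<omega> = j} = Q $ i $ j / (- Q $ i $ i)) \<and>
     (\<forall>n i j. jump W n i j \<in> borel_measurable (noise W) \<and>
        distr (noise W) borel (jump W n i j) = distr (noise W) borel (jump W 0 i j)) \<and>
     (\<forall>n i j. i = j \<or> Q $ i $ j = 0 \<longrightarrow> (AE \<omega> in noise W. jump W n i j \<omega> = 0))"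

fun jump_chain :: "('w, 'n) map_ingredients \<Rightarrow> 'n \<Rightarrow> nat \<Rightarrow> 'w \<Rightarrow> 'n" where
  "jump_chain W i 0 \<omega> = i"
| "jump_chain W i (Suc n) \<omega> = goto W n (jump_chain W i n \<omega>) \<omega>"

fun jump_time :: "('w, 'n) map_ingredients \<Rightarrow> 'n \<Rightarrow> nat \<Rightarrow> 'w \<Rightarrow> ereal" where
  "jump_time W i 0 \<omega> = 0"
| "jump_time W i (Suc n) \<omega> = jump_time W i n \<omega> + hold W n (jump_chain W i n \<omega>) \<omega>"

text \<open>Position just after the \<open>n\<close>-th jump of the chain (meaningless if that jump never happens).\<close>

fun jump_position :: "('w, 'n) map_ingredients \<Rightarrow> real \<Rightarrow> 'n \<Rightarrow> nat \<Rightarrow> 'w \<Rightarrow> real" where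
  "jump_position W x i 0 \<omega> = x"
| "jump_position W x i (Suc n) \<omega> =
     (let a = jump_chain W i n \<omega>; b = jump_chain W i (Suc n) \<omega> in
      jump_position W x i n \<omega> + levy W n a (real_of_ereal (hold W n a \<omega>)) \<omega> + jump W n a b \<omega>)"

text \<open>
  The path started from \<open>(x, i)\<close>, assembled from the ingredients. The event that infinitely many
  jumps accumulate before time \<open>t\<close> is null; there the cemetery is used as default.
\<close>

definition map_path :: "('w, 'n) map_ingredients \<Rightarrow> real \<Rightarrow> 'n \<Rightarrow> real \<Rightarrow> 'w \<Rightarrow> ereal \<times> 'n option" where
  "map_path W x i t \<omega> =
     (let n = (LEAST n. ereal t < jump_time W i (Suc n) \<omega>);
          a = jump_chain W i n \<omega>;
          age = t - real_of_ereal (jump_time W i n \<omega>)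
      in if (\<exists>n. ereal t < jump_time W i (Suc n) \<omega>) \<and>
            (\<forall>m<n. hold W m (jump_chain W i m \<omega>) \<omega> < kill W m (jump_chain W i m \<omega>) \<omega>) \<and>
            ereal age < kill W n a \<omega>
         then (ereal (jump_position W x i n \<omega> + levy W n a age \<omega>), Some a)
         else (- \<infinity>, None))"

text \<open>
  \<open>(\<xi>, \<Theta>)\<close> evolves according to the given ingredients: under each \<open>P x i\<close> its law is that of the
  assembled path.
\<close>

definition has_ingredients ::
  "(real \<Rightarrow> 'n \<Rightarrow> 'a measure) \<Rightarrow> (real \<Rightarrow> 'a \<Rightarrow> ereal) \<Rightarrow> (real \<Rightarrow> 'a \<Rightarrow> 'n option)
    \<Rightarrow> ('w, 'n) map_ingredients \<Rightarrow> bool" where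
  "has_ingredients P \<xi> \<Theta> W \<longleftrightarrow>
     (\<forall>x i. distr (P x i) (path_space {0..}) (path_on {0..} \<xi> \<Theta>) =
            distr (noise W) (path_space {0..}) (\<lambda>\<omega>. \<lambda>t\<in>{0..}. map_path W x i t \<omega>))"


section \<open>Matrix exponent and leading eigenvalue\<close>

text \<open>
  \<open>E [exp (z \<xi>\<^sub>i(t))] = exp (\<psi> t)\<close> for all \<open>t \<ge> 0\<close>, where the killed Levy process contributes 0
  once it is killed (also for \<open>z = 0\<close>).
\<close>

definition has_laplace_exponent :: "('w, 'n) map_ingredients \<Rightarrow> 'n \<Rightarrow> real \<Rightarrow> real \<Rightarrow> bool" where
  "has_laplace_exponent W i z \<psi> \<longleftrightarrow>
     (\<forall>t\<ge>0. has_bochner_integral (noise W)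
        (\<lambda>\<omega>. if ereal t < kill W 0 i \<omega> then exp (z * levy W 0 i t \<omega>) else 0) (exp (\<psi> * t)))"

definition laplace_exponent :: "('w, 'n) map_ingredients \<Rightarrow> 'n \<Rightarrow> real \<Rightarrow> real" where
  "laplace_exponent W i z = (THE \<psi>. has_laplace_exponent W i z \<psi>)"

definition jump_transform :: "('w, 'n) map_ingredients \<Rightarrow> real \<Rightarrow> real^'n^'n" where
  "jump_transform W z = (\<chi> i j. \<integral>\<omega>. exp (z * jump W 0 i j \<omega>) \<partial>noise W)"

definition matrix_exponent :: "real^'n^'n \<Rightarrow> ('w, 'n) map_ingredients \<Rightarrow> real \<Rightarrow> real^'n^'n" where
  "matrix_exponent Q W z =
     (\<chi> i j. (if i = j then laplace_exponent W i z else 0) + Q $ i $ j * jump_transform W z $ i $ j)"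

definition matrix_exponent_defined :: "('w, 'n) map_ingredients \<Rightarrow> real \<Rightarrow> bool" where
  "matrix_exponent_defined W z \<longleftrightarrow>
     (\<forall>i. \<exists>\<psi>. has_laplace_exponent W i z \<psi>) \<and>
     (\<forall>i j. integrable (noise W) (\<lambda>\<omega>. exp (z * jump W 0 i j \<omega>)))"

definition complexify :: "real^'n^'n \<Rightarrow> complex^'n^'n" where
  "complexify A = (\<chi> i j. complex_of_real (A $ i $ j))"

definition is_eigenvalue :: "complex^'n^'n \<Rightarrow> complex \<Rightarrow> bool" where
  "is_eigenvalue A c \<longleftrightarrow> (\<exists>v. v \<noteq> 0 \<and> A *v v = c *s v)"

definition characteristic_poly :: "complex^'n^'n \<Rightarrow> complex poly" where
  "characteristic_poly A = det ((\<chi> i j. (if i = j then [:0, 1:] else 0) - [:A $ i $ j:]) :: complex poly^'n^'n)"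

text \<open>``Simple'' refers to the algebraic multiplicity.\<close>

definition is_leading_eigenvalue :: "real^'n^'n \<Rightarrow> real \<Rightarrow> bool" where
  "is_leading_eigenvalue A r \<longleftrightarrow>
     is_eigenvalue (complexify A) (of_real r) \<and>
     order (of_real r) (characteristic_poly (complexify A)) = 1 \<and>
     (\<forall>c. is_eigenvalue (complexify A) c \<and> c \<noteq> of_real r \<longrightarrow> Re c < r)"


section \<open>Exponential functional\<close>

definition exp_ereal :: "ereal \<Rightarrow> ennreal" where
  "exp_ereal y = (if y = - \<infinity> then 0 else if y = \<infinity> then \<infinity> else ennreal (exp (real_of_ereal y)))"

definition exponential_functional :: "(real \<Rightarrow> 'a \<Rightarrow> ereal) \<Rightarrow> 'a \<Rightarrow> ennreal" where
  "exponential_functional \<xi> \<omega> = (\<integral>\<^sup>+ s\<in>{0..}. exp_ereal (\<xi> s \<omega>) \<partial>lborel)"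

text \<open>Only used for positive exponents.\<close>

definition ennreal_power :: "ennreal \<Rightarrow> real \<Rightarrow> ennreal" where
  "ennreal_power y p = (if y = \<infinity> then \<infinity> else ennreal (enn2real y powr p))"

definition finite_moment :: "'a measure \<Rightarrow> real \<Rightarrow> ('a \<Rightarrow> ennreal) \<Rightarrow> bool" where
  "finite_moment M p X \<longleftrightarrow> (\<integral>\<^sup>+ \<omega>. ennreal_power (X \<omega>) p \<partial>M) < \<infinity>"

text \<open>
  The law of the process when \<open>(\<xi>(0), \<Theta>(0))\<close> has distribution \<open>\<mu>\<close>. The exponential functional
  under it is \<open>exp (\<xi>(0))\<close> times the functional of \<open>\<xi> - \<xi>(0)\<close>, and given \<open>\<Theta>(0)\<close> the factors are
  independent, so its moment of order \<open>\<gamma>\<close> can only be finite if \<open>exp (\<gamma> \<xi>(0))\<close> is \<open>\<mu>\<close>-integrable.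
\<close>

definition initial_law :: "(real \<Rightarrow> 'n \<Rightarrow> 'a measure) \<Rightarrow> (real \<times> 'n) measure \<Rightarrow> 'a measure" where
  "initial_law P \<mu> = \<mu> \<bind> (\<lambda>(x, i). P x i)"

end

theory Submission
  imports Defs
begin

text \<open>
  Since the matrix \<open>F(\<gamma>)\<close> has nonnegative off-diagonal entries and no eigenvalue in \<open>[0, \<infinity>)\<close>, the
  solution of \<open>F(\<gamma>) v = - 1\<close> is positive, so \<open>F(\<gamma>) v \<le> \<kappa> v\<close> for some \<open>\<kappa> < 0\<close>. Hence
  \<open>exp (\<gamma> \<xi>(t) - \<kappa> t) v(\<Theta>(t))\<close> is a supermartingale; comparing its values at successive jump times of
  the modulating chain and summing up gives \<open>E[exp (\<gamma> \<xi>(t))] = O(exp (\<kappa> t))\<close>.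

  For small \<open>d\<close> the process loses at most 1 during a time \<open>r \<le> d\<close> with probability at least 1/2,
  from any state. By the Markov property at the first passage above a level, the maximum of
  \<open>exp (\<gamma> \<xi>)\<close> over a block of length \<open>d\<close> then has expectation at most \<open>2 exp \<gamma>\<close> times that of its
  value at the end of the block. The integral of \<open>exp \<xi>\<close> is at most the sum over the blocks of \<open>d\<close>
  times the maximum, and geometric weights handle the power \<open>\<gamma>\<close> of this sum, uniformly in \<open>\<gamma> > 0\<close>.
\<close>

section \<open>Metzler matrices with negative leading eigenvalue\<close>

text \<open>The obstacle is the passage from single times to whole paths: the matrix exponent
  controls \<open>\<xi>\<close> only at fixed times, and no exponential moment of a running maximum
  is assumed. Comparing the maximum over a block with the value at the end of the block, instead of
  at its start, changes what must be controlled: only large losses over a short time have to be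
  unlikely, and right-continuity at 0 provides this. A strict subsolution takes the place of the
  Perron-Frobenius eigenvector because an inequality is all that a supermartingale argument uses,
  and it comes from a single linear system. The two halves of the proof live on different spaces.
  Moments at fixed times are computed on the independent ingredients, where every holding period
  factorises, and are carried over by equality of laws; the maximal inequality uses the Markov
  additive property of the abstract process. The exponential functional enters only through a
  measurable upper bound that serves all initial states at once.\<close>

lemma continuous_on_det:
  fixes A :: "'a::topological_space \<Rightarrow> real^'n^'n"
  assumes "\<And>i j. continuous_on S (\<lambda>x. A x $ i $ j)"
  shows "continuous_on S (\<lambda>x. det (A x))"
  unfolding det_def using assms by (intro continuous_on_sum continuous_on_mult continuous_on_prod continuous_on_const)

text \<open>Homotopy in \<open>\<tau>\<close>: the solution of \<open>(\<tau> I - A) x = 1\<close>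
  depends continuously on \<open>\<tau> \<ge> 0\<close>, is nonnegative for large
  \<open>\<tau>\<close>, and cannot lose positivity on the way down to 0, because a minimal
  coordinate equal to 0 would give \<open>1 \<le> 0\<close> in its row.\<close>

lemma metzler_positive_solution:
  fixes A :: "real^'n^'n"
  assumes offdiag: "\<And>i j. i \<noteq> j \<Longrightarrow> 0 \<le> A $ i $ j"
    and no_eigenvalue: "\<And>\<tau> x. 0 \<le> \<tau> \<Longrightarrow> A *v x = \<tau> *s x \<Longrightarrow> x = 0"
  shows "\<exists>v. (\<forall>i. 0 < v $ i) \<and> (\<forall>i. (A *v v) $ i = - 1)"
proof -
  define B where "B \<tau> = (\<chi> i j. (if i = j then \<tau> else 0) - A $ i $ j)" for \<tau> :: real
  \<comment> \<open>Cramer's rule instead of an abstract inverse: a quotient of determinants is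
    visibly continuous in \<open>\<tau>\<close>.\<close>
  define x where "x \<tau> = (\<chi> k. det (\<chi> i j. if j = k then 1 else B \<tau> $ i $ j) / det (B \<tau>))" for \<tau> :: real
  have B_mult: "B \<tau> *v y = \<tau> *s y - A *v y" for \<tau> y
  proof -
    have "(\<Sum>j\<in>UNIV. ((if i = j then \<tau> else 0) - A $ i $ j) * y $ j)
        = (\<Sum>j\<in>UNIV. (if i = j then \<tau> * y $ j else 0) - A $ i $ j * y $ j)" for i
      by (rule sum.cong) (auto simp: algebra_simps)
    then show ?thesis
      by (simp add: vec_eq_iff B_def matrix_vector_mult_def sum_subtractf)
  qed
  have det_B: "det (B \<tau>) \<noteq> 0" if "0 \<le> \<tau>" for \<tau>
  proof -
    have "inj ((*v) (B \<tau>))"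
    proof (rule injI)
      fix y z assume "B \<tau> *v y = B \<tau> *v z"
      then have "B \<tau> *v (y - z) = 0"
        by (simp add: matrix_vector_mult_diff_distrib)
      then have "A *v (y - z) = \<tau> *s (y - z)" by (simp add: B_mult)
      then show "y = z" using no_eigenvalue[OF that] by fastforce
    qed
    then show ?thesis
      by (simp add: invertible_det_nz[symmetric] invertible_left_inverse matrix_left_invertible_injective)
  qed
  have sol: "B \<tau> *v x \<tau> = (\<chi> i. 1)" if "0 \<le> \<tau>" for \<tau>
    unfolding cramer[OF det_B[OF that]] x_def by (simp add: vec_eq_iff cong: if_cong)
  \<comment> \<open>At a minimal coordinate the off-diagonal signs allow every
    \<open>x \<tau> $ j\<close> to be replaced by \<open>x \<tau> $ k\<close>, so that the row sees
    only one coordinate of the solution.\<close>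
  have row: "1 \<le> (\<tau> - (\<Sum>j\<in>UNIV. A $ k $ j)) * x \<tau> $ k"
    if "0 \<le> \<tau>" and min: "\<And>j. x \<tau> $ k \<le> x \<tau> $ j" for \<tau> k
  proof -
    have "\<tau> * x \<tau> $ k - (\<Sum>j\<in>UNIV. A $ k $ j * x \<tau> $ j) = 1"
      using arg_cong[OF sol[OF that(1), unfolded B_mult], of "\<lambda>v. v $ k"]
      by (simp add: matrix_vector_mult_def)
    moreover have "(\<Sum>j\<in>UNIV. A $ k $ j * x \<tau> $ k) \<le> (\<Sum>j\<in>UNIV. A $ k $ j * x \<tau> $ j)"
    proof (rule sum_mono)
      fix j show "A $ k $ j * x \<tau> $ k \<le> A $ k $ j * x \<tau> $ j"
        using offdiag[of k j] min[of j] by (cases "j = k") (auto intro: mult_left_mono)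
    qed
    ultimately show ?thesis by (simp add: algebra_simps sum_distrib_left)
  qed
  have argmin: "\<exists>k. \<forall>j. x \<tau> $ k \<le> x \<tau> $ j" for \<tau>
    using ex_min_if_finite[of "range (\<lambda>k. x \<tau> $ k)"] by (auto simp: not_less)
  have pos: "0 < x \<tau> $ k" if "0 \<le> \<tau>" "\<And>j. 0 \<le> x \<tau> $ j" for \<tau> k
  proof -
    obtain m where m: "\<And>j. x \<tau> $ m \<le> x \<tau> $ j" using argmin by blast
    have "x \<tau> $ m \<noteq> 0" using row[OF that(1) m] by auto
    then show ?thesis using m[of k] that(2)[of m] by auto
  qed
  \<comment> \<open>Chosen to dominate every row sum of \<open>A\<close>: the factor in
    \<open>row\<close> is then nonnegative, so the minimal coordinate cannot be negative.\<close>
  define \<tau>1 where "\<tau>1 = (\<Sum>i\<in>UNIV. \<bar>\<Sum>j\<in>UNIV. A $ i $ j\<bar>)"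
  have "0 \<le> \<tau>1" by (simp add: \<tau>1_def sum_nonneg)
  have large: "0 \<le> x \<tau>1 $ j" for j
  proof -
    obtain m where m: "\<And>j. x \<tau>1 $ m \<le> x \<tau>1 $ j" using argmin by blast
    have "(\<Sum>j\<in>UNIV. A $ m $ j) \<le> \<bar>\<Sum>j\<in>UNIV. A $ m $ j\<bar>" by simp
    also have "\<dots> \<le> \<tau>1" unfolding \<tau>1_def by (rule member_le_sum) auto
    finally have "0 \<le> x \<tau>1 $ m"
      using row[OF \<open>0 \<le> \<tau>1\<close> m]
      by (metis diff_ge_0_iff_ge linorder_not_le mult_nonneg_nonpos not_one_le_zero
          order_less_imp_le order_trans)
    then show ?thesis using m[of j] by simp
  qed
  have cont_B: "continuous_on {0..\<tau>1} (\<lambda>\<tau>. B \<tau> $ i $ j)" for i j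
    by (cases "i = j") (simp_all add: B_def continuous_on_diff)
  have cont: "continuous_on {0..\<tau>1} x"
    unfolding x_def
  proof (intro continuous_on_vec_lambda continuous_on_divide continuous_on_det)
    fix k i j
    show "continuous_on {0..\<tau>1} (\<lambda>\<tau>. (\<chi> i j. if j = k then 1 else B \<tau> $ i $ j) $ i $ j)"
      using cont_B by (cases "j = k") simp_all
  qed (use cont_B det_B in auto)
  \<comment> \<open>Strict positivity gives an open condition and nonnegativity a closed one; by
    \<open>pos\<close> they describe the same set, which is therefore all of the connected
    interval.\<close>
  define T where "T = {0..\<tau>1} \<inter> x -` {y. \<forall>k. 0 < y $ k}"
  have T': "T = {0..\<tau>1} \<inter> x -` {y. \<forall>k. 0 \<le> y $ k}"
    unfolding T_def using pos by (auto intro: less_imp_le)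
  have "open {y :: real^'n. \<forall>k. 0 < y $ k}"
    unfolding Collect_all_eq
    by (intro open_INT) (auto intro!: open_Collect_less continuous_intros)
  then have "openin (top_of_set {0..\<tau>1}) T"
    unfolding T_def using cont by (rule continuous_openin_preimage_gen[rotated])
  moreover have "closed {y :: real^'n. \<forall>k. 0 \<le> y $ k}"
    unfolding Collect_all_eq
    by (intro closed_INT) (auto intro!: closed_Collect_le continuous_intros)
  then have "closedin (top_of_set {0..\<tau>1}) T"
    unfolding T' using cont by (rule continuous_closedin_preimage[rotated])
  moreover have "\<tau>1 \<in> T" unfolding T' using large \<open>0 \<le> \<tau>1\<close> by auto
  ultimately have "T = {0..\<tau>1}"
    using connected_clopen[of "{0..\<tau>1}"] by (metis connected_Icc empty_iff)
  then have "0 \<in> T" using \<open>0 \<le> \<tau>1\<close> by auto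
  then have "\<forall>i. 0 < x 0 $ i" by (simp add: T_def)
  moreover have "\<forall>i. (A *v x 0) $ i = - 1"
  proof
    fix i
    have "(B 0 *v x 0) $ i = 1" using sol[of 0] by simp
    then show "(A *v x 0) $ i = - 1" by (simp add: B_mult)
  qed
  ultimately show ?thesis by blast
qed

text \<open>A real eigenvalue \<open>\<tau> \<ge> 0\<close> would also be one of the complexified
  matrix and would lie to the right of \<open>r < 0\<close>, so the homotopy applies and yields
  \<open>A *v v = - 1\<close>.\<close>

lemma leading_eigenvalue_negative_subsolution:
  fixes A :: "real^'n^'n"
  assumes "is_leading_eigenvalue A r" and "r < 0"
    and offdiag: "\<And>i j. i \<noteq> j \<Longrightarrow> 0 \<le> A $ i $ j"
  shows "\<exists>v \<kappa>. \<kappa> < 0 \<and> (\<forall>i. 0 < v $ i) \<and> (\<forall>i. (A *v v) $ i \<le> \<kappa> * v $ i)"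
proof -
  have "x = 0" if "0 \<le> \<tau>" "A *v x = \<tau> *s x" for \<tau> x
  proof (rule ccontr)
    assume "x \<noteq> 0"
    define y :: "complex^'n" where "y = (\<chi> i. complex_of_real (x $ i))"
    have "y \<noteq> 0" using \<open>x \<noteq> 0\<close> by (auto simp: y_def vec_eq_iff)
    moreover have "complexify A *v y = complex_of_real \<tau> *s y"
    proof -
      have "(\<Sum>j\<in>UNIV. A $ i $ j * x $ j) = \<tau> * x $ i" for i
        using arg_cong[OF that(2), of "\<lambda>v. v $ i"] by (simp add: matrix_vector_mult_def)
      then show ?thesis
        by (simp add: vec_eq_iff complexify_def matrix_vector_mult_def y_def
            flip: of_real_mult of_real_sum)
    qed
    ultimately have "is_eigenvalue (complexify A) (of_real \<tau>)"
      unfolding is_eigenvalue_def by blast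
    then have "\<tau> < r \<or> \<tau> = r"
      using assms(1) unfolding is_leading_eigenvalue_def by fastforce
    then show False using that(1) assms(2) by simp
  qed
  then obtain v where v: "\<And>i. 0 < v $ i" "\<And>i. (A *v v) $ i = - 1"
    using metzler_positive_solution[OF offdiag] by blast
  \<comment> \<open>Any upper bound of the entries works: \<open>v $ i \<le> m\<close> turns the
    right-hand side -1 into at most \<open>- (1 / m) * v $ i\<close>.\<close>
  define m where "m = (\<Sum>i\<in>UNIV. v $ i)"
  have le: "v $ i \<le> m" for i unfolding m_def using v(1) by (intro member_le_sum) (auto intro: less_imp_le)
  have "0 < m" using le v(1) by (metis less_le_trans)
  show ?thesis
  proof (intro exI conjI allI)
    show "- (1 / m) < 0" using \<open>0 < m\<close> by simp
    show "0 < v $ i" for i by (rule v)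
    show "(A *v v) $ i \<le> - (1 / m) * v $ i" for i
      using le[of i] \<open>0 < m\<close> by (simp add: v(2) divide_simps)
  qed
qed

section \<open>Powers of extended nonnegative reals\<close>

lemma ennreal_le_suminf:
  fixes f :: "nat \<Rightarrow> ennreal"
  shows "f n \<le> (\<Sum>n. f n)"
  using sum_le_suminf[OF summableI, of "{n}" f] by simp

lemma ennreal_power_mono:
  assumes "0 < p" "x \<le> y" shows "ennreal_power x p \<le> ennreal_power y p"
  using assms unfolding ennreal_power_def
  by (auto intro!: ennreal_leI powr_mono2 enn2real_mono simp: top.not_eq_extremum top_unique)

lemma ennreal_power_mult:
  assumes "0 \<le> c" "0 < p"
  shows "ennreal_power (ennreal c * x) p \<le> ennreal (c powr p) * ennreal_power x p"
proof (cases "x = \<infinity>")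
  case True
  then show ?thesis using assms by (cases "c = 0") (auto simp: ennreal_power_def ennreal_mult_top)
next
  case False
  then obtain y where "x = ennreal y" "0 \<le> y" by (cases x) auto
  then show ?thesis using assms
    by (simp add: ennreal_power_def powr_mult flip: ennreal_mult')
qed

text \<open>A substitute for Minkowski's inequality (\<open>p \<ge> 1\<close>) and subadditivity
  (\<open>p \<le> 1\<close>) that treats all \<open>p > 0\<close> alike. If the weighted sum is
  \<open>S\<close>, each single term gives \<open>a n \<le> S powr (1 / p) * r ^ n\<close> with
  \<open>r = q powr (- (1 / p)) < 1\<close>, and a geometric series remains.\<close>

lemma ennreal_power_suminf_le:
  assumes "0 < p" "1 < q"
  shows "\<exists>K. \<forall>a :: nat \<Rightarrow> ennreal. ennreal_power (\<Sum>n. a n) p \<le> ennreal K * (\<Sum>n. ennreal (q ^ n) * ennreal_power (a n) p)"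
proof -
  define r where "r = q powr (- (1 / p))"
  have r: "0 < r" "r < 1" using assms by (auto simp: r_def powr_less_one)
  define K where "K = (1 / (1 - r)) powr p"
  have "0 < K" using r by (simp add: K_def)
  have "ennreal_power (\<Sum>n. a n) p \<le> ennreal K * (\<Sum>n. ennreal (q ^ n) * ennreal_power (a n) p)"
    for a :: "nat \<Rightarrow> ennreal"
  proof (cases "(\<Sum>n. ennreal (q ^ n) * ennreal_power (a n) p) = \<infinity>")
    case True
    then show ?thesis using \<open>0 < K\<close> by (simp add: ennreal_mult_top)
  next
    case False
    then obtain S where S: "(\<Sum>n. ennreal (q ^ n) * ennreal_power (a n) p) = ennreal S" "0 \<le> S"
      by (cases "\<Sum>n. ennreal (q ^ n) * ennreal_power (a n) p") auto
    have term_le: "ennreal (q ^ n) * ennreal_power (a n) p \<le> ennreal S" for n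
      unfolding S(1)[symmetric]
      by (rule ennreal_le_suminf)
    have a_le: "a n \<le> ennreal (S powr (1 / p) * r ^ n)" for n
    proof -
      have "0 < q ^ n" using assms by simp
      have "a n \<noteq> \<infinity>"
      proof
        assume "a n = \<infinity>"
        then have "ennreal (q ^ n) * ennreal_power (a n) p = \<infinity>"
          using \<open>0 < q ^ n\<close> using assms by (simp add: ennreal_power_def ennreal_mult_top)
        then show False using term_le[of n] by (simp add: top_unique)
      qed
      then obtain y where y: "a n = ennreal y" "0 \<le> y" by (cases "a n") auto
      have "q ^ n * y powr p \<le> S"
        using term_le[of n] y S(2) \<open>0 < q ^ n\<close>
        by (simp add: ennreal_power_def flip: ennreal_mult')
      then have "y powr p \<le> S * q powr (- real n)"
        using \<open>0 < q ^ n\<close> assms by (simp add: powr_minus powr_realpow field_simps)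
      then have "(y powr p) powr (1 / p) \<le> (S * q powr (- real n)) powr (1 / p)"
        using assms by (intro powr_mono2) auto
      also have "\<dots> = S powr (1 / p) * r ^ n"
        using S(2) assms r by (simp add: powr_mult powr_powr r_def flip: powr_realpow)
      finally have "y \<le> S powr (1 / p) * r ^ n"
        using y assms by (simp add: powr_powr)
      then show ?thesis using y by (simp add: ennreal_leI)
    qed
    have "(\<Sum>n. a n) \<le> (\<Sum>n. ennreal (S powr (1 / p) * r ^ n))"
      by (intro suminf_le a_le) auto
    also have "\<dots> = ennreal (S powr (1 / p) * (1 / (1 - r)))"
    proof (rule suminf_ennreal_eq)
      show "0 \<le> S powr (1 / p) * r ^ i" for i using r by simp
      show "(\<lambda>n. S powr (1 / p) * r ^ n) sums (S powr (1 / p) * (1 / (1 - r)))"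
        using r by (intro sums_mult geometric_sums) auto
    qed
    finally have "ennreal_power (\<Sum>n. a n) p \<le> ennreal_power (ennreal (S powr (1 / p) * (1 / (1 - r)))) p"
      by (rule ennreal_power_mono[OF assms(1)])
    also have "\<dots> = ennreal (S * K)"
      using r S(2) assms by (simp add: ennreal_power_def K_def powr_mult powr_powr powr_divide)
    also have "\<dots> = ennreal K * ennreal S" using \<open>0 < K\<close> S(2) by (simp add: mult.commute ennreal_mult')
    finally show ?thesis using S(1) by simp
  qed
  then show ?thesis by blast
qed

lemma ennreal_power_inverse:
  assumes "0 < p"
  shows "ennreal_power (ennreal_power x p) (1 / p) = x" "ennreal_power (ennreal_power x (1 / p)) p = x"
  using assms by (cases x; simp add: ennreal_power_def powr_powr)+

section \<open>A maximal inequality\<close>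

text \<open>Translates tails of \<open>exp (p \<xi>)\<close> into level crossings of
  \<open>\<xi>\<close>, the form in which the maximal inequality is proved.\<close>

lemma exp_ereal_power_less_iff:
  assumes "0 < p" "0 < l"
  shows "ennreal l < ennreal_power (exp_ereal y) p \<longleftrightarrow> ereal (ln l / p) < y"
proof (cases y)
  case (real z)
  have "l < exp z powr p \<longleftrightarrow> ln l < p * z"
    using assms by (metis exp_gt_zero exp_less_cancel_iff exp_ln exp_powr_real mult.commute)
  then show ?thesis
    using assms real by (simp add: exp_ereal_def ennreal_power_def ennreal_less_iff field_simps)
qed (auto simp: exp_ereal_def ennreal_power_def assms)

lemma measurable_exp_ereal_power [measurable]:
  "(\<lambda>y. ennreal_power (exp_ereal y) p) \<in> borel_measurable borel"
proof -
  have "exp_ereal \<in> borel_measurable borel"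
    unfolding exp_ereal_def by measurable
  moreover have "(\<lambda>y. ennreal_power y p) \<in> borel_measurable borel"
    unfolding ennreal_power_def by measurable
  ultimately show ?thesis by measurable
qed

text \<open>The layer cake formula, by Fubini for the region \<open>0 < l < f x\<close>. It lets an
  inequality between tail probabilities at every level be integrated to one between
  expectations.\<close>

lemma nn_integral_eq_tail_integral:
  assumes "sigma_finite_measure N" and [measurable]: "f \<in> borel_measurable N"
  shows "(\<integral>\<^sup>+ x. f x \<partial>N) = (\<integral>\<^sup>+ l. indicator {0<..} l * emeasure N {x \<in> space N. ennreal l < f x} \<partial>lborel)"
proof -
  interpret sigma_finite_measure N by fact
  interpret pair_sigma_finite lborel N ..
  have *: "(\<integral>\<^sup>+ l. indicator {l. 0 < l \<and> ennreal l < y} l \<partial>lborel) = y" for y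
  proof (cases y)
    case (real z)
    have "{l. 0 < l \<and> ennreal l < y} = {0<..<z}"
      using real by (auto simp: ennreal_less_iff)
    then show ?thesis using real by simp
  next
    case top
    have "{l. 0 < l \<and> ennreal l < y} = {0::real<..}"
      using top by auto
    moreover have "emeasure lborel {0::real<..} = \<infinity>"
    proof (rule ccontr)
      assume "emeasure lborel {0::real<..} \<noteq> \<infinity>"
      then obtain c where c: "emeasure lborel {0::real<..} = ennreal c" "0 \<le> c"
        by (cases "emeasure lborel {0::real<..}") auto
      have "emeasure lborel {0<..<c + 1} \<le> emeasure lborel {0::real<..}"
        by (rule emeasure_mono) auto
      then show False using c by simp
    qed
    ultimately show ?thesis using top by simp
  qed
  have "(\<integral>\<^sup>+ x. f x \<partial>N) = (\<integral>\<^sup>+ x. \<integral>\<^sup>+ l. indicator {l. 0 < l \<and> ennreal l < f x} l \<partial>lborel \<partial>N)"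
    by (simp only: *)
  also have "\<dots> = (\<integral>\<^sup>+ l. \<integral>\<^sup>+ x. indicator {l. 0 < l \<and> ennreal l < f x} l \<partial>N \<partial>lborel)"
    by (rule Fubini') measurable
  also have "\<dots> = (\<integral>\<^sup>+ l. \<integral>\<^sup>+ x. indicator {0<..} l * indicator {x \<in> space N. ennreal l < f x} x \<partial>N \<partial>lborel)"
    by (intro nn_integral_cong) (auto split: split_indicator)
  also have "\<dots> = (\<integral>\<^sup>+ l. indicator {0<..} l * emeasure N {x \<in> space N. ennreal l < f x} \<partial>lborel)"
    by (simp add: nn_integral_cmult)
  finally show ?thesis .
qed

section \<open>First passage over a level within a short time block\<close>

context markov_additive_process
begin

lemma kernel_space: "P x i \<in> space (prob_algebra M)"
  using measurable_space[OF kernel, of "(x, i)"]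
  by (simp add: state_space_def space_pair_measure)

lemma sets_P [simp, measurable_cong]: "sets (P x i) = sets M"
  using kernel_space[of x i] by (simp add: space_prob_algebra)

lemma space_P [simp]: "space (P x i) = space M"
  using sets_P by (rule sets_eq_imp_space_eq)

lemma prob_space_P: "prob_space (P x i)"
  using kernel_space[of x i] by (simp add: space_prob_algebra)

text \<open>Absorption settles one direction. For the other, right-continuity of
  \<open>\<Theta>\<close> keeps a path alive on an interval to the right of \<open>t\<close>, so the
  infimum defining the lifetime is strictly larger than \<open>t\<close>.\<close>

lemma alive_iff:
  assumes "0 \<le> t" "\<omega> \<in> space M"
  shows "ereal t < lifetime \<Theta> \<omega> \<longleftrightarrow> \<xi> t \<omega> \<noteq> - \<infinity>"
proof
  assume *: "ereal t < lifetime \<Theta> \<omega>"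
  show "\<xi> t \<omega> \<noteq> - \<infinity>"
  proof
    assume "\<xi> t \<omega> = - \<infinity>"
    then have dead: "\<Theta> t \<omega> = None" using cemetery assms by simp
    obtain s where s: "ereal t < ereal s" "ereal s < lifetime \<Theta> \<omega>"
      using ereal_dense2[OF *] by blast
    then have "\<Theta> s \<omega> = None" "0 < s" using absorbing[of t s \<omega>] assms dead by auto
    then have "lifetime \<Theta> \<omega> \<le> ereal s"
      unfolding lifetime_def by (intro Inf_lower) auto
    then show False using s(2) by simp
  qed
next
  assume "\<xi> t \<omega> \<noteq> - \<infinity>"
  then have *: "\<Theta> t \<omega> \<noteq> None" using cemetery assms by simp
  from right_continuous[OF assms]
  obtain b where b: "t < b" "\<And>s. t < s \<Longrightarrow> s < b \<Longrightarrow> \<Theta> s \<omega> = \<Theta> t \<omega>"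
    unfolding eventually_at_right_field by auto
  have "ereal b \<le> lifetime \<Theta> \<omega>"
    unfolding lifetime_def
  proof (intro Inf_greatest, clarsimp)
    fix s assume s: "0 < s" "\<Theta> s \<omega> = None"
    show "b \<le> s"
    proof (rule ccontr)
      assume "\<not> b \<le> s"
      then show False
        using b(2)[of s] absorbing[of s t \<omega>] s assms * by (cases "t < s") auto
    qed
  qed
  then show "ereal t < lifetime \<Theta> \<omega>" using b(1) by (meson ereal_less_eq(3) less_le_trans less_ereal.simps(1))
qed

lemma path_on_measurable [measurable]: "path_on {0..t} \<xi> \<Theta> \<in> M \<rightarrow>\<^sub>M path_space {0..t}"
  unfolding path_on_def path_space_def
  using measurable_\<xi> measurable_\<Theta> by (intro measurable_restrict measurable_Pair) auto

lemma subalgebra_natural_filtration: "subalgebra (P x i) (natural_filtration M \<xi> \<Theta> t)"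
  unfolding subalgebra_def natural_filtration_def
  using sets_image_in_sets[OF refl path_on_measurable] by simp

lemma measurable_natural_filtration:
  assumes "0 \<le> s" "s \<le> t"
  shows "\<xi> s \<in> borel_measurable (natural_filtration M \<xi> \<Theta> t)"
proof -
  have "path_on {0..t} \<xi> \<Theta> \<in> natural_filtration M \<xi> \<Theta> t \<rightarrow>\<^sub>M path_space {0..t}"
    unfolding natural_filtration_def
    by (rule measurable_vimage_algebra1) (use measurable_space[OF path_on_measurable] in auto)
  moreover have "(\<lambda>p. p s) \<in> path_space {0..t} \<rightarrow>\<^sub>M borel \<Otimes>\<^sub>M (count_space UNIV :: 'n option measure)"
    unfolding path_space_def by (rule measurable_component_singleton) (use assms in auto)
  from measurable_compose[OF this measurable_fst]
  have "(\<lambda>p. fst (p s)) \<in> borel_measurable (path_space {0..t} :: (real \<Rightarrow> ereal \<times> 'n option) measure)" .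
  ultimately have "(\<lambda>\<omega>. fst (path_on {0..t} \<xi> \<Theta> \<omega> s)) \<in> borel_measurable (natural_filtration M \<xi> \<Theta> t)"
    by measurable
  then show ?thesis using assms by (simp add: path_on_def)
qed

text \<open>If no \<open>d\<close> worked for a state, there would be times \<open>r n\<close>
  tending to 0 with probability below 1/2; but by right-continuity at 0 the indicators converge
  almost surely to 1, and dominated convergence contradicts this. A minimum over the finitely many
  states makes \<open>d\<close> uniform.\<close>

lemma small_time_lower_bound:
  "\<exists>d>0. \<forall>j. \<forall>r\<in>{0..d}. 1 / 2 \<le> measure (P 0 j) {\<omega> \<in> space M. ereal (- 1) < \<xi> r \<omega>}"
proof -
  have "\<exists>d>0. \<forall>r\<in>{0..d}. 1 / 2 \<le> measure (P 0 j) {\<omega> \<in> space M. ereal (- 1) < \<xi> r \<omega>}" for j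
  proof (rule ccontr)
    assume "\<not> ?thesis"
    then have "\<exists>r. 0 \<le> r \<and> r \<le> 1 / real (Suc n) \<and>
        measure (P 0 j) {\<omega> \<in> space M. ereal (- 1) < \<xi> r \<omega>} < 1 / 2" for n
      by (auto simp: not_le dest!: spec[of _ "1 / real (Suc n)"])
    then obtain r where r: "\<And>n. 0 \<le> r n" "\<And>n. r n \<le> 1 / real (Suc n)"
      "\<And>n. measure (P 0 j) {\<omega> \<in> space M. ereal (- 1) < \<xi> (r n) \<omega>} < 1 / 2"
      by metis
    interpret prob_space "P 0 j" by (rule prob_space_P)
    have [measurable]: "\<xi> (r n) \<in> borel_measurable M" for n using r(1) by (rule measurable_\<xi>)
    have r0: "r \<longlonglongrightarrow> 0"
      by (rule tendsto_sandwich[OF _ _ tendsto_const LIMSEQ_inverse_real_of_nat])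
        (use r in \<open>auto simp: inverse_eq_divide\<close>)
    let ?f = "\<lambda>n \<omega>. indicator {\<omega> \<in> space M. ereal (- 1) < \<xi> (r n) \<omega>} \<omega> :: real"
    have "(\<lambda>n. \<integral>\<omega>. ?f n \<omega> \<partial>P 0 j) \<longlonglongrightarrow> (\<integral>\<omega>. 1 \<partial>P 0 j)"
    proof (rule integral_dominated_convergence[where w = "\<lambda>_. 1"])
      show "AE \<omega> in P 0 j. (\<lambda>n. ?f n \<omega>) \<longlonglongrightarrow> 1"
        using start AE_space
      proof eventually_elim
        fix \<omega> assume \<omega>: "\<xi> 0 \<omega> = ereal 0 \<and> \<Theta> 0 \<omega> = Some j" "\<omega> \<in> space (P 0 j)"
        then have "((\<lambda>s. \<xi> s \<omega>) \<longlongrightarrow> ereal 0) (at_right 0)"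
          using right_continuous[of 0 \<omega>] by simp
        from order_tendstoD(1)[OF this, of "ereal (- 1)"]
        obtain b where b: "0 < b" "\<And>s. 0 < s \<Longrightarrow> s < b \<Longrightarrow> ereal (- 1) < \<xi> s \<omega>"
          unfolding eventually_at_right_field by auto
        have "\<forall>\<^sub>F n in sequentially. r n < b" using order_tendstoD(2)[OF r0 b(1)] .
        then have "\<forall>\<^sub>F n in sequentially. ?f n \<omega> = 1"
        proof eventually_elim
          case (elim n)
          \<comment> \<open>The limit from the right says nothing about time 0 itself, where the
            starting value is used.\<close>
          then show ?case using r(1)[of n] b(2)[of "r n"] \<omega> by (cases "r n = 0") auto
        qed
        then show "(\<lambda>n. ?f n \<omega>) \<longlonglongrightarrow> 1" by (rule tendsto_eventually)
      qed
    qed (auto split: split_indicator)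
    then have "(\<lambda>n. measure (P 0 j) {\<omega> \<in> space M. ereal (- 1) < \<xi> (r n) \<omega>}) \<longlonglongrightarrow> 1"
      by (simp add: prob_space[simplified])
    then have "1 \<le> (1 / 2 :: real)"
      by (rule LIMSEQ_le_const2) (use r(3) in \<open>auto intro: less_imp_le\<close>)
    then show False by simp
  qed
  then obtain d where d: "\<And>j. 0 < d j"
    "\<And>j r. r \<in> {0..d j} \<Longrightarrow> 1 / 2 \<le> measure (P 0 j) {\<omega> \<in> space M. ereal (- 1) < \<xi> r \<omega>}"
    by metis
  show ?thesis
  proof (intro exI conjI allI ballI)
    show "0 < Min (range d)" using d(1) by simp
    fix j r assume "r \<in> {0..Min (range d)}"
    then show "1 / 2 \<le> measure (P 0 j) {\<omega> \<in> space M. ereal (- 1) < \<xi> r \<omega>}"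
      by (intro d(2)) auto
  qed
qed

text \<open>Given the past up to \<open>t\<close>, the increment over \<open>r\<close> has the law
  of \<open>\<xi> r\<close> under \<open>P 0 j\<close> with \<open>j\<close> the current state, so
  it exceeds -1 with conditional probability at least 1/2. Integrating over the past event
  \<open>A\<close> costs the factor 2; \<open>gt\<close> ensures that its paths are alive at
  \<open>t\<close>.\<close>

lemma conditional_lower_bound:
  assumes half: "\<And>j. 1 / 2 \<le> measure (P 0 j) {\<omega> \<in> space M. ereal (- 1) < \<xi> r \<omega>}"
    and "0 \<le> t" "0 \<le> r" and A: "A \<in> sets (natural_filtration M \<xi> \<Theta> t)"
    and gt: "\<And>\<omega>. \<omega> \<in> A \<Longrightarrow> ereal u < \<xi> t \<omega>"
  shows "measure (P x i) A \<le> 2 * measure (P x i) {\<omega> \<in> A. ereal (u - 1) < \<xi> (t + r) \<omega>}"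
proof -
  interpret finite_measure_subalgebra "P x i" "natural_filtration M \<xi> \<Theta> t"
    using prob_space_P subalgebra_natural_filtration
    by (simp add: finite_measure_subalgebra_def finite_measure_subalgebra_axioms_def prob_space.finite_measure)
  interpret prob_space "P x i" by (rule prob_space_P)
  have AM [measurable]: "A \<in> sets M"
    using subalgebra_natural_filtration[of x i t] A by (auto simp: subalgebra_def)
  then have AsubM: "A \<subseteq> space M" by (rule sets.sets_into_space)
  have [measurable]: "\<xi> t \<in> borel_measurable M" "\<xi> (t + r) \<in> borel_measurable M" "\<xi> r \<in> borel_measurable M"
    using assms by (auto intro: measurable_\<xi>)
  define f :: "real \<times> 'n \<Rightarrow> real" where "f = (\<lambda>(y, j). indicator {- 1<..} y)"
  have f: "f \<in> borel_measurable state_space" "bounded (range f)"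
    unfolding f_def state_space_def
    by (measurable, auto intro!: boundedI[of _ 1] split: split_indicator)
  define g where "g = (\<lambda>\<omega>. if ereal (t + r) < lifetime \<Theta> \<omega>
                  then f (real_of_ereal (\<xi> (t + r) \<omega> - \<xi> t \<omega>), the (\<Theta> (t + r) \<omega>)) else 0)"
  define h where "h = (\<lambda>\<omega>. if ereal t < lifetime \<Theta> \<omega>
              then \<integral>\<omega>'. alive_value \<xi> \<Theta> f r \<omega>' \<partial>P 0 (the (\<Theta> t \<omega>)) else 0)"
  \<comment> \<open>Survival must be listed separately: for a path killed in between, the difference
    is \<open>- \<infinity>\<close>, which \<open>real_of_ereal\<close> maps to 0, a value above
    -1.\<close>
  have g_eq: "g \<omega> = indicator {\<omega> \<in> space M. \<xi> (t + r) \<omega> \<noteq> - \<infinity> \<and> - 1 < real_of_ereal (\<xi> (t + r) \<omega> - \<xi> t \<omega>)} \<omega>"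
    if "\<omega> \<in> space M" for \<omega>
    using that alive_iff[of "t + r" \<omega>] assms by (auto simp: g_def f_def split: split_indicator)
  have g_int: "integrable (P x i) g"
    by (subst Bochner_Integration.integrable_cong[OF refl g_eq]) (auto intro!: integrable_real_indicator simp: emeasure_eq_measure)
  have h_ge: "1 / 2 \<le> h \<omega>" if "\<omega> \<in> A" for \<omega>
  proof -
    have "alive_value \<xi> \<Theta> f r \<omega>' = indicator {\<omega> \<in> space M. ereal (- 1) < \<xi> r \<omega>} \<omega>'"
      if "\<omega>' \<in> space M" for \<omega>'
      using that alive_iff[of r \<omega>'] not_top[of r \<omega>'] assms
      by (cases "\<xi> r \<omega>'") (auto simp: alive_value_def f_def split: split_indicator)
    then have "(\<integral>\<omega>'. alive_value \<xi> \<Theta> f r \<omega>' \<partial>P 0 j) = measure (P 0 j) {\<omega> \<in> space M. ereal (- 1) < \<xi> r \<omega>}" for j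
      by (subst Bochner_Integration.integral_cong[OF refl]) auto
    moreover have "\<xi> t \<omega> \<noteq> - \<infinity>" "\<omega> \<in> space M"
      using gt[OF that] that AsubM by auto
    then have "ereal t < lifetime \<Theta> \<omega>"
      using alive_iff \<open>0 \<le> t\<close> by simp
    ultimately show ?thesis using half by (simp add: h_def)
  qed
  have "measure (P x i) A / 2 = (\<integral>\<omega>\<in>A. 1 / 2 \<partial>P x i)"
    using AM by (simp add: set_lebesgue_integral_def)
  also have "\<dots> \<le> (\<integral>\<omega>\<in>A. real_cond_exp (P x i) (natural_filtration M \<xi> \<Theta> t) g \<omega> \<partial>P x i)"
  proof -
    have "AE \<omega> in P x i. real_cond_exp (P x i) (natural_filtration M \<xi> \<Theta> t) g \<omega> = h \<omega>"
      using markov_additive[OF f assms(3,2)] unfolding g_def h_def .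
    then have "AE \<omega>\<in>A in P x i. 1 / 2 \<le> real_cond_exp (P x i) (natural_filtration M \<xi> \<Theta> t) g \<omega>"
      by eventually_elim (use h_ge in auto)
    then show ?thesis
      unfolding set_lebesgue_integral_def
      by (intro integral_mono_AE integrable_mult_indicator integrable_const real_cond_exp_int(1)[OF g_int])
        (auto split: split_indicator)
  qed
  also have "\<dots> = (\<integral>\<omega>\<in>A. g \<omega> \<partial>P x i)"
    by (rule real_cond_exp_intA[symmetric, OF g_int A])
  also have "\<dots> \<le> (\<integral>\<omega>. indicator {\<omega> \<in> A. ereal (u - 1) < \<xi> (t + r) \<omega>} \<omega> \<partial>P x i)"
    unfolding set_lebesgue_integral_def
  proof (intro integral_mono integrable_mult_indicator g_int)
    fix \<omega> assume "\<omega> \<in> space (P x i)"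
    then have \<omega>: "\<omega> \<in> space M" by simp
    have "ereal (u - 1) < \<xi> (t + r) \<omega>"
      if "\<omega> \<in> A" "\<xi> (t + r) \<omega> \<noteq> - \<infinity>" "- 1 < real_of_ereal (\<xi> (t + r) \<omega> - \<xi> t \<omega>)"
      using gt[OF that(1)] that(2,3) not_top[of t \<omega>] not_top[of "t + r" \<omega>] \<omega> assms(2,3)
      by (cases "\<xi> t \<omega>"; cases "\<xi> (t + r) \<omega>") auto
    then show "indicat_real A \<omega> *\<^sub>R g \<omega> \<le> indicator {\<omega> \<in> A. ereal (u - 1) < \<xi> (t + r) \<omega>} \<omega>"
      by (auto simp: g_eq[OF \<omega>] split: split_indicator)
  qed (use AM in \<open>auto intro!: integrable_real_indicator simp: emeasure_eq_measure\<close>)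
  also have "\<dots> = measure (P x i) {\<omega> \<in> A. ereal (u - 1) < \<xi> (t + r) \<omega>}"
    using AsubM by (simp add: Int_absorb1 Collect_conj_eq Int_commute subset_eq)
  finally show ?thesis by simp
qed


text \<open>An Ottaviani-type argument. The events of first passage above \<open>u\<close> at the
  times of \<open>F\<close> are disjoint and each is known at its passage time; after the passage
  the path stays above \<open>u - 1\<close> at time \<open>s + d\<close> with conditional
  probability at least 1/2.\<close>

lemma maximal_inequality_finite:
  assumes half: "\<And>j r. r \<in> {0..d} \<Longrightarrow> 1 / 2 \<le> measure (P 0 j) {\<omega> \<in> space M. ereal (- 1) < \<xi> r \<omega>}"
    and "0 \<le> s" "0 \<le> d" "finite F" and F: "F \<subseteq> {s..s + d}"
  shows "measure (P x i) {\<omega> \<in> space M. \<exists>t\<in>F. ereal u < \<xi> t \<omega>}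
    \<le> 2 * measure (P x i) {\<omega> \<in> space M. ereal (u - 1) < \<xi> (s + d) \<omega>}"
proof -
  interpret prob_space "P x i" by (rule prob_space_P)
  define A where "A t = {\<omega> \<in> space M. ereal u < \<xi> t \<omega> \<and> (\<forall>t'\<in>F. t' < t \<longrightarrow> \<not> ereal u < \<xi> t' \<omega>)}" for t
  define B where "B t = {\<omega> \<in> A t. ereal (u - 1) < \<xi> (s + d) \<omega>}" for t
  have nonneg: "0 \<le> t" if "t \<in> F" for t using that F assms(2) by auto
  have A_filt: "A t \<in> sets (natural_filtration M \<xi> \<Theta> t)" if "t \<in> F" for t
  proof -
    let ?N = "natural_filtration M \<xi> \<Theta> t"
    have N: "space ?N = space M" by (simp add: natural_filtration_def)
    have [measurable]: "\<xi> t' \<in> borel_measurable ?N" if "t' \<in> F" "t' \<le> t" for t'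
      using that nonneg by (intro measurable_natural_filtration) auto
    have "A t = {\<omega> \<in> space ?N. ereal u < \<xi> t \<omega>} \<inter> {\<omega> \<in> space ?N. \<forall>t'\<in>{t'\<in>F. t' < t}. \<not> ereal u < \<xi> t' \<omega>}"
      by (auto simp: A_def N)
    moreover have "{\<omega> \<in> space ?N. ereal u < \<xi> t \<omega>} \<in> sets ?N" using \<open>t \<in> F\<close> by measurable
    moreover have "{\<omega> \<in> space ?N. \<forall>t'\<in>{t'\<in>F. t' < t}. \<not> ereal u < \<xi> t' \<omega>} \<in> sets ?N"
      using \<open>finite F\<close> by (intro sets.sets_Collect_finite_All) (auto intro!: sets.sets_Collect_neg)
    ultimately show ?thesis by auto
  qed
  have A_M [measurable]: "A t \<in> sets M" if "t \<in> F" for t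
    using A_filt[OF that] subalgebra_natural_filtration[of x i t] by (auto simp: subalgebra_def)
  have [measurable]: "\<xi> (s + d) \<in> borel_measurable M" using assms by (intro measurable_\<xi>) auto
  have B_M: "B t \<in> sets M" if "t \<in> F" for t
  proof -
    have "B t = A t \<inter> {\<omega> \<in> space M. ereal (u - 1) < \<xi> (s + d) \<omega>}" by (auto simp: B_def A_def)
    then show ?thesis using A_M[OF that] by simp
  qed
  have disj: "t = t'" if "t \<in> F" "t' \<in> F" "\<omega> \<in> A t" "\<omega> \<in> A t'" for t t' \<omega>
    using that by (cases t t' rule: linorder_cases) (auto simp: A_def)
  have "{\<omega> \<in> space M. \<exists>t\<in>F. ereal u < \<xi> t \<omega>} = (\<Union>t\<in>F. A t)"
  proof safe
    fix \<omega> t assume "\<omega> \<in> space M" "t \<in> F" "ereal u < \<xi> t \<omega>"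
    moreover obtain m where "m \<in> {t\<in>F. ereal u < \<xi> t \<omega>}" "\<And>t'. t' \<in> {t\<in>F. ereal u < \<xi> t \<omega>} \<Longrightarrow> \<not> t' < m"
      using ex_min_if_finite[of "{t\<in>F. ereal u < \<xi> t \<omega>}"] \<open>finite F\<close> calculation by auto
    ultimately show "\<omega> \<in> (\<Union>t\<in>F. A t)" by (auto simp: A_def)
  qed (auto simp: A_def)
  then have "measure (P x i) {\<omega> \<in> space M. \<exists>t\<in>F. ereal u < \<xi> t \<omega>} = (\<Sum>t\<in>F. measure (P x i) (A t))"
    using \<open>finite F\<close> A_M disj
    by (simp, intro finite_measure_finite_Union) (auto simp: disjoint_family_on_def)
  also have "\<dots> \<le> (\<Sum>t\<in>F. 2 * measure (P x i) (B t))"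
  proof (rule sum_mono)
    fix t assume t: "t \<in> F"
    \<comment> \<open>The time \<open>s + d - t\<close> left in the block lies in
      \<open>{0..d}\<close> because \<open>F\<close> lies in the block; this is the range covered by
      \<open>half\<close>.\<close>
    have "measure (P x i) (A t) \<le> 2 * measure (P x i) {\<omega> \<in> A t. ereal (u - 1) < \<xi> (t + (s + d - t)) \<omega>}"
      using t F nonneg half by (intro conditional_lower_bound A_filt) (auto simp: A_def)
    then show "measure (P x i) (A t) \<le> 2 * measure (P x i) (B t)" by (simp add: B_def)
  qed
  also have "\<dots> = 2 * measure (P x i) (\<Union>t\<in>F. B t)"
    using \<open>finite F\<close> B_M disj unfolding sum_distrib_left[symmetric]
    by (subst finite_measure_finite_Union) (auto simp: disjoint_family_on_def B_def)
  also have "\<dots> \<le> 2 * measure (P x i) {\<omega> \<in> space M. ereal (u - 1) < \<xi> (s + d) \<omega>}"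
    by (intro mult_left_mono finite_measure_mono) (auto simp: B_def A_def)
  finally show ?thesis .
qed

text \<open>Continuity from below along the initial segments of an enumeration; the bound does not
  depend on the size of the finite set.\<close>

lemma maximal_inequality:
  assumes half: "\<And>j r. r \<in> {0..d} \<Longrightarrow> 1 / 2 \<le> measure (P 0 j) {\<omega> \<in> space M. ereal (- 1) < \<xi> r \<omega>}"
    and "0 \<le> s" "0 \<le> d" "countable D" and D: "D \<subseteq> {s..s + d}"
  shows "emeasure (P x i) {\<omega> \<in> space M. \<exists>t\<in>D. ereal u < \<xi> t \<omega>}
    \<le> 2 * emeasure (P x i) {\<omega> \<in> space M. ereal (u - 1) < \<xi> (s + d) \<omega>}"
proof (cases "D = {}")
  case False
  interpret prob_space "P x i" by (rule prob_space_P)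
  define t where "t = from_nat_into D"
  have t: "range t = D" unfolding t_def using False assms(4) by (rule range_from_nat_into)
  then have tD: "t n \<in> D" for n by auto
  have [measurable]: "\<xi> (t n) \<in> borel_measurable M" for n
    using tD[of n] D assms(2) by (intro measurable_\<xi>) auto
  define E where "E n = {\<omega> \<in> space M. \<exists>k\<in>{..n}. ereal u < \<xi> (t k) \<omega>}" for n :: nat
  have "E n \<in> sets M" for n unfolding E_def by measurable
  then have "(\<lambda>n. measure (P x i) (E n)) \<longlonglongrightarrow> measure (P x i) (\<Union>n. E n)"
    by (intro finite_Lim_measure_incseq) (auto simp: incseq_def E_def intro: order_trans)
  moreover have "measure (P x i) (E n) \<le> 2 * measure (P x i) {\<omega> \<in> space M. ereal (u - 1) < \<xi> (s + d) \<omega>}" for n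
    using maximal_inequality_finite[OF half assms(2,3), of "t ` {..n}" x i u] tD D
    unfolding E_def by auto
  ultimately have "measure (P x i) (\<Union>n. E n) \<le> 2 * measure (P x i) {\<omega> \<in> space M. ereal (u - 1) < \<xi> (s + d) \<omega>}"
    by (intro LIMSEQ_le_const2) auto
  moreover have "(\<Union>n. E n) = {\<omega> \<in> space M. \<exists>t\<in>D. ereal u < \<xi> t \<omega>}"
    unfolding E_def t[symmetric] by auto
  ultimately show ?thesis
    by (simp add: emeasure_eq_measure ennreal_leI flip: ennreal_mult' ennreal_numeral)
qed simp

text \<open>Layer cake on both sides. The loss of 1 in the level of \<open>\<xi>\<close> becomes the
  factor \<open>exp p\<close>, and the 2 is that of the maximal inequality.\<close>

lemma moment_maximum:
  assumes half: "\<And>j r. r \<in> {0..d} \<Longrightarrow> 1 / 2 \<le> measure (P 0 j) {\<omega> \<in> space M. ereal (- 1) < \<xi> r \<omega>}"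
    and "0 \<le> s" "0 \<le> d" "countable D" and D: "D \<subseteq> {s..s + d}" and "0 < p"
  shows "(\<integral>\<^sup>+ \<omega>. (SUP t\<in>D. ennreal_power (exp_ereal (\<xi> t \<omega>)) p) \<partial>P x i)
    \<le> ennreal (2 * exp p) * (\<integral>\<^sup>+ \<omega>. ennreal_power (exp_ereal (\<xi> (s + d) \<omega>)) p \<partial>P x i)"
proof -
  interpret prob_space "P x i" by (rule prob_space_P)
  have D_meas [measurable]: "\<xi> t \<in> borel_measurable M" if "t \<in> D" for t
    using that D assms(2) by (intro measurable_\<xi>) auto
  have [measurable]: "\<xi> (s + d) \<in> borel_measurable M" using assms by (intro measurable_\<xi>) auto
  let ?f = "\<lambda>\<omega>. ennreal_power (exp_ereal (\<xi> (s + d) \<omega>)) p"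
  have "(\<integral>\<^sup>+ \<omega>. (SUP t\<in>D. ennreal_power (exp_ereal (\<xi> t \<omega>)) p) \<partial>P x i)
    = (\<integral>\<^sup>+ l. indicator {0<..} l * emeasure (P x i)
        {\<omega> \<in> space (P x i). ennreal l < (SUP t\<in>D. ennreal_power (exp_ereal (\<xi> t \<omega>)) p)} \<partial>lborel)"
    using \<open>countable D\<close> by (intro nn_integral_eq_tail_integral sigma_finite_measure_axioms) measurable
  also have "\<dots> \<le> (\<integral>\<^sup>+ l. 2 * (indicator {0<..} l * emeasure (P x i)
        {\<omega> \<in> space (P x i). ennreal l < ennreal (exp p) * ?f \<omega>}) \<partial>lborel)"
  proof (rule nn_integral_mono)
    fix l :: real
    show "indicator {0<..} l * emeasure (P x i)
        {\<omega> \<in> space (P x i). ennreal l < (SUP t\<in>D. ennreal_power (exp_ereal (\<xi> t \<omega>)) p)}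
      \<le> 2 * (indicator {0<..} l * emeasure (P x i) {\<omega> \<in> space (P x i). ennreal l < ennreal (exp p) * ?f \<omega>})"
    proof (cases "0 < l")
      case True
      \<comment> \<open>Dividing the level \<open>l\<close> by \<open>exp p\<close> lowers
        \<open>ln l / p\<close> by exactly 1.\<close>
      have shift: "ennreal l < ennreal (exp p) * y \<longleftrightarrow> ennreal (l / exp p) < y" for y
        using True by (cases y) (auto simp: ennreal_less_iff ennreal_mult_top field_simps simp flip: ennreal_mult')
      have "ln (l / exp p) / p = ln l / p - 1"
        using True \<open>0 < p\<close> by (simp add: ln_div field_simps)
      then have "ennreal l < ennreal (exp p) * ?f \<omega> \<longleftrightarrow> ereal (ln l / p - 1) < \<xi> (s + d) \<omega>" for \<omega>
        using True \<open>0 < p\<close> by (simp add: shift exp_ereal_power_less_iff)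
      then show ?thesis
        using maximal_inequality[OF half assms(2-5), of x i "ln l / p"] True \<open>0 < p\<close>
        by (simp add: less_SUP_iff exp_ereal_power_less_iff)
    qed simp
  qed
  also have "\<dots> = 2 * (\<integral>\<^sup>+ \<omega>. ennreal (exp p) * ?f \<omega> \<partial>P x i)"
    by (subst nn_integral_eq_tail_integral) (auto simp: nn_integral_cmult sigma_finite_measure_axioms)
  also have "\<dots> = ennreal (2 * exp p) * (\<integral>\<^sup>+ \<omega>. ?f \<omega> \<partial>P x i)"
    by (simp add: nn_integral_cmult ennreal_mult mult.assoc)
  finally show ?thesis .
qed

text \<open>Right-continuity allows \<open>t\<close> to be approached by rationals from the right;
  the strict \<open>t < e\<close> leaves room for them inside the block. A countable supremum is
  what the maximal inequality and measurability can handle.\<close>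

lemma exp_ereal_le_rational_SUP:
  assumes "0 \<le> s" "s \<le> t" "t < e" "\<omega> \<in> space M" "0 < p"
  shows "ennreal_power (exp_ereal (\<xi> t \<omega>)) p \<le> (SUP r\<in>\<rat> \<inter> {s..e}. ennreal_power (exp_ereal (\<xi> r \<omega>)) p)"
  unfolding le_SUP_iff
proof (intro allI impI)
  have *: "\<exists>r\<in>\<rat> \<inter> {s..e}. y < \<xi> r \<omega>" if "y < \<xi> t \<omega>" for y
  proof -
    have "0 \<le> t" using assms by simp
    then have "((\<lambda>s. \<xi> s \<omega>) \<longlongrightarrow> \<xi> t \<omega>) (at_right t)" using right_continuous assms by blast
    from order_tendstoD(1)[OF this that]
    obtain b where b: "t < b" "\<And>s. t < s \<Longrightarrow> s < b \<Longrightarrow> y < \<xi> s \<omega>"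
      unfolding eventually_at_right_field by auto
    obtain r where "r \<in> \<rat>" "t < r" "r < min b e"
      using Rats_dense_in_real[of t "min b e"] b assms by auto
    then show ?thesis using b assms by (intro bexI[of _ r]) auto
  qed
  fix z assume z: "z < ennreal_power (exp_ereal (\<xi> t \<omega>)) p"
  then obtain l where l: "z = ennreal l" "0 \<le> l" by (cases z) auto
  show "\<exists>r\<in>\<rat> \<inter> {s..e}. z < ennreal_power (exp_ereal (\<xi> r \<omega>)) p"
  proof (cases "l = 0")
    case False
    then show ?thesis using z l * assms by (simp add: exp_ereal_power_less_iff)
  next
    case True
    \<comment> \<open>The level 0 has no logarithm; exceeding it just means being alive.\<close>
    have iff: "0 < ennreal_power (exp_ereal y) p \<longleftrightarrow> - \<infinity> < y" for y
      by (cases y) (auto simp: exp_ereal_def ennreal_power_def)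
    show ?thesis using z l *[of "- \<infinity>"] True by (simp add: iff)
  qed
qed

end

section \<open>Independence of the ingredients\<close>

text \<open>The identity, read as a map into \<open>A\<close> and as a map into \<open>B\<close>,
  gives two independent random variables, so the diagonal pair has a product law and Fubini applies.
  This covers integrands in which the sources interact, such as a Levy path run for an independent
  random time.\<close>

lemma (in prob_space) nn_integral_indep_diagonal:
  assumes A: "space A = space M" "sets A \<subseteq> events" and B: "space B = space M" "sets B \<subseteq> events"
    and indep: "indep_set (sets A) (sets B)"
    and f: "f \<in> borel_measurable (A \<Otimes>\<^sub>M B)"
  shows "(\<integral>\<^sup>+ \<omega>. f (\<omega>, \<omega>) \<partial>M) = (\<integral>\<^sup>+ \<omega>. \<integral>\<^sup>+ \<omega>'. f (\<omega>, \<omega>') \<partial>M \<partial>M)"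
proof -
  have [measurable]: "(\<lambda>\<omega>. \<omega>) \<in> M \<rightarrow>\<^sub>M A" "(\<lambda>\<omega>. \<omega>) \<in> M \<rightarrow>\<^sub>M B"
    using A B by (auto intro!: measurableI)
  have id: "{(\<lambda>\<omega>. \<omega>) -` S \<inter> space M |S. S \<in> sets N} = sets N" if "space N = space M" for N
    using that by (auto simp: Int_absorb2 dest: sets.sets_into_space) (metis Int_absorb2 sets.sets_into_space)
  have "sigma_sets (space M) (sets N) = sets N" if "space N = space M" for N
    using sets.sigma_sets_eq[of N] that by simp
  then have "indep_var A (\<lambda>\<omega>. \<omega>) B (\<lambda>\<omega>. \<omega>)"
    unfolding indep_var_eq using A B indep by (simp only: id) simp
  then have distr: "distr M A (\<lambda>\<omega>. \<omega>) \<Otimes>\<^sub>M distr M B (\<lambda>\<omega>. \<omega>) = distr M (A \<Otimes>\<^sub>M B) (\<lambda>\<omega>. (\<omega>, \<omega>))"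
    by (simp add: indep_var_distribution_eq)
  interpret B: prob_space "distr M B (\<lambda>\<omega>. \<omega>)" by (rule prob_space_distr) simp
  have f': "f \<in> borel_measurable (distr M A (\<lambda>\<omega>. \<omega>) \<Otimes>\<^sub>M distr M B (\<lambda>\<omega>. \<omega>))"
    using f by (subst measurable_cong_sets[OF sets_pair_measure_cong refl]) auto
  have inner: "(\<lambda>x. \<integral>\<^sup>+ y. f (x, y) \<partial>distr M B (\<lambda>\<omega>. \<omega>)) \<in> borel_measurable A"
  proof (rule B.borel_measurable_nn_integral_fst)
    show "f \<in> borel_measurable (A \<Otimes>\<^sub>M distr M B (\<lambda>\<omega>. \<omega>))"
      using f by (subst measurable_cong_sets[OF sets_pair_measure_cong refl]) auto
  qed
  have slice: "(\<lambda>y. f (x, y)) \<in> borel_measurable B" if "x \<in> space A" for x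
    using f that by measurable
  have "(\<integral>\<^sup>+ \<omega>. f (\<omega>, \<omega>) \<partial>M) = (\<integral>\<^sup>+ p. f p \<partial>distr M (A \<Otimes>\<^sub>M B) (\<lambda>\<omega>. (\<omega>, \<omega>)))"
    using f by (subst nn_integral_distr) auto
  also have "\<dots> = (\<integral>\<^sup>+ x. \<integral>\<^sup>+ y. f (x, y) \<partial>distr M B (\<lambda>\<omega>. \<omega>) \<partial>distr M A (\<lambda>\<omega>. \<omega>))"
    unfolding distr[symmetric] by (rule B.nn_integral_fst[symmetric, OF f'])
  also have "\<dots> = (\<integral>\<^sup>+ x. \<integral>\<^sup>+ y. f (x, y) \<partial>distr M B (\<lambda>\<omega>. \<omega>) \<partial>M)"
    using inner by (subst nn_integral_distr) auto
  also have "\<dots> = (\<integral>\<^sup>+ x. \<integral>\<^sup>+ y. f (x, y) \<partial>M \<partial>M)"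
    using slice A by (intro nn_integral_cong) (subst nn_integral_distr, auto)
  finally show ?thesis .
qed

text \<open>Time is rounded up to a grid of mesh \<open>1 / Suc n\<close>: the rounded process takes
  countably many time values, so it is jointly measurable, and right-continuity passes to the limit.
  \<open>max 0\<close> makes the process total in time.\<close>

lemma borel_measurable_right_continuous_process:
  fixes X :: "real \<Rightarrow> 'w \<Rightarrow> real"
  assumes meas: "\<And>t. 0 \<le> t \<Longrightarrow> X t \<in> borel_measurable N"
    and rcont: "\<And>\<omega> t. \<omega> \<in> space N \<Longrightarrow> 0 \<le> t \<Longrightarrow> ((\<lambda>s. X s \<omega>) \<longlongrightarrow> X t \<omega>) (at_right t)"
  shows "(\<lambda>(s :: real, \<omega>). X (max 0 s) \<omega>) \<in> borel_measurable ((borel :: real measure) \<Otimes>\<^sub>M N)"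
proof (rule borel_measurable_LIMSEQ_metric[where f = "\<lambda>n (s :: real, \<omega>). X ((of_int \<lfloor>max 0 s * real (Suc n)\<rfloor> + 1) / real (Suc n)) \<omega>"])
  define a where "a n s = (real_of_int \<lfloor>max 0 s * real (Suc n)\<rfloor> + 1) / real (Suc n)" for n and s :: real
  fix n
  have [measurable]: "(\<lambda>p. X (max 0 ((of_int z + 1) / real (Suc n))) (snd p)) \<in> borel_measurable ((borel :: real measure) \<Otimes>\<^sub>M N)" for z
    by (rule measurable_compose[OF measurable_snd meas]) simp
  have "(\<lambda>p. X (max 0 ((of_int \<lfloor>max 0 (fst p) * real (Suc n)\<rfloor> + 1) / real (Suc n))) (snd p))
      \<in> borel_measurable ((borel :: real measure) \<Otimes>\<^sub>M N)"
    by (rule measurable_compose_countable[where f = "\<lambda>z p. X (max 0 ((of_int z + 1) / real (Suc n))) (snd p)"]) measurable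
  moreover have "max 0 (a n s) = a n s" for s
    by (auto simp: a_def max_def)
  ultimately show "(\<lambda>(s :: real, \<omega>). X ((of_int \<lfloor>max 0 s * real (Suc n)\<rfloor> + 1) / real (Suc n)) \<omega>) \<in> borel_measurable ((borel :: real measure) \<Otimes>\<^sub>M N)"
    by (simp add: a_def split_beta)
next
  fix p assume "p \<in> space ((borel :: real measure) \<Otimes>\<^sub>M N)"
  then obtain s \<omega> where p: "p = (s, \<omega>)" "\<omega> \<in> space N" by (auto simp: space_pair_measure)
  define t where "t = max 0 s"
  define a where "a n = (of_int \<lfloor>t * real (Suc n)\<rfloor> + 1) / real (Suc n)" for n
  have "0 \<le> t" by (simp add: t_def)
  have t_eq: "t = t * real (Suc n) / real (Suc n)" for n by simp
  \<comment> \<open>The \<open>+ 1\<close> after the floor puts the grid point strictly to the right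
    of \<open>t\<close>, even when \<open>t\<close> is itself on the grid, as a limit along
    \<open>at_right t\<close> demands.\<close>
  have gt: "t < a n" for n
    unfolding a_def by (subst t_eq[of n], rule divide_strict_right_mono) linarith+
  have le: "a n \<le> t + inverse (real (Suc n))" for n
  proof -
    have "a n \<le> (t * real (Suc n) + 1) / real (Suc n)"
      unfolding a_def by (rule divide_right_mono) linarith+
    then show ?thesis by (simp only: add_divide_distrib t_eq[symmetric] inverse_eq_divide)
  qed
  have "a \<longlonglongrightarrow> t"
  proof (rule tendsto_sandwich[OF _ _ tendsto_const])
    show "(\<lambda>n. t + inverse (real (Suc n))) \<longlonglongrightarrow> t"
      using tendsto_add[OF tendsto_const LIMSEQ_inverse_real_of_nat, of t] by simp
  qed (use gt le in \<open>auto intro: less_imp_le always_eventually\<close>)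
  then have "filterlim a (at_right t) sequentially"
    by (rule tendsto_imp_filterlim_at_right) (simp add: gt)
  then have "(\<lambda>n. X (a n) \<omega>) \<longlonglongrightarrow> X t \<omega>"
    using rcont[OF p(2) \<open>0 \<le> t\<close>] by (rule filterlim_compose[rotated])
  then show "(\<lambda>n. (case p of (s, \<omega>) \<Rightarrow> X ((of_int \<lfloor>max 0 s * real (Suc n)\<rfloor> + 1) / real (Suc n)) \<omega>))
     \<longlonglongrightarrow> (case p of (s, \<omega>) \<Rightarrow> X (max 0 s) \<omega>)"
    by (simp add: p a_def t_def)
qed

lemma measurable_finite_select:
  fixes g :: "'w \<Rightarrow> 'n::finite"
  assumes "\<And>a. f a \<in> M \<rightarrow>\<^sub>M N" "g \<in> M \<rightarrow>\<^sub>M count_space UNIV"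
  shows "(\<lambda>\<omega>. f (g \<omega>) \<omega>) \<in> M \<rightarrow>\<^sub>M N"
  using assms by (rule measurable_compose_countable') (simp_all add: countable_finite)

section \<open>Sigma-algebras generated by groups of sources\<close>

fun source_step :: "'n source \<Rightarrow> nat" where
  "source_step (Levy n i) = n"
| "source_step (Kill n i) = n"
| "source_step (Hold n i) = n"
| "source_step (Goto n i) = n"
| "source_step (Jump n i j) = n"

locale map_noise =
  fixes Q :: "real^'n^'n" and k :: "'n::finite \<Rightarrow> real" and W :: "('w, 'n) map_ingredients"
  assumes ingredients: "ingredients_for Q k W"
begin

lemma prob_space_noise: "prob_space (noise W)"
  using ingredients by (simp add: ingredients_for_def)

sublocale prob_space "noise W" by (rule prob_space_noise)

lemma levy: "levy_process (noise W) (levy W n i)"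
  using ingredients by (simp add: ingredients_for_def)

lemma kill: "exponential_time (noise W) (k i) (kill W n i)"
  using ingredients by (simp add: ingredients_for_def)

lemma hold: "exponential_time (noise W) (- Q $ i $ i) (hold W n i)"
  using ingredients by (simp add: ingredients_for_def)

lemma levy_measurable: "0 \<le> t \<Longrightarrow> levy W n i t \<in> borel_measurable (noise W)"
  using levy[of n i] by (simp add: levy_process_def)

lemma kill_measurable [measurable]: "kill W n i \<in> borel_measurable (noise W)"
  using kill[of i n] by (simp add: exponential_time_def)

lemma hold_measurable [measurable]: "hold W n i \<in> borel_measurable (noise W)"
  using hold[of i n] by (simp add: exponential_time_def)

lemma hold_nonneg: "\<omega> \<in> space (noise W) \<Longrightarrow> 0 \<le> hold W n i \<omega>"
  using hold[of i n] by (simp add: exponential_time_def)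

lemma goto_measurable [measurable]: "goto W n i \<in> noise W \<rightarrow>\<^sub>M count_space UNIV"
  using ingredients by (simp add: ingredients_for_def)

lemma jump_measurable [measurable]: "jump W n i j \<in> borel_measurable (noise W)"
  using ingredients by (simp add: ingredients_for_def)

lemma real_path_measurable: "real_path (levy W n i) \<in> noise W \<rightarrow>\<^sub>M real_path_space"
  unfolding real_path_def real_path_space_def
  by (intro measurable_restrict levy_measurable) auto

lemma space_source [simp]: "space (source_algebra W c) = space (noise W)"
  by (cases c) auto

lemma sets_source: "sets (source_algebra W c) \<subseteq> events"
  by (cases c) (simp_all add: sets_image_in_sets real_path_measurable)

text \<open>
  All independence arguments go through \<open>block I\<close>, the sigma-algebra generated by the sources in
  \<open>I\<close>: for disjoint \<open>I\<close> and \<open>J\<close> an expectation of \<open>f (\<omega>, \<omega>)\<close> may be computed with two independent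
  copies of \<open>\<omega>\<close>.
\<close>

definition block :: "'n source set \<Rightarrow> 'w measure" where
  "block I = sigma (space (noise W)) (\<Union>c\<in>I. sets (source_algebra W c))"

lemma space_block [simp]: "space (block I) = space (noise W)"
  unfolding block_def by (rule space_measure_of) (use sets_source sets.sets_into_space in blast)

lemma sets_block: "sets (block I) = sigma_sets (space (noise W)) (\<Union>c\<in>I. sets (source_algebra W c))"
  unfolding block_def by (rule sets_measure_of) (use sets_source sets.sets_into_space in blast)

lemma sets_block_events: "sets (block I) \<subseteq> events"
  unfolding sets_block using sets_source by (intro sets.sigma_sets_subset) blast

lemma measurable_block:
  assumes "c \<in> I" "f \<in> source_algebra W c \<rightarrow>\<^sub>M N"
  shows "f \<in> block I \<rightarrow>\<^sub>M N"
proof -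
  have "sets (source_algebra W c) \<subseteq> sets (block I)"
    unfolding sets_block using assms(1) by auto
  then show ?thesis using measurable_mono[of N N "source_algebra W c" "block I"] assms(2) by auto
qed

lemma block_mono: "I \<subseteq> J \<Longrightarrow> f \<in> block I \<rightarrow>\<^sub>M N \<Longrightarrow> f \<in> block J \<rightarrow>\<^sub>M N"
  using measurable_mono[OF order_refl refl, of "block I" "block J" N]
    sigma_sets_mono'[of "\<Union>c\<in>I. sets (source_algebra W c)" "\<Union>c\<in>J. sets (source_algebra W c)"]
  by (auto simp: sets_block)

lemma block_noise: "f \<in> block I \<rightarrow>\<^sub>M N \<Longrightarrow> f \<in> noise W \<rightarrow>\<^sub>M N"
  using measurable_mono[of N N "block I" "noise W"] sets_block_events by auto

text \<open>Grouping of independent families: each source algebra is stable under intersection, so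
  independence passes to the sigma-algebras generated by disjoint groups.\<close>

lemma indep_blocks:
  assumes "I \<inter> J = {}"
  shows "indep_set (sets (block I)) (sets (block J))"
proof -
  have "indep_sets (\<lambda>b. sigma_sets (space (noise W)) (\<Union>c\<in>case_bool I J b. sets (source_algebra W c))) UNIV"
  proof (rule indep_sets_collect_sigma)
    have "indep_sets (\<lambda>c. sets (source_algebra W c)) UNIV"
      using ingredients by (simp add: ingredients_for_def)
    then show "indep_sets (\<lambda>c. sets (source_algebra W c)) (\<Union>b\<in>UNIV. case_bool I J b)"
      by (rule indep_sets_mono_index[rotated]) simp
    show "Int_stable (sets (source_algebra W c))" for c
      by (auto simp: Int_stable_def)
    show "disjoint_family_on (case_bool I J) UNIV"
      using assms by (auto simp: disjoint_family_on_def split: bool.splits)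
  qed
  then show ?thesis
    unfolding indep_set_def sets_block
    by (rule indep_sets_cong[THEN iffD1, rotated -1]) (auto split: bool.split)
qed

lemma nn_integral_blocks:
  assumes "I \<inter> J = {}" "f \<in> borel_measurable (block I \<Otimes>\<^sub>M block J)"
  shows "(\<integral>\<^sup>+ \<omega>. f (\<omega>, \<omega>) \<partial>noise W) = (\<integral>\<^sup>+ \<omega>. \<integral>\<^sup>+ \<omega>'. f (\<omega>, \<omega>') \<partial>noise W \<partial>noise W)"
  using assms sets_block_events by (intro nn_integral_indep_diagonal[of "block I" "block J"] indep_blocks) auto

lemma nn_integral_blocks_mult:
  assumes "I \<inter> J = {}" and f: "f \<in> borel_measurable (block I)" and g: "g \<in> borel_measurable (block J)"
  shows "(\<integral>\<^sup>+ \<omega>. f \<omega> * g \<omega> \<partial>noise W) = (\<integral>\<^sup>+ \<omega>. f \<omega> \<partial>noise W) * (\<integral>\<^sup>+ \<omega>. g \<omega> \<partial>noise W)"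
proof -
  note [measurable] = f g block_noise[OF f] block_noise[OF g]
  have "(\<integral>\<^sup>+ \<omega>. f \<omega> * g \<omega> \<partial>noise W) = (\<integral>\<^sup>+ \<omega>. \<integral>\<^sup>+ \<omega>'. f \<omega> * g \<omega>' \<partial>noise W \<partial>noise W)"
    using nn_integral_blocks[OF assms(1), of "\<lambda>(\<omega>, \<omega>'). f \<omega> * g \<omega>'"] by simp
  also have "\<dots> = (\<integral>\<^sup>+ \<omega>. f \<omega> \<partial>noise W) * (\<integral>\<^sup>+ \<omega>. g \<omega> \<partial>noise W)"
    by (simp add: nn_integral_cmult nn_integral_multc)
  finally show ?thesis .
qed

text \<open>Joint measurability in time and \<open>\<omega>\<close> lets a Levy path be evaluated at
  a random time, such as a holding time, without leaving the sources in \<open>I\<close>.\<close>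

lemma levy_block:
  assumes "Levy n i \<in> I"
  shows "(\<lambda>(s, \<omega>). levy W n i (max 0 s) \<omega>) \<in> borel_measurable (borel \<Otimes>\<^sub>M block I)"
proof (rule borel_measurable_right_continuous_process)
  fix t :: real assume t: "0 \<le> t"
  have "real_path (levy W n i) \<in> source_algebra W (Levy n i) \<rightarrow>\<^sub>M real_path_space"
    by simp (rule measurable_vimage_algebra1, use measurable_space[OF real_path_measurable] in auto)
  moreover have "(\<lambda>p. p t) \<in> borel_measurable real_path_space"
    unfolding real_path_space_def by (rule measurable_component_singleton) (use t in auto)
  ultimately have "(\<lambda>\<omega>. real_path (levy W n i) \<omega> t) \<in> borel_measurable (source_algebra W (Levy n i))"
    by (rule measurable_compose)
  then show "levy W n i t \<in> borel_measurable (block I)"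
    using t by (intro measurable_block[OF assms]) (simp add: real_path_def)
qed (use levy[of n i] in \<open>simp add: levy_process_def\<close>)

lemma levy_compose_block:
  assumes "Levy n i \<in> I" "h \<in> borel_measurable (block I)"
  shows "(\<lambda>\<omega>. levy W n i (max 0 (h \<omega>)) \<omega>) \<in> borel_measurable (block I)"
  using measurable_compose[OF _ levy_block[OF assms(1)], of "\<lambda>\<omega>. (h \<omega>, \<omega>)" "block I"] assms(2) by simp

lemma kill_block: "Kill n i \<in> I \<Longrightarrow> kill W n i \<in> borel_measurable (block I)"
  by (erule measurable_block) (simp, rule measurable_vimage_algebra1, simp)

lemma hold_block: "Hold n i \<in> I \<Longrightarrow> hold W n i \<in> borel_measurable (block I)"
  by (erule measurable_block) (simp, rule measurable_vimage_algebra1, simp)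

lemma goto_block: "Goto n i \<in> I \<Longrightarrow> goto W n i \<in> block I \<rightarrow>\<^sub>M count_space UNIV"
  by (erule measurable_block) (simp, rule measurable_vimage_algebra1, simp)

lemma jump_block: "Jump n i j \<in> I \<Longrightarrow> jump W n i j \<in> borel_measurable (block I)"
  by (erule measurable_block) (simp, rule measurable_vimage_algebra1, simp)

text \<open>The history up to the \<open>n\<close>-th jump, counted in jumps instead of time. The
  sources of step \<open>n\<close> lie outside it, so what drives the holding period after that jump
  is independent of it.\<close>

abbreviation past :: "nat \<Rightarrow> 'w measure" where
  "past n \<equiv> block {c. source_step c < n}"

lemma past_Suc: "f \<in> past n \<rightarrow>\<^sub>M N \<Longrightarrow> f \<in> past (Suc n) \<rightarrow>\<^sub>M N"
  by (rule block_mono) auto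

lemma jump_chain_past: "jump_chain W i n \<in> past n \<rightarrow>\<^sub>M count_space UNIV"
proof (induction n)
  case (Suc n)
  show ?case
    unfolding jump_chain.simps
    by (rule measurable_finite_select[OF goto_block past_Suc[OF Suc]]) simp
qed simp

lemma hold_chain_past: "(\<lambda>\<omega>. hold W n (jump_chain W i n \<omega>) \<omega>) \<in> borel_measurable (past (Suc n))"
  by (rule measurable_finite_select[OF hold_block past_Suc[OF jump_chain_past]]) simp

lemma kill_chain_past: "(\<lambda>\<omega>. kill W n (jump_chain W i n \<omega>) \<omega>) \<in> borel_measurable (past (Suc n))"
  by (rule measurable_finite_select[OF kill_block past_Suc[OF jump_chain_past]]) simp

lemma jump_time_past: "jump_time W i n \<in> borel_measurable (past n)"
proof (induction n)
  case (Suc n)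
  show ?case
    unfolding jump_time.simps
    by (rule borel_measurable_ereal_add[OF past_Suc[OF Suc] hold_chain_past])
qed simp

lemma jump_position_past: "jump_position W x i n \<in> borel_measurable (past n)"
proof (induction n)
  case (Suc n)
  have "(\<lambda>\<omega>. levy W n a (max 0 (real_of_ereal (hold W n a \<omega>))) \<omega>) \<in> borel_measurable (past (Suc n))" for a
  proof (rule levy_compose_block)
    have "hold W n a \<in> borel_measurable (past (Suc n))" by (rule hold_block) simp
    then show "(\<lambda>\<omega>. real_of_ereal (hold W n a \<omega>)) \<in> borel_measurable (past (Suc n))" by measurable
  qed simp
  moreover have "max 0 (real_of_ereal (hold W n a \<omega>)) = real_of_ereal (hold W n a \<omega>)"
    if "\<omega> \<in> space (noise W)" for a \<omega>
    using hold_nonneg[OF that, of n a] by (simp add: max_def real_of_ereal_pos)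
  ultimately have L: "(\<lambda>\<omega>. levy W n a (real_of_ereal (hold W n a \<omega>)) \<omega>) \<in> borel_measurable (past (Suc n))" for a
    by (subst measurable_cong[where g = "\<lambda>\<omega>. levy W n a (max 0 (real_of_ereal (hold W n a \<omega>))) \<omega>"]) simp_all
  have "(\<lambda>\<omega>. jump W n a (jump_chain W i (Suc n) \<omega>) \<omega>) \<in> borel_measurable (past (Suc n))" for a
    by (rule measurable_finite_select[where f = "jump W n a", OF jump_block jump_chain_past]) simp
  then have J: "(\<lambda>\<omega>. jump W n (jump_chain W i n \<omega>) (jump_chain W i (Suc n) \<omega>) \<omega>) \<in> borel_measurable (past (Suc n))"
    by (rule measurable_finite_select[where f = "\<lambda>a \<omega>. jump W n a (jump_chain W i (Suc n) \<omega>) \<omega>", OF _ past_Suc[OF jump_chain_past]])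
  show ?case
    unfolding jump_position.simps Let_def jump_chain.simps
    by (rule borel_measurable_add[OF borel_measurable_add[OF past_Suc[OF Suc]
          measurable_finite_select[where f = "\<lambda>a \<omega>. levy W n a (real_of_ereal (hold W n a \<omega>)) \<omega>",
            OF L past_Suc[OF jump_chain_past]]] J[unfolded jump_chain.simps]])
qed simp

text \<open>The survival clause of \<open>map_path\<close> for the completed holding periods,
  singled out because it obeys a recursion in \<open>n\<close>.\<close>

definition unkilled :: "'n \<Rightarrow> nat \<Rightarrow> 'w \<Rightarrow> bool" where
  "unkilled i n \<omega> \<longleftrightarrow> (\<forall>m<n. hold W m (jump_chain W i m \<omega>) \<omega> < kill W m (jump_chain W i m \<omega>) \<omega>)"

lemma unkilled_Suc:
  "unkilled i (Suc n) \<omega> \<longleftrightarrow> unkilled i n \<omega> \<and> hold W n (jump_chain W i n \<omega>) \<omega> < kill W n (jump_chain W i n \<omega>) \<omega>"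
  by (auto simp: unkilled_def less_Suc_eq)

lemma unkilled_past: "Measurable.pred (past n) (unkilled i n)"
proof (induction n)
  case (Suc n)
  note [measurable] = past_Suc[OF Suc] hold_chain_past kill_chain_past
  show ?case unfolding unkilled_Suc by measurable
qed (simp add: unkilled_def)

end

section \<open>Exponential moments along the jumps of the chain\<close>

text \<open>For \<open>r = 0\<close> the time exceeds \<open>u\<close> almost surely and both sides
  vanish. For \<open>r > 0\<close> the tails force it to be almost surely finite, and its real value
  has the exponential density.\<close>

lemma (in prob_space) exponential_time_nn_integral:
  assumes T: "exponential_time M r T" and "0 \<le> r" "0 \<le> u" and [measurable]: "g \<in> borel_measurable borel"
  shows "(\<integral>\<^sup>+ \<omega>. indicator {..ereal u} (T \<omega>) * g (real_of_ereal (T \<omega>)) \<partial>M)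
    = (\<integral>\<^sup>+ s. ennreal (r * exp (- r * s)) * indicator {0..u} s * g s \<partial>lborel)"
proof -
  have [measurable]: "T \<in> borel_measurable M" and nonneg: "\<And>\<omega>. \<omega> \<in> space M \<Longrightarrow> 0 \<le> T \<omega>"
    and tail: "\<And>t. 0 \<le> t \<Longrightarrow> prob {\<omega> \<in> space M. ereal t < T \<omega>} = exp (- r * t)"
    using T by (auto simp: exponential_time_def)
  show ?thesis
  proof (cases "r = 0")
    case True
    then have "AE \<omega> in M. ereal u < T \<omega>"
      using tail[OF \<open>0 \<le> u\<close>] by (intro prob_Collect_eq_1[THEN iffD1]) auto
    then have "AE \<omega> in M. indicator {..ereal u} (T \<omega>) * g (real_of_ereal (T \<omega>)) = 0"
      by eventually_elim auto
    then have "(\<integral>\<^sup>+ \<omega>. indicator {..ereal u} (T \<omega>) * g (real_of_ereal (T \<omega>)) \<partial>M) = (\<integral>\<^sup>+ \<omega>. 0 \<partial>M)"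
      by (rule nn_integral_cong_AE)
    then show ?thesis using True by simp
  next
    case False
    then have "0 < r" using \<open>0 \<le> r\<close> by simp
    have "prob {\<omega> \<in> space M. T \<omega> = \<infinity>} \<le> exp (- r * real n)" for n
      unfolding tail[OF of_nat_0_le_iff, symmetric] by (rule finite_measure_mono) auto
    moreover have "(\<lambda>n. exp (- r * real n)) \<longlonglongrightarrow> 0"
    proof -
      have "(\<lambda>n. exp (- r) ^ n) \<longlonglongrightarrow> 0"
        using \<open>0 < r\<close> by (intro LIMSEQ_realpow_zero) auto
      then show ?thesis by (simp add: exp_of_nat_mult[symmetric] mult.commute)
    qed
    ultimately have "prob {\<omega> \<in> space M. T \<omega> = \<infinity>} \<le> 0"
      by (intro LIMSEQ_le_const) auto
    then have "prob {\<omega> \<in> space M. T \<omega> = \<infinity>} = 0"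
      using measure_nonneg[of M] by (intro antisym) auto
    then have fin: "AE \<omega> in M. T \<omega> \<noteq> \<infinity>"
      by (subst (asm) prob_eq_0) (auto simp: AE_iff_measurable)
    have "distributed M lborel (\<lambda>\<omega>. real_of_ereal (T \<omega>)) (exponential_density r)"
    proof (rule exponential_distributedI[OF _ \<open>0 < r\<close>])
      fix s :: real assume "0 \<le> s"
      have "prob {\<omega> \<in> space M. real_of_ereal (T \<omega>) \<le> s} = prob {\<omega> \<in> space M. \<not> ereal s < T \<omega>}"
      proof (rule finite_measure_eq_AE)
        show "AE \<omega> in M. \<omega> \<in> {\<omega> \<in> space M. real_of_ereal (T \<omega>) \<le> s} \<longleftrightarrow> \<omega> \<in> {\<omega> \<in> space M. \<not> ereal s < T \<omega>}"
          using fin AE_space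
        proof eventually_elim
          case (elim \<omega>)
          then show ?case using nonneg[of \<omega>] by (cases "T \<omega>") auto
        qed
      qed auto
      also have "\<dots> = 1 - exp (- s * r)"
        using prob_neg[of "\<lambda>\<omega>. ereal s < T \<omega>"] tail[OF \<open>0 \<le> s\<close>] by (simp add: mult.commute)
      finally show "emeasure M {\<omega> \<in> space M. real_of_ereal (T \<omega>) \<le> s} = 1 - ennreal (exp (- s * r))"
        by (simp add: emeasure_eq_measure ennreal_minus ennreal_1[symmetric] del: ennreal_1)
    qed measurable
    from distributed_nn_integral[OF this, of "\<lambda>s. indicator {..u} s * g s"]
    have "(\<integral>\<^sup>+ \<omega>. indicator {..u} (real_of_ereal (T \<omega>)) * g (real_of_ereal (T \<omega>)) \<partial>M)
        = (\<integral>\<^sup>+ s. ennreal (exponential_density r s) * (indicator {..u} s * g s) \<partial>lborel)"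
      by simp
    moreover have "(\<integral>\<^sup>+ \<omega>. indicator {..ereal u} (T \<omega>) * g (real_of_ereal (T \<omega>)) \<partial>M)
        = (\<integral>\<^sup>+ \<omega>. indicator {..u} (real_of_ereal (T \<omega>)) * g (real_of_ereal (T \<omega>)) \<partial>M)"
    proof (rule nn_integral_cong_AE)
      show "AE \<omega> in M. indicator {..ereal u} (T \<omega>) * g (real_of_ereal (T \<omega>))
          = indicator {..u} (real_of_ereal (T \<omega>)) * g (real_of_ereal (T \<omega>))"
        using fin AE_space
      proof eventually_elim
        case (elim \<omega>)
        then show ?case using nonneg[of \<omega>] by (cases "T \<omega>") (auto split: split_indicator)
      qed
    qed
    moreover have "(\<integral>\<^sup>+ s. ennreal (exponential_density r s) * (indicator {..u} s * g s) \<partial>lborel)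
        = (\<integral>\<^sup>+ s. ennreal (r * exp (- r * s)) * indicator {0..u} s * g s \<partial>lborel)"
      by (rule nn_integral_cong) (auto simp: exponential_density_def mult.commute split: split_indicator)
    ultimately show ?thesis by simp
  qed
qed

lemma nn_integral_indicator_greaterThan:
  fixes T :: "'a \<Rightarrow> 'b::linorder_topology"
  assumes [measurable]: "T \<in> borel_measurable M"
  shows "(\<integral>\<^sup>+ \<omega>. indicator {c<..} (T \<omega>) \<partial>M) = emeasure M {\<omega> \<in> space M. c < T \<omega>}"
proof -
  have "T -` {c<..} \<inter> space M = {\<omega> \<in> space M. c < T \<omega>}" by auto
  then show ?thesis
    using nn_integral_indicator[of "T -` {c<..} \<inter> space M" M] measurable_sets[OF assms, of "{c<..}"]
    by (simp add: indicator_def cong: nn_integral_cong_simp)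
qed

section \<open>Expectations over one holding period of the chain\<close>

locale map_noise_subsolution = map_noise Q k W
  for Q :: "real^'n^'n" and k :: "'n::finite \<Rightarrow> real" and W :: "('w, 'n) map_ingredients" +
  fixes z \<kappa> :: real and v :: "real^'n"
  assumes offdiag: "\<And>i j. i \<noteq> j \<Longrightarrow> 0 \<le> Q $ i $ j"
    and row_sum: "\<And>i. (\<Sum>j\<in>UNIV. Q $ i $ j) = 0"
    and exponent_defined: "matrix_exponent_defined W z"
    and v_pos: "\<And>i. 0 < v $ i"
    and subsolution: "\<And>i. (matrix_exponent Q W z *v v) $ i \<le> \<kappa> * v $ i"
begin

abbreviation "\<psi> a \<equiv> laplace_exponent W a z"
abbreviation "G a b \<equiv> jump_transform W z $ a $ b"

text \<open>The description by \<open>THE\<close> is unambiguous because the integral at time 1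
  already determines the exponent.\<close>

lemma laplace_exponent: "has_laplace_exponent W a z (\<psi> a)"
proof -
  obtain p where p: "has_laplace_exponent W a z p"
    using exponent_defined unfolding matrix_exponent_defined_def by blast
  show ?thesis
    unfolding laplace_exponent_def
  proof (rule theI)
    show "has_laplace_exponent W a z p" by (rule p)
    fix p' assume "has_laplace_exponent W a z p'"
    note this[unfolded has_laplace_exponent_def, rule_format, OF zero_le_one]
      and p[unfolded has_laplace_exponent_def, rule_format, OF zero_le_one]
    then have "exp (p' * 1) = exp (p * 1)" by (rule has_bochner_integral_eq)
    then show "p' = p" by simp
  qed
qed

lemma diag_nonpos: "Q $ a $ a \<le> 0"
proof -
  have "Q $ a $ a = - (\<Sum>j\<in>UNIV - {a}. Q $ a $ j)"
    using row_sum[of a] by (simp add: sum.remove[of UNIV a])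
  moreover have "0 \<le> (\<Sum>j\<in>UNIV - {a}. Q $ a $ j)"
    by (intro sum_nonneg offdiag) auto
  ultimately show ?thesis by simp
qed

lemma tail_kill: "0 \<le> t \<Longrightarrow> emeasure (noise W) {\<omega> \<in> space (noise W). ereal t < kill W n a \<omega>} = ennreal (exp (- k a * t))"
  using kill[of a n] by (simp add: exponential_time_def emeasure_eq_measure)

lemma tail_hold: "0 \<le> t \<Longrightarrow> emeasure (noise W) {\<omega> \<in> space (noise W). ereal t < hold W n a \<omega>} = ennreal (exp (Q $ a $ a * t))"
  using hold[of a n] by (simp add: exponential_time_def emeasure_eq_measure)

text \<open>The Laplace exponent includes killing, and killing is independent of the Levy motion, so
  its survival probability splits off; equality of path laws carries the formula from the reference
  copy to copy \<open>n\<close>.\<close>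

lemma nn_integral_levy:
  assumes "0 \<le> s"
  shows "ennreal (exp (- k a * s)) * (\<integral>\<^sup>+ \<omega>. ennreal (exp (z * levy W n a s \<omega>)) \<partial>noise W) = ennreal (exp (\<psi> a * s))"
proof -
  have dist: "(\<integral>\<^sup>+ \<omega>. ennreal (exp (z * levy W m a s \<omega>)) \<partial>noise W)
      = (\<integral>\<^sup>+ p. ennreal (exp (z * p s)) \<partial>distr (noise W) real_path_space (real_path (levy W m a)))" for m
  proof -
    have "(\<lambda>p. p s) \<in> borel_measurable real_path_space"
      unfolding real_path_space_def by (rule measurable_component_singleton) (use assms in auto)
    then have "(\<lambda>p. ennreal (exp (z * p s))) \<in> borel_measurable real_path_space" by measurable
    then show ?thesis
      using assms by (simp add: nn_integral_distr[OF real_path_measurable] real_path_def)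
  qed
  have "distr (noise W) real_path_space (real_path (levy W n a)) = distr (noise W) real_path_space (real_path (levy W 0 a))"
    using ingredients by (simp add: ingredients_for_def)
  then have same: "(\<integral>\<^sup>+ \<omega>. ennreal (exp (z * levy W n a s \<omega>)) \<partial>noise W) = (\<integral>\<^sup>+ \<omega>. ennreal (exp (z * levy W 0 a s \<omega>)) \<partial>noise W)"
    by (simp only: dist)
  have kb: "kill W 0 a \<in> borel_measurable (block {Kill 0 a})" by (rule kill_block) simp
  have lb: "levy W 0 a s \<in> borel_measurable (block {Levy 0 a})"
    using levy_compose_block[of 0 a "{Levy 0 a}" "\<lambda>_. s"] assms by simp
  have km: "(\<lambda>\<omega>. indicator {ereal s<..} (kill W 0 a \<omega>) :: ennreal) \<in> borel_measurable (block {Kill 0 a})"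
    using kb by measurable
  have lm: "(\<lambda>\<omega>. ennreal (exp (z * levy W 0 a s \<omega>))) \<in> borel_measurable (block {Levy 0 a})"
    using lb by measurable
  have "ennreal (exp (\<psi> a * s))
      = (\<integral>\<^sup>+ \<omega>. ennreal (if ereal s < kill W 0 a \<omega> then exp (z * levy W 0 a s \<omega>) else 0) \<partial>noise W)"
    using laplace_exponent[of a] assms unfolding has_laplace_exponent_def
    by (subst nn_integral_eq_integral) (auto simp: has_bochner_integral_iff)
  also have "\<dots> = (\<integral>\<^sup>+ \<omega>. indicator {ereal s<..} (kill W 0 a \<omega>) * ennreal (exp (z * levy W 0 a s \<omega>)) \<partial>noise W)"
    by (rule nn_integral_cong) (auto split: split_indicator)
  also have "\<dots> = (\<integral>\<^sup>+ \<omega>. indicator {ereal s<..} (kill W 0 a \<omega>) \<partial>noise W) * (\<integral>\<^sup>+ \<omega>. ennreal (exp (z * levy W 0 a s \<omega>)) \<partial>noise W)"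
    by (rule nn_integral_blocks_mult[OF _ km lm]) simp
  also have "(\<integral>\<^sup>+ \<omega>. indicator {ereal s<..} (kill W 0 a \<omega>) \<partial>noise W) = ennreal (exp (- k a * s))"
    by (simp add: nn_integral_indicator_greaterThan tail_kill[OF assms])
  finally show ?thesis by (simp add: same)
qed

lemma nn_integral_jump: "(\<integral>\<^sup>+ \<omega>. ennreal (exp (z * jump W n a b \<omega>)) \<partial>noise W) = ennreal (G a b)"
proof -
  have dist: "(\<integral>\<^sup>+ \<omega>. ennreal (exp (z * jump W m a b \<omega>)) \<partial>noise W)
      = (\<integral>\<^sup>+ y. ennreal (exp (z * y)) \<partial>distr (noise W) borel (jump W m a b))" for m
    by (subst nn_integral_distr) auto
  have "distr (noise W) borel (jump W n a b) = distr (noise W) borel (jump W 0 a b)"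
    using ingredients by (simp add: ingredients_for_def)
  then have "(\<integral>\<^sup>+ \<omega>. ennreal (exp (z * jump W n a b \<omega>)) \<partial>noise W) = (\<integral>\<^sup>+ \<omega>. ennreal (exp (z * jump W 0 a b \<omega>)) \<partial>noise W)"
    by (simp only: dist)
  also have "\<dots> = ennreal (\<integral>\<omega>. exp (z * jump W 0 a b \<omega>) \<partial>noise W)"
    using exponent_defined by (intro nn_integral_eq_integral) (auto simp: matrix_exponent_defined_def)
  finally show ?thesis by (simp add: jump_transform_def)
qed

lemma G_nonneg: "0 \<le> G a b"
  by (simp add: jump_transform_def)

lemma G_diag: "G a a = 1"
proof -
  have "AE \<omega> in noise W. jump W 0 a a \<omega> = 0"
    using ingredients by (simp add: ingredients_for_def)
  then have "(\<integral>\<omega>. exp (z * jump W 0 a a \<omega>) \<partial>noise W) = (\<integral>\<omega>. 1 \<partial>noise W)"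
    by (intro integral_cong_AE) auto
  then show ?thesis by (simp add: jump_transform_def prob_space)
qed

lemma subsolution_row: "(\<Sum>b\<in>UNIV - {a}. Q $ a $ b * G a b * v $ b) \<le> (\<kappa> - \<psi> a - Q $ a $ a) * v $ a"
proof -
  have "(matrix_exponent Q W z *v v) $ a
      = (\<psi> a + Q $ a $ a) * v $ a + (\<Sum>b\<in>UNIV - {a}. Q $ a $ b * G a b * v $ b)"
    by (simp add: matrix_vector_mult_def matrix_exponent_def sum.remove[of UNIV a] G_diag)
  then show ?thesis using subsolution[of a] by (simp add: algebra_simps)
qed

text \<open>It bounds a sum of nonnegative terms. Since \<open>v $ a > 0\<close>, the discounted
  contribution of paths that stay in \<open>a\<close> cannot grow with time.\<close>

lemma rate_nonneg: "0 \<le> (\<kappa> - \<psi> a - Q $ a $ a) * v $ a"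
proof (rule order_trans[OF _ subsolution_row])
  show "0 \<le> (\<Sum>b\<in>UNIV - {a}. Q $ a $ b * G a b * v $ b)"
    using offdiag G_nonneg v_pos by (intro sum_nonneg mult_nonneg_nonneg) (auto intro: less_imp_le)
qed

text \<open>The mean of \<open>landing\<close>, introduced below.\<close>

definition landing_mean :: "nat \<Rightarrow> 'n \<Rightarrow> ennreal" where
  "landing_mean n a = (\<Sum>b\<in>UNIV. emeasure (noise W) {\<omega> \<in> space (noise W). goto W n a \<omega> = b} * ennreal (G a b * v $ b))"

text \<open>If \<open>Q $ a $ a = 0\<close>, the law of \<open>goto\<close> is unspecified but the
  factor in front vanishes. Otherwise the prescribed probabilities of the states other than
  \<open>a\<close> already sum to 1, so a jump back to \<open>a\<close> is null, and multiplying by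
  \<open>- Q $ a $ a\<close> restores the off-diagonal row of the matrix exponent.\<close>

lemma transition_rate: "ennreal (- Q $ a $ a) * landing_mean n a \<le> ennreal ((\<kappa> - \<psi> a - Q $ a $ a) * v $ a)"
proof (cases "Q $ a $ a = 0")
  case False
  then have neg: "Q $ a $ a < 0" using diag_nonpos[of a] by simp
  have other: "prob {\<omega> \<in> space (noise W). goto W n a \<omega> = b} = Q $ a $ b / (- Q $ a $ a)" if "b \<noteq> a" for b
    using ingredients neg that by (auto simp: ingredients_for_def)
  have "1 = prob (\<Union>b\<in>UNIV. {\<omega> \<in> space (noise W). goto W n a \<omega> = b})"
    by (subst prob_space[symmetric]) (auto intro!: arg_cong[where f = prob])
  also have "\<dots> = (\<Sum>b\<in>UNIV. prob {\<omega> \<in> space (noise W). goto W n a \<omega> = b})"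
    by (rule finite_measure_finite_Union) (auto simp: disjoint_family_on_def)
  also have "\<dots> = prob {\<omega> \<in> space (noise W). goto W n a \<omega> = a} + (\<Sum>b\<in>UNIV - {a}. Q $ a $ b / (- Q $ a $ a))"
    by (simp add: sum.remove[of UNIV a] other)
  also have "(\<Sum>b\<in>UNIV - {a}. Q $ a $ b / (- Q $ a $ a)) = 1"
    unfolding sum_divide_distrib[symmetric]
    using row_sum[of a] neg by (simp add: sum.remove[of UNIV a] field_simps)
  finally have stay: "prob {\<omega> \<in> space (noise W). goto W n a \<omega> = a} = 0" by simp
  have "ennreal (- Q $ a $ a) * landing_mean n a
      = (\<Sum>b\<in>UNIV - {a}. ennreal (- Q $ a $ a) * (ennreal (Q $ a $ b / (- Q $ a $ a)) * ennreal (G a b * v $ b)))"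
    by (simp add: landing_mean_def sum.remove[of UNIV a] emeasure_eq_measure stay other sum_distrib_left)
  also have "\<dots> = (\<Sum>b\<in>UNIV - {a}. ennreal (Q $ a $ b * G a b * v $ b))"
  proof (rule sum.cong[OF refl])
    fix b assume "b \<in> UNIV - {a}"
    then have "0 \<le> Q $ a $ b / (- Q $ a $ a)" using offdiag[of a b] neg by (intro divide_nonneg_pos) auto
    then show "ennreal (- Q $ a $ a) * (ennreal (Q $ a $ b / (- Q $ a $ a)) * ennreal (G a b * v $ b))
        = ennreal (Q $ a $ b * G a b * v $ b)"
      using neg G_nonneg[of a b] v_pos[of b] by (simp add: mult.assoc flip: ennreal_mult')
  qed
  also have "\<dots> = ennreal (\<Sum>b\<in>UNIV - {a}. Q $ a $ b * G a b * v $ b)"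
    using offdiag G_nonneg v_pos by (intro sum_ennreal mult_nonneg_nonneg) (auto intro: less_imp_le)
  also have "\<dots> \<le> ennreal ((\<kappa> - \<psi> a - Q $ a $ a) * v $ a)"
    by (rule ennreal_leI[OF subsolution_row])
  finally show ?thesis .
qed simp


text \<open>
  Seen from the \<open>n\<close>-th jump, with a time \<open>u\<close> left, \<open>stay\<close> is the contribution of the paths which
  make no further jump before \<open>u\<close>, and \<open>leave\<close> that of the paths which do, evaluated just after
  that jump.
\<close>

definition stay :: "nat \<Rightarrow> 'n \<Rightarrow> real \<Rightarrow> 'w \<Rightarrow> ennreal" where
  "stay n a u \<omega> = indicator {ereal u<..} (hold W n a \<omega>) *
     (indicator {ereal u<..} (kill W n a \<omega>) *
      (ennreal (exp (z * levy W n a (max 0 u) \<omega>)) * ennreal (exp (- \<kappa> * u) * v $ a)))"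

definition landing :: "nat \<Rightarrow> 'n \<Rightarrow> 'w \<Rightarrow> ennreal" where
  "landing n a \<omega> = (\<Sum>b\<in>UNIV. indicator {b} (goto W n a \<omega>) * (ennreal (exp (z * jump W n a b \<omega>)) * ennreal (v $ b)))"

definition leave :: "nat \<Rightarrow> 'n \<Rightarrow> real \<Rightarrow> 'w \<Rightarrow> ennreal" where
  "leave n a u \<omega> = indicator {..ereal u} (hold W n a \<omega>) * (ennreal (exp (- \<kappa> * real_of_ereal (hold W n a \<omega>))) *
     (indicator {hold W n a \<omega><..} (kill W n a \<omega>) *
      (ennreal (exp (z * levy W n a (max 0 (real_of_ereal (hold W n a \<omega>))) \<omega>)) * landing n a \<omega>)))"

lemma landing_block:
  assumes "Goto n a \<in> I" "\<And>b. Jump n a b \<in> I"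
  shows "landing n a \<in> borel_measurable (block I)"
proof -
  note [measurable] = goto_block[OF assms(1)] jump_block[OF assms(2)]
  show ?thesis unfolding landing_def by measurable
qed

lemma nn_integral_landing: "(\<integral>\<^sup>+ \<omega>. landing n a \<omega> \<partial>noise W) = landing_mean n a"
proof -
  have "(\<integral>\<^sup>+ \<omega>. indicator {b} (goto W n a \<omega>) * (ennreal (exp (z * jump W n a b \<omega>)) * ennreal (v $ b)) \<partial>noise W)
      = emeasure (noise W) {\<omega> \<in> space (noise W). goto W n a \<omega> = b} * ennreal (G a b * v $ b)" for b
  proof -
    note [measurable] = goto_block[of n a "{Goto n a}"] jump_block[of n a b "{Jump n a b}"]
    have "(\<integral>\<^sup>+ \<omega>. indicator {b} (goto W n a \<omega>) * (ennreal (exp (z * jump W n a b \<omega>)) * ennreal (v $ b)) \<partial>noise W)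
        = (\<integral>\<^sup>+ \<omega>. indicator {b} (goto W n a \<omega>) \<partial>noise W)
          * (\<integral>\<^sup>+ \<omega>. ennreal (exp (z * jump W n a b \<omega>)) * ennreal (v $ b) \<partial>noise W)"
      by (rule nn_integral_blocks_mult[of "{Goto n a}" "{Jump n a b}"]) (simp, measurable)
    also have "(\<integral>\<^sup>+ \<omega>. indicator {b} (goto W n a \<omega>) \<partial>noise W)
        = (\<integral>\<^sup>+ \<omega>. indicator {\<omega> \<in> space (noise W). goto W n a \<omega> = b} \<omega> \<partial>noise W)"
      by (rule nn_integral_cong) (auto split: split_indicator)
    also have "\<dots> = emeasure (noise W) {\<omega> \<in> space (noise W). goto W n a \<omega> = b}"
      by (rule nn_integral_indicator) measurable
    also have "(\<integral>\<^sup>+ \<omega>. ennreal (exp (z * jump W n a b \<omega>)) * ennreal (v $ b) \<partial>noise W) = ennreal (G a b * v $ b)"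
      using v_pos[of b] G_nonneg[of a b]
      by (simp add: nn_integral_multc nn_integral_jump ennreal_mult less_imp_le)
    finally show ?thesis .
  qed
  then show ?thesis
    unfolding landing_def landing_mean_def by (subst nn_integral_sum) simp_all
qed

text \<open>Killing, Levy motion and \<open>f\<close> are independent, and the first two recombine
  to \<open>exp (\<psi> a * s)\<close>. A constant \<open>f\<close> serves \<open>stay\<close>, and
  \<open>f = landing n a\<close> serves \<open>leave\<close>.\<close>

lemma nn_integral_kill_levy:
  assumes "0 \<le> s" and f: "f \<in> borel_measurable (block I)" and I: "Kill n a \<notin> I" "Levy n a \<notin> I"
  shows "(\<integral>\<^sup>+ \<omega>. indicator {ereal s<..} (kill W n a \<omega>) * (ennreal (exp (z * levy W n a s \<omega>)) * f \<omega>) \<partial>noise W)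
    = ennreal (exp (\<psi> a * s)) * (\<integral>\<^sup>+ \<omega>. f \<omega> \<partial>noise W)"
proof -
  have l: "levy W n a s \<in> borel_measurable (block J)" if "Levy n a \<in> J" for J
    using levy_compose_block[OF that, of "\<lambda>_. s"] assms(1) by simp
  have l1: "(\<lambda>\<omega>. ennreal (exp (z * levy W n a s \<omega>))) \<in> borel_measurable (block {Levy n a})"
    using l[of "{Levy n a}"] by measurable
  have k1: "(\<lambda>\<omega>. indicator {ereal s<..} (kill W n a \<omega>) :: ennreal) \<in> borel_measurable (block {Kill n a})"
    using kill_block[of n a "{Kill n a}"] by measurable
  have f': "f \<in> borel_measurable (block (insert (Levy n a) I))"
    by (rule block_mono[OF _ f]) auto
  have g: "(\<lambda>\<omega>. ennreal (exp (z * levy W n a s \<omega>)) * f \<omega>) \<in> borel_measurable (block (insert (Levy n a) I))"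
    using l[of "insert (Levy n a) I"] f' by measurable
  have "(\<integral>\<^sup>+ \<omega>. indicator {ereal s<..} (kill W n a \<omega>) * (ennreal (exp (z * levy W n a s \<omega>)) * f \<omega>) \<partial>noise W)
      = (\<integral>\<^sup>+ \<omega>. indicator {ereal s<..} (kill W n a \<omega>) \<partial>noise W)
        * (\<integral>\<^sup>+ \<omega>. ennreal (exp (z * levy W n a s \<omega>)) * f \<omega> \<partial>noise W)"
    by (rule nn_integral_blocks_mult[OF _ k1 g]) (use I in auto)
  also have "(\<integral>\<^sup>+ \<omega>. ennreal (exp (z * levy W n a s \<omega>)) * f \<omega> \<partial>noise W)
      = (\<integral>\<^sup>+ \<omega>. ennreal (exp (z * levy W n a s \<omega>)) \<partial>noise W) * (\<integral>\<^sup>+ \<omega>. f \<omega> \<partial>noise W)"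
    by (rule nn_integral_blocks_mult[OF _ l1 f]) (use I in auto)
  also have "(\<integral>\<^sup>+ \<omega>. indicator {ereal s<..} (kill W n a \<omega>) \<partial>noise W) = ennreal (exp (- k a * s))"
    by (simp add: nn_integral_indicator_greaterThan tail_kill[OF assms(1)])
  finally show ?thesis
    by (simp only: nn_integral_levy[OF assms(1), of a n, symmetric] mult.assoc)
qed

text \<open>By independence, holding, surviving and Levy growth contribute separate exponential
  factors, which merge with the discount into one exponent.\<close>

lemma nn_integral_stay:
  assumes "0 \<le> u"
  shows "(\<integral>\<^sup>+ \<omega>. stay n a u \<omega> \<partial>noise W) = ennreal (v $ a * exp ((\<psi> a + Q $ a $ a - \<kappa>) * u))"
proof -
  define g where "g \<omega> = indicator {ereal u<..} (kill W n a \<omega>) *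
      (ennreal (exp (z * levy W n a u \<omega>)) * ennreal (exp (- \<kappa> * u) * v $ a))" for \<omega>
  have h1: "(\<lambda>\<omega>. indicator {ereal u<..} (hold W n a \<omega>) :: ennreal) \<in> borel_measurable (block {Hold n a})"
    using hold_block[of n a "{Hold n a}"] by measurable
  have g1: "g \<in> borel_measurable (block {Kill n a, Levy n a})"
    unfolding g_def
    using kill_block[of n a "{Kill n a, Levy n a}"] levy_compose_block[of n a "{Kill n a, Levy n a}" "\<lambda>_. u"] assms
    by simp
  have "(\<integral>\<^sup>+ \<omega>. stay n a u \<omega> \<partial>noise W) = (\<integral>\<^sup>+ \<omega>. indicator {ereal u<..} (hold W n a \<omega>) * g \<omega> \<partial>noise W)"
    using assms by (simp add: stay_def g_def)
  also have "\<dots> = (\<integral>\<^sup>+ \<omega>. indicator {ereal u<..} (hold W n a \<omega>) \<partial>noise W) * (\<integral>\<^sup>+ \<omega>. g \<omega> \<partial>noise W)"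
    by (rule nn_integral_blocks_mult[OF _ h1 g1]) simp
  also have "(\<integral>\<^sup>+ \<omega>. indicator {ereal u<..} (hold W n a \<omega>) \<partial>noise W) = ennreal (exp (Q $ a $ a * u))"
    by (simp add: nn_integral_indicator_greaterThan tail_hold[OF assms])
  also have "(\<integral>\<^sup>+ \<omega>. g \<omega> \<partial>noise W) = ennreal (exp (\<psi> a * u)) * ennreal (exp (- \<kappa> * u) * v $ a)"
    unfolding g_def by (subst nn_integral_kill_levy[OF assms, where I = "{}"]) (simp_all add: emeasure_space_1)
  also have "ennreal (exp (Q $ a $ a * u)) * (ennreal (exp (\<psi> a * u)) * ennreal (exp (- \<kappa> * u) * v $ a))
      = ennreal (v $ a * exp ((\<psi> a + Q $ a $ a - \<kappa>) * u))"
    using v_pos[of a] by (simp add: algebra_simps exp_add exp_diff exp_minus divide_inverse flip: ennreal_mult')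
  finally show ?thesis .
qed

text \<open>The holding time is independent of the sources in \<open>J\<close>, so it can be frozen:
  given the value \<open>h\<close>, the rest has mean
  \<open>exp ((\<psi> a - \<kappa>) * h) * landing_mean n a\<close>. Integrating against the
  exponential law and using \<open>transition_rate\<close> leaves an elementary integral.\<close>

lemma nn_integral_leave:
  assumes "0 \<le> u"
  shows "(\<integral>\<^sup>+ \<omega>. leave n a u \<omega> \<partial>noise W) \<le> ennreal (v $ a * (1 - exp ((\<psi> a + Q $ a $ a - \<kappa>) * u)))"
proof -
  define J where "J = {Kill n a, Levy n a, Goto n a} \<union> range (Jump n a)"
  define r where "r = - Q $ a $ a"
  define e where "e = \<kappa> - \<psi> a - Q $ a $ a"
  have "0 \<le> r" using diag_nonpos[of a] by (simp add: r_def)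
  have J: "Kill n a \<in> J" "Levy n a \<in> J" "Goto n a \<in> J" "\<And>b. Jump n a b \<in> J"
    by (auto simp: J_def)
  define f where "f = (\<lambda>(\<omega>, \<omega>'). indicator {..ereal u} (hold W n a \<omega>) * (ennreal (exp (- \<kappa> * real_of_ereal (hold W n a \<omega>))) *
     (indicator {hold W n a \<omega><..} (kill W n a \<omega>') *
      (ennreal (exp (z * levy W n a (max 0 (real_of_ereal (hold W n a \<omega>))) \<omega>')) * landing n a \<omega>'))))"
  note hb [measurable] = hold_block[of n a "{Hold n a}", simplified]
  note [measurable] = kill_block[OF J(1)] landing_block[OF J(3,4)]
  have "(\<lambda>p. (real_of_ereal (hold W n a (fst p)), snd p)) \<in> block {Hold n a} \<Otimes>\<^sub>M block J \<rightarrow>\<^sub>M borel \<Otimes>\<^sub>M block J"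
    by measurable
  from measurable_compose[OF this levy_block[OF J(2)]]
  have [measurable]: "(\<lambda>p. levy W n a (max 0 (real_of_ereal (hold W n a (fst p)))) (snd p))
      \<in> borel_measurable (block {Hold n a} \<Otimes>\<^sub>M block J)"
    by simp
  have f: "f \<in> borel_measurable (block {Hold n a} \<Otimes>\<^sub>M block J)"
    unfolding f_def split_beta indicator_def greaterThan_iff atMost_iff by measurable
  have inner: "(\<integral>\<^sup>+ \<omega>'. f (\<omega>, \<omega>') \<partial>noise W)
      = indicator {..ereal u} (hold W n a \<omega>) * ennreal (exp ((\<psi> a - \<kappa>) * real_of_ereal (hold W n a \<omega>))) * landing_mean n a"
    if \<omega>: "\<omega> \<in> space (noise W)" for \<omega>
  proof (cases "hold W n a \<omega> \<le> ereal u")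
    case True
    then obtain h where h: "hold W n a \<omega> = ereal h" "0 \<le> h"
      using hold_nonneg[OF \<omega>, of n a] by (cases "hold W n a \<omega>") auto
    have lb: "landing n a \<in> borel_measurable (block ({Goto n a} \<union> range (Jump n a)))"
      by (rule landing_block) auto
    have "(\<integral>\<^sup>+ \<omega>'. f (\<omega>, \<omega>') \<partial>noise W) = ennreal (exp (- \<kappa> * h)) *
        (\<integral>\<^sup>+ \<omega>'. indicator {ereal h<..} (kill W n a \<omega>') * (ennreal (exp (z * levy W n a h \<omega>')) * landing n a \<omega>') \<partial>noise W)"
      using True h block_noise[OF lb] levy_measurable[OF h(2), of n a]
      by (simp add: f_def nn_integral_cmult)
    also have "\<dots> = ennreal (exp (- \<kappa> * h)) * (ennreal (exp (\<psi> a * h)) * landing_mean n a)"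
      by (subst nn_integral_kill_levy[OF h(2) lb]) (auto simp: nn_integral_landing)
    also have "\<dots> = ennreal (exp (- \<kappa> * h) * exp (\<psi> a * h)) * landing_mean n a"
      by (simp add: ennreal_mult mult.assoc)
    also have "exp (- \<kappa> * h) * exp (\<psi> a * h) = exp ((\<psi> a - \<kappa>) * h)"
      unfolding exp_add[symmetric] by (simp add: algebra_simps)
    finally show ?thesis using True h by simp
  qed (simp add: f_def)
  have "(\<integral>\<^sup>+ \<omega>. leave n a u \<omega> \<partial>noise W) = (\<integral>\<^sup>+ \<omega>. f (\<omega>, \<omega>) \<partial>noise W)"
    by (simp add: leave_def f_def)
  also have "\<dots> = (\<integral>\<^sup>+ \<omega>. \<integral>\<^sup>+ \<omega>'. f (\<omega>, \<omega>') \<partial>noise W \<partial>noise W)"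
    by (rule nn_integral_blocks[OF _ f]) (auto simp: J_def)
  also have "\<dots> = (\<integral>\<^sup>+ \<omega>. indicator {..ereal u} (hold W n a \<omega>) * ennreal (exp ((\<psi> a - \<kappa>) * real_of_ereal (hold W n a \<omega>))) \<partial>noise W) * landing_mean n a"
    by (subst nn_integral_cong[OF inner]) (simp_all add: nn_integral_multc)
  also have "(\<integral>\<^sup>+ \<omega>. indicator {..ereal u} (hold W n a \<omega>) * ennreal (exp ((\<psi> a - \<kappa>) * real_of_ereal (hold W n a \<omega>))) \<partial>noise W)
      = (\<integral>\<^sup>+ s. ennreal (r * exp (- r * s)) * indicator {0..u} s * ennreal (exp ((\<psi> a - \<kappa>) * s)) \<partial>lborel)"
    by (rule exponential_time_nn_integral[OF _ \<open>0 \<le> r\<close> assms]) (use hold[of a n] in \<open>auto simp: r_def\<close>)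
  also have "\<dots> = (\<integral>\<^sup>+ s. ennreal r * (ennreal (exp (- e * s)) * indicator {0..u} s) \<partial>lborel)"
  proof (rule nn_integral_cong)
    fix s
    have "r * exp (- r * s) * exp ((\<psi> a - \<kappa>) * s) = r * exp (- e * s)"
      unfolding mult.assoc exp_add[symmetric] by (simp add: r_def e_def algebra_simps)
    then show "ennreal (r * exp (- r * s)) * indicator {0..u} s * ennreal (exp ((\<psi> a - \<kappa>) * s))
        = ennreal r * (ennreal (exp (- e * s)) * indicator {0..u} s)"
      using \<open>0 \<le> r\<close> by (auto simp flip: ennreal_mult' split: split_indicator)
  qed
  \<comment> \<open>The rate \<open>r\<close> is attached to \<open>landing_mean\<close>, since the
    subsolution bounds only their product.\<close>
  also have "\<dots> * landing_mean n a = (\<integral>\<^sup>+ s. ennreal (exp (- e * s)) * indicator {0..u} s \<partial>lborel) * (ennreal r * landing_mean n a)"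
    by (simp add: nn_integral_cmult ac_simps)
  also have "\<dots> \<le> (\<integral>\<^sup>+ s. ennreal (exp (- e * s)) * indicator {0..u} s \<partial>lborel) * ennreal (e * v $ a)"
    unfolding r_def e_def by (rule mult_left_mono[OF transition_rate]) simp
  \<comment> \<open>With the factor \<open>e\<close> inside the integrand a primitive exists without
    dividing by \<open>e\<close>, which may vanish.\<close>
  also have "\<dots> = (\<integral>\<^sup>+ s. ennreal (e * v $ a * exp (- e * s)) * indicator {0..u} s \<partial>lborel)"
  proof (subst nn_integral_multc[symmetric])
    have "0 \<le> e * v $ a" using rate_nonneg[of a] by (simp add: e_def)
    then have "ennreal (e * v $ a * exp (- e * s)) = ennreal (e * v $ a) * ennreal (exp (- e * s))" for s
      by (rule ennreal_mult) simp
    then show "(\<integral>\<^sup>+ s. ennreal (exp (- e * s)) * indicator {0..u} s * ennreal (e * v $ a) \<partial>lborel)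
        = (\<integral>\<^sup>+ s. ennreal (e * v $ a * exp (- e * s)) * indicator {0..u} s \<partial>lborel)"
      by (simp only: ac_simps)
  qed simp
  also have "\<dots> = ennreal ((- v $ a * exp (- e * u)) - (- v $ a * exp (- e * 0)))"
  proof (rule nn_integral_FTC_Icc)
    show "((\<lambda>s. - v $ a * exp (- e * s)) has_real_derivative e * v $ a * exp (- e * s)) (at s)" for s
      by (auto intro!: derivative_eq_intros)
    show "0 \<le> e * v $ a * exp (- e * s)" for s
      using rate_nonneg[of a] by (simp add: e_def)
  qed (use assms in auto)
  also have "\<dots> = ennreal (v $ a * (1 - exp ((\<psi> a + Q $ a $ a - \<kappa>) * u)))"
    by (simp add: e_def algebra_simps)
  finally show ?thesis .
qed

text \<open>The exponential terms of the two contributions cancel: this is the supermartingale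
  inequality for one holding period, stopped at \<open>u\<close>.\<close>

lemma nn_integral_stay_leave:
  assumes "0 \<le> u"
  shows "(\<integral>\<^sup>+ \<omega>. stay n a u \<omega> \<partial>noise W) + (\<integral>\<^sup>+ \<omega>. leave n a u \<omega> \<partial>noise W) \<le> ennreal (v $ a)"
proof -
  have "\<psi> a + Q $ a $ a - \<kappa> \<le> 0"
    using rate_nonneg[of a] v_pos[of a] by (simp add: zero_le_mult_iff)
  then have "exp ((\<psi> a + Q $ a $ a - \<kappa>) * u) \<le> 1"
    using assms by (simp add: mult_nonpos_nonneg)
  then have *: "ennreal (v $ a * exp ((\<psi> a + Q $ a $ a - \<kappa>) * u))
      + ennreal (v $ a * (1 - exp ((\<psi> a + Q $ a $ a - \<kappa>) * u))) = ennreal (v $ a)"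
    using v_pos[of a] by (simp add: algebra_simps flip: ennreal_plus)
  show ?thesis
    unfolding nn_integral_stay[OF assms] *[symmetric]
    by (rule add_left_mono[OF nn_integral_leave[OF assms]])
qed

end

context map_noise
begin

lemma jump_time_nonneg:
  assumes "\<omega> \<in> space (noise W)"
  shows "0 \<le> jump_time W i n \<omega>"
  by (induction n) (auto simp: hold_nonneg[OF assms])

end

section \<open>Telescoping over the jumps of the chain\<close>

context map_noise_subsolution
begin

text \<open>The discounted exponential just after the \<open>n\<close>-th jump, set to 0 if that
  jump comes after \<open>t\<close> or the path is killed before it. The entry of \<open>v\<close>
  is left out because \<open>stay\<close> and \<open>leave\<close> supply it for the state in which
  they end.\<close>

definition weight :: "real \<Rightarrow> 'n \<Rightarrow> real \<Rightarrow> nat \<Rightarrow> 'w \<Rightarrow> ennreal" where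
  "weight x i t n \<omega> = (if jump_time W i n \<omega> \<le> ereal t \<and> unkilled i n \<omega>
     then ennreal (exp (z * jump_position W x i n \<omega> - \<kappa> * real_of_ereal (jump_time W i n \<omega>))) else 0)"

text \<open>On paths alive at time \<open>t\<close> with exactly \<open>n\<close> jumps so far this
  is \<open>exp (z \<xi>(t) - \<kappa> t) v(\<Theta>(t))\<close>; elsewhere it is 0.\<close>

definition present :: "real \<Rightarrow> 'n \<Rightarrow> real \<Rightarrow> nat \<Rightarrow> 'w \<Rightarrow> ennreal" where
  "present x i t n \<omega> = weight x i t n \<omega> * stay n (jump_chain W i n \<omega>) (t - real_of_ereal (jump_time W i n \<omega>)) \<omega>"

lemma weight_past: "weight x i t n \<in> borel_measurable (past n)"
proof -
  note [measurable] = jump_time_past[of i n] unkilled_past jump_position_past[of x i n]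
  show ?thesis unfolding weight_def by measurable
qed

text \<open>A pathwise identity. If the next jump occurs by time \<open>t\<close> without killing,
  the exponent splits into past (\<open>?A\<close>), discount (\<open>?B\<close>), Levy increment
  (\<open>?C\<close>) and transition jump (\<open>?D\<close>); in all other cases both sides
  vanish.\<close>

lemma weight_Suc:
  assumes \<omega>: "\<omega> \<in> space (noise W)"
  shows "weight x i t (Suc n) \<omega> * ennreal (v $ jump_chain W i (Suc n) \<omega>)
    = weight x i t n \<omega> * leave n (jump_chain W i n \<omega>) (t - real_of_ereal (jump_time W i n \<omega>)) \<omega>"
proof -
  define a where "a = jump_chain W i n \<omega>"
  define b where "b = goto W n a \<omega>"
  have landing: "landing n a \<omega> = ennreal (exp (z * jump W n a b \<omega>)) * ennreal (v $ b)"
  proof -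
    have "landing n a \<omega> = (\<Sum>c\<in>UNIV. if c = b then ennreal (exp (z * jump W n a c \<omega>)) * ennreal (v $ c) else 0)"
      unfolding landing_def b_def by (rule sum.cong) auto
    then show ?thesis by simp
  qed
  show ?thesis
  proof (cases "jump_time W i n \<omega> \<le> ereal t")
    case False
    then have "\<not> jump_time W i (Suc n) \<omega> \<le> ereal t"
      using hold_nonneg[OF \<omega>, of n "jump_chain W i n \<omega>"]
      by (metis add.right_neutral add_left_mono jump_time.simps(2) order_trans)
    with False show ?thesis by (simp add: weight_def del: jump_time.simps)
  next
    case True
    then obtain \<tau> where \<tau>: "jump_time W i n \<omega> = ereal \<tau>" "0 \<le> \<tau>"
      using jump_time_nonneg[OF \<omega>, of i n] by (cases "jump_time W i n \<omega>") auto
    show ?thesis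
    proof (cases "hold W n a \<omega> \<le> ereal (t - \<tau>)")
      case False
      then have "\<not> ereal \<tau> + hold W n a \<omega> \<le> ereal t"
        by (cases "hold W n a \<omega>") auto
      with False show ?thesis by (simp add: weight_def leave_def \<tau> a_def)
    next
      case True
      then obtain h where h: "hold W n a \<omega> = ereal h" "0 \<le> h"
        using hold_nonneg[OF \<omega>, of n a] by (cases "hold W n a \<omega>") auto
      let ?A = "exp (z * jump_position W x i n \<omega> - \<kappa> * \<tau>)"
      let ?B = "exp (- \<kappa> * h)" and ?C = "exp (z * levy W n a h \<omega>)" and ?D = "exp (z * jump W n a b \<omega>)"
      have eq: "exp (z * (jump_position W x i n \<omega> + levy W n a h \<omega> + jump W n a b \<omega>) - \<kappa> * (\<tau> + h))
          = ?A * (?B * (?C * ?D))"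
        unfolding exp_add[symmetric] by (simp add: algebra_simps)
      have chain: "jump_chain W i (Suc n) \<omega> = b" by (simp add: a_def b_def)
      have time: "jump_time W i (Suc n) \<omega> = ereal (\<tau> + h)" by (simp add: \<tau> h flip: a_def)
      have pos: "jump_position W x i (Suc n) \<omega> = jump_position W x i n \<omega> + levy W n a h \<omega> + jump W n a b \<omega>"
        by (simp add: h b_def flip: a_def)
      have "\<tau> + h \<le> t" using True h by simp
      show ?thesis
      proof (cases "unkilled i n \<omega> \<and> hold W n a \<omega> < kill W n a \<omega>")
        case alive: True
        have "weight x i t (Suc n) \<omega> = ennreal (?A * (?B * (?C * ?D)))"
          using alive \<open>\<tau> + h \<le> t\<close> unfolding weight_def time pos unkilled_Suc a_def[symmetric]
          by (simp only: eq real_of_ereal.simps ereal_less_eq simp_thms if_True)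
        also have "\<dots> = ennreal ?A * (ennreal ?B * (ennreal ?C * ennreal ?D))"
          by (simp only: ennreal_mult exp_ge_zero mult_nonneg_nonneg)
        finally have w: "weight x i t (Suc n) \<omega> = ennreal ?A * (ennreal ?B * (ennreal ?C * ennreal ?D))" .
        have w': "weight x i t n \<omega> = ennreal ?A"
          using alive \<open>jump_time W i n \<omega> \<le> ereal t\<close> \<tau>(1) by (simp add: weight_def)
        have "leave n a (t - \<tau>) \<omega> = ennreal ?B * (ennreal ?C * (ennreal ?D * ennreal (v $ b)))"
          using alive True h by (simp add: leave_def landing)
        then show ?thesis
          unfolding w w' chain a_def[symmetric] by (simp add: \<tau>(1) mult.assoc)
      next
        case False
        then show ?thesis
          by (auto simp: weight_def leave_def unkilled_Suc simp flip: a_def)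
      qed
    qed
  qed
qed

lemma measurable_stay_leave:
  assumes "Kill n a \<in> J" "Levy n a \<in> J" "Goto n a \<in> J" "Hold n a \<in> J" "\<And>b. Jump n a b \<in> J"
  shows "(\<lambda>(u, \<omega>). stay n a u \<omega>) \<in> borel_measurable (borel \<Otimes>\<^sub>M block J)"
    and "(\<lambda>(u, \<omega>). leave n a u \<omega>) \<in> borel_measurable (borel \<Otimes>\<^sub>M block J)"
proof -
  note [measurable] = kill_block[OF assms(1)] hold_block[OF assms(4)] landing_block[OF assms(3,5)]
    levy_block[OF assms(2)] levy_compose_block[OF assms(2)]
  have [measurable]: "(\<lambda>p. levy W n a (max 0 (fst p)) (snd p)) \<in> borel_measurable (borel \<Otimes>\<^sub>M block J)"
    using levy_block[OF assms(2)] by (simp add: split_beta)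
  show "(\<lambda>(u, \<omega>). stay n a u \<omega>) \<in> borel_measurable (borel \<Otimes>\<^sub>M block J)"
    unfolding stay_def split_beta indicator_def greaterThan_iff by measurable
  show "(\<lambda>(u, \<omega>). leave n a u \<omega>) \<in> borel_measurable (borel \<Otimes>\<^sub>M block J)"
    unfolding leave_def split_beta indicator_def greaterThan_iff atMost_iff by measurable
qed

text \<open>The time left is itself random and depends on earlier sources, so measurability is taken
  with respect to all sources together.\<close>

lemma stay_leave_noise:
  fixes n i t
  defines "u \<equiv> \<lambda>\<omega>. t - real_of_ereal (jump_time W i n \<omega>)"
  shows "(\<lambda>\<omega>. stay n a (u \<omega>) \<omega>) \<in> borel_measurable (noise W)"
    and "(\<lambda>\<omega>. leave n a (u \<omega>) \<omega>) \<in> borel_measurable (noise W)"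
proof -
  have [measurable]: "(\<lambda>\<omega>. \<omega>) \<in> noise W \<rightarrow>\<^sub>M block UNIV"
    using sets_block_events[of UNIV] by (auto intro!: measurableI)
  note [measurable] = jump_time_past[of i n, THEN block_noise]
  have diag: "(\<lambda>\<omega>. (u \<omega>, \<omega>)) \<in> noise W \<rightarrow>\<^sub>M borel \<Otimes>\<^sub>M block UNIV"
    unfolding u_def by measurable
  show "(\<lambda>\<omega>. stay n a (u \<omega>) \<omega>) \<in> borel_measurable (noise W)"
    using measurable_compose[OF diag measurable_stay_leave(1)[of n a UNIV]] by simp
  show "(\<lambda>\<omega>. leave n a (u \<omega>) \<omega>) \<in> borel_measurable (noise W)"
    using measurable_compose[OF diag measurable_stay_leave(2)[of n a UNIV]] by simp
qed

lemma present_measurable: "present x i t n \<in> borel_measurable (noise W)"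
  unfolding present_def
  by (rule borel_measurable_times_ennreal[OF weight_past[THEN block_noise]
        measurable_finite_select[where f = "\<lambda>a \<omega>. stay n a (t - real_of_ereal (jump_time W i n \<omega>)) \<omega>",
          OF stay_leave_noise(1) jump_chain_past[THEN block_noise]]])

text \<open>The supermartingale property along the jump times, in a form that telescopes.\<close>

lemma nn_integral_weight_step:
  "(\<integral>\<^sup>+ \<omega>. present x i t n \<omega> \<partial>noise W)
    + (\<integral>\<^sup>+ \<omega>. weight x i t (Suc n) \<omega> * ennreal (v $ jump_chain W i (Suc n) \<omega>) \<partial>noise W)
    \<le> (\<integral>\<^sup>+ \<omega>. weight x i t n \<omega> * ennreal (v $ jump_chain W i n \<omega>) \<partial>noise W)"
proof -
  let ?J = "{c :: 'n source. source_step c = n}"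
  let ?u = "\<lambda>\<omega>. t - real_of_ereal (jump_time W i n \<omega>)"
  \<comment> \<open>The current state is random. Splitting the expectation according to it makes the
    index of the step-\<open>n\<close> sources deterministic.\<close>
  define g where "g a \<omega> = indicator {a} (jump_chain W i n \<omega>) * weight x i t n \<omega>" for a \<omega>
  define K where "K a u \<omega> = stay n a u \<omega> + leave n a u \<omega>" for a u \<omega>
  have select: "weight x i t n \<omega> * f (jump_chain W i n \<omega>) = (\<Sum>a\<in>UNIV. g a \<omega> * f a)"
    for \<omega> and f :: "'n \<Rightarrow> ennreal"
  proof -
    have "(\<Sum>a\<in>UNIV. g a \<omega> * f a) = (\<Sum>a\<in>UNIV. if a = jump_chain W i n \<omega> then weight x i t n \<omega> * f a else 0)"
      unfolding g_def by (rule sum.cong) auto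
    then show ?thesis by simp
  qed
  have g_past: "g a \<in> borel_measurable (past n)" for a
  proof -
    note [measurable] = jump_chain_past[of i n] weight_past[of x i t n]
    show ?thesis unfolding g_def by measurable
  qed
  note [measurable] = g_past[THEN block_noise] jump_time_past[of i n] jump_time_past[of i n, THEN block_noise]
    weight_past[of x i t n, THEN block_noise] jump_chain_past[of i n, THEN block_noise]
  note sl = measurable_stay_leave[of n _ ?J, simplified]
  have K_meas: "(\<lambda>(u, \<omega>). K a u \<omega>) \<in> borel_measurable (borel \<Otimes>\<^sub>M block ?J)" for a
    unfolding K_def using sl[of a] by (simp add: split_beta)
  have pair: "(\<lambda>p. (?u (fst p), snd p)) \<in> past n \<Otimes>\<^sub>M block ?J \<rightarrow>\<^sub>M borel \<Otimes>\<^sub>M block ?J"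
    by measurable
  have K_pair: "(\<lambda>p. K a (?u (fst p)) (snd p)) \<in> borel_measurable (past n \<Otimes>\<^sub>M block ?J)" for a
    using measurable_compose[OF pair K_meas[of a]] by simp
  note [measurable] = stay_leave_noise[of n _ t i]
  have S: "(\<lambda>\<omega>. stay n (jump_chain W i n \<omega>) (?u \<omega>) \<omega>) \<in> borel_measurable (noise W)"
    by (rule measurable_finite_select[where f = "\<lambda>a \<omega>. stay n a (?u \<omega>) \<omega>",
          OF stay_leave_noise(1) jump_chain_past[THEN block_noise]])
  have L: "(\<lambda>\<omega>. leave n (jump_chain W i n \<omega>) (?u \<omega>) \<omega>) \<in> borel_measurable (noise W)"
    by (rule measurable_finite_select[where f = "\<lambda>a \<omega>. leave n a (?u \<omega>) \<omega>",
          OF stay_leave_noise(2) jump_chain_past[THEN block_noise]])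
  have slice: "(\<lambda>\<omega>'. stay n a u \<omega>') \<in> borel_measurable (noise W)" "(\<lambda>\<omega>'. leave n a u \<omega>') \<in> borel_measurable (noise W)" for a u
    using measurable_compose[OF measurable_Pair1' sl(1)[of a], of u] measurable_compose[OF measurable_Pair1' sl(2)[of a], of u]
    by (auto intro: block_noise)
  have "(\<integral>\<^sup>+ \<omega>. present x i t n \<omega> \<partial>noise W)
      + (\<integral>\<^sup>+ \<omega>. weight x i t (Suc n) \<omega> * ennreal (v $ jump_chain W i (Suc n) \<omega>) \<partial>noise W)
    = (\<integral>\<^sup>+ \<omega>. weight x i t n \<omega> * stay n (jump_chain W i n \<omega>) (?u \<omega>) \<omega> \<partial>noise W)
      + (\<integral>\<^sup>+ \<omega>. weight x i t n \<omega> * leave n (jump_chain W i n \<omega>) (?u \<omega>) \<omega> \<partial>noise W)"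
    by (intro arg_cong2[where f = "(+)"] nn_integral_cong) (simp_all only: present_def weight_Suc)
  also have "\<dots> = (\<integral>\<^sup>+ \<omega>. weight x i t n \<omega> * stay n (jump_chain W i n \<omega>) (?u \<omega>) \<omega>
      + weight x i t n \<omega> * leave n (jump_chain W i n \<omega>) (?u \<omega>) \<omega> \<partial>noise W)"
    by (rule nn_integral_add[symmetric]) (intro borel_measurable_times_ennreal S L weight_past[THEN block_noise])+
  also have "\<dots> = (\<integral>\<^sup>+ \<omega>. (\<Sum>a\<in>UNIV. g a \<omega> * K a (?u \<omega>) \<omega>) \<partial>noise W)"
    unfolding K_def distrib_left[symmetric]
    by (rule nn_integral_cong) (rule select)
  also have "\<dots> = (\<Sum>a\<in>UNIV. \<integral>\<^sup>+ \<omega>. g a \<omega> * K a (?u \<omega>) \<omega> \<partial>noise W)"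
    unfolding K_def by (rule nn_integral_sum) measurable
  \<comment> \<open>For a fixed state, \<open>g a\<close> and the remaining time depend on the past
    only, and \<open>K a\<close> on the sources of step \<open>n\<close> only, so the step can be
    averaged with the past frozen.\<close>
  also have "\<dots> = (\<Sum>a\<in>UNIV. \<integral>\<^sup>+ \<omega>. \<integral>\<^sup>+ \<omega>'. g a \<omega> * K a (?u \<omega>) \<omega>' \<partial>noise W \<partial>noise W)"
  proof (rule sum.cong[OF refl])
    fix a
    have "(\<lambda>(\<omega>, \<omega>'). g a \<omega> * K a (?u \<omega>) \<omega>') \<in> borel_measurable (past n \<Otimes>\<^sub>M block ?J)"
      using g_past[of a] K_pair[of a] by (simp add: split_beta)
    from nn_integral_blocks[OF _ this]
    show "(\<integral>\<^sup>+ \<omega>. g a \<omega> * K a (?u \<omega>) \<omega> \<partial>noise W) = (\<integral>\<^sup>+ \<omega>. \<integral>\<^sup>+ \<omega>'. g a \<omega> * K a (?u \<omega>) \<omega>' \<partial>noise W \<partial>noise W)"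
      by auto
  qed
  also have "\<dots> \<le> (\<Sum>a\<in>UNIV. \<integral>\<^sup>+ \<omega>. g a \<omega> * ennreal (v $ a) \<partial>noise W)"
  proof (intro sum_mono nn_integral_mono)
    fix a \<omega> assume \<omega>: "\<omega> \<in> space (noise W)"
    show "(\<integral>\<^sup>+ \<omega>'. g a \<omega> * K a (?u \<omega>) \<omega>' \<partial>noise W) \<le> g a \<omega> * ennreal (v $ a)"
    \<comment> \<open>If the jump falls after \<open>t\<close>, the weight in \<open>g\<close> is 0;
      otherwise the time left is nonnegative, as the one-period bound requires.\<close>
    proof (cases "jump_time W i n \<omega> \<le> ereal t")
      case True
      then have "0 \<le> ?u \<omega>"
        using jump_time_nonneg[OF \<omega>, of i n] by (cases "jump_time W i n \<omega>") auto
      have "(\<integral>\<^sup>+ \<omega>'. g a \<omega> * K a (?u \<omega>) \<omega>' \<partial>noise W)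
          = g a \<omega> * ((\<integral>\<^sup>+ \<omega>'. stay n a (?u \<omega>) \<omega>' \<partial>noise W) + (\<integral>\<^sup>+ \<omega>'. leave n a (?u \<omega>) \<omega>' \<partial>noise W))"
        unfolding K_def using slice by (simp add: nn_integral_cmult nn_integral_add)
      also have "\<dots> \<le> g a \<omega> * ennreal (v $ a)"
        by (rule mult_left_mono[OF nn_integral_stay_leave[OF \<open>0 \<le> ?u \<omega>\<close>]]) simp
      finally show ?thesis .
    qed (simp add: g_def weight_def)
  qed
  also have "\<dots> = (\<integral>\<^sup>+ \<omega>. (\<Sum>a\<in>UNIV. g a \<omega> * ennreal (v $ a)) \<partial>noise W)"
    by (rule nn_integral_sum[symmetric]) measurable
  also have "\<dots> = (\<integral>\<^sup>+ \<omega>. weight x i t n \<omega> * ennreal (v $ jump_chain W i n \<omega>) \<partial>noise W)"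
    by (rule nn_integral_cong) (rule select[symmetric])
  finally show ?thesis .
qed

text \<open>The induction keeps the mass still travelling after \<open>m\<close> jumps on the
  left-hand side, so each step is one application of \<open>nn_integral_weight_step\<close>; that
  remainder is then dropped as nonnegative.\<close>

lemma suminf_present:
  assumes "0 \<le> t"
  shows "(\<Sum>n. \<integral>\<^sup>+ \<omega>. present x i t n \<omega> \<partial>noise W) \<le> ennreal (exp (z * x) * v $ i)"
proof -
  have "(\<Sum>n<m. \<integral>\<^sup>+ \<omega>. present x i t n \<omega> \<partial>noise W)
      + (\<integral>\<^sup>+ \<omega>. weight x i t m \<omega> * ennreal (v $ jump_chain W i m \<omega>) \<partial>noise W) \<le> ennreal (exp (z * x) * v $ i)" for m
  proof (induction m)
    case 0
    show ?case
      using assms v_pos[of i] by (simp add: weight_def unkilled_def zero_ereal_def emeasure_space_1 ennreal_mult less_imp_le)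
  next
    case (Suc m)
    let ?S = "\<Sum>n<m. \<integral>\<^sup>+ \<omega>. present x i t n \<omega> \<partial>noise W"
    have "?S + ((\<integral>\<^sup>+ \<omega>. present x i t m \<omega> \<partial>noise W)
        + (\<integral>\<^sup>+ \<omega>. weight x i t (Suc m) \<omega> * ennreal (v $ jump_chain W i (Suc m) \<omega>) \<partial>noise W))
        \<le> ?S + (\<integral>\<^sup>+ \<omega>. weight x i t m \<omega> * ennreal (v $ jump_chain W i m \<omega>) \<partial>noise W)"
      by (rule add_left_mono[OF nn_integral_weight_step])
    also note Suc
    finally show ?case by (simp add: add.assoc del: jump_chain.simps)
  qed
  then have "(\<Sum>n<m. \<integral>\<^sup>+ \<omega>. present x i t n \<omega> \<partial>noise W) \<le> ennreal (exp (z * x) * v $ i)" for m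
    by (meson add_increasing2 dual_order.trans order_refl zero_le)
  then show ?thesis
    unfolding suminf_eq_SUP by (intro SUP_least)
qed

text \<open>Minimality of the index in \<open>map_path\<close> supplies the lower bound on
  \<open>t\<close>. The first alternative covers killing and the accumulation of jumps
  alike.\<close>

lemma map_path_cases:
  assumes \<omega>: "\<omega> \<in> space (noise W)" and "0 \<le> t"
  obtains "map_path W x i t \<omega> = (- \<infinity>, None)"
  | n where "jump_time W i n \<omega> \<le> ereal t" "ereal t < jump_time W i (Suc n) \<omega>" "unkilled i n \<omega>"
      "ereal (t - real_of_ereal (jump_time W i n \<omega>)) < kill W n (jump_chain W i n \<omega>) \<omega>"
      "map_path W x i t \<omega> = (ereal (jump_position W x i n \<omega>
          + levy W n (jump_chain W i n \<omega>) (t - real_of_ereal (jump_time W i n \<omega>)) \<omega>), Some (jump_chain W i n \<omega>))"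
proof (cases "\<exists>n. ereal t < jump_time W i (Suc n) \<omega>")
  case False
  then show ?thesis using that(1) by (simp add: map_path_def Let_def del: jump_time.simps)
next
  case True
  define N where "N = (LEAST n. ereal t < jump_time W i (Suc n) \<omega>)"
  have N: "ereal t < jump_time W i (Suc N) \<omega>"
    unfolding N_def using True by (rule LeastI_ex)
  have le: "jump_time W i N \<omega> \<le> ereal t"
  proof (cases N)
    case 0
    then show ?thesis using assms(2) by simp
  next
    case (Suc m)
    then have "\<not> ereal t < jump_time W i (Suc m) \<omega>"
      using not_less_Least[of m "\<lambda>n. ereal t < jump_time W i (Suc n) \<omega>"] by (simp add: N_def)
    then show ?thesis using Suc by (simp del: jump_time.simps)
  qed
  show ?thesis
  proof (cases "unkilled i N \<omega> \<and> ereal (t - real_of_ereal (jump_time W i N \<omega>)) < kill W N (jump_chain W i N \<omega>) \<omega>")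
    case False
    then show ?thesis
      using that(1) unfolding map_path_def Let_def N_def[symmetric] unkilled_def by (auto simp del: jump_time.simps)
  next
    case T: True
    then show ?thesis
      using that(2)[OF le N] True unfolding map_path_def Let_def N_def[symmetric] unkilled_def
      by (auto simp del: jump_time.simps)
  qed
qed

text \<open>For a path alive at \<open>t\<close> the term of its jump count equals
  \<open>exp (z * y - \<kappa> * t) * v $ a\<close>; undoing the discount and using
  \<open>m \<le> v $ a\<close> suffices, and the other terms are nonnegative.\<close>

lemma map_path_le_present:
  assumes \<omega>: "\<omega> \<in> space (noise W)" and "0 \<le> t" and m: "0 < m" "\<And>a. m \<le> v $ a" and "0 < z"
  shows "ennreal_power (exp_ereal (fst (map_path W x i t \<omega>))) z
    \<le> ennreal (exp (\<kappa> * t) / m) * (\<Sum>n. present x i t n \<omega>)"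
proof (cases rule: map_path_cases[OF assms(1,2), of x i])
  case 1
  then show ?thesis using \<open>0 < z\<close> by (simp add: exp_ereal_def ennreal_power_def)
next
  case (2 n)
  define a where "a = jump_chain W i n \<omega>"
  obtain \<tau> where \<tau>: "jump_time W i n \<omega> = ereal \<tau>" "0 \<le> \<tau>" "\<tau> \<le> t"
    using jump_time_nonneg[OF \<omega>, of i n] 2(1) by (cases "jump_time W i n \<omega>") auto
  define y where "y = jump_position W x i n \<omega> + levy W n a (t - \<tau>) \<omega>"
  have "ereal (t - \<tau>) < hold W n a \<omega>"
    using 2(2) \<tau> by (cases "hold W n a \<omega>") (auto simp: a_def[symmetric])
  moreover have "exp (z * jump_position W x i n \<omega> - \<kappa> * \<tau>) * (exp (z * levy W n a (t - \<tau>) \<omega>) * exp (- \<kappa> * (t - \<tau>)))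
      = exp (z * y - \<kappa> * t)"
    unfolding exp_add[symmetric] y_def by (simp add: algebra_simps)
  ultimately have present: "present x i t n \<omega> = ennreal (exp (z * y - \<kappa> * t) * v $ a)"
    using 2(1,3,4) \<tau> v_pos[of a]
    by (simp add: present_def weight_def stay_def a_def[symmetric] ennreal_mult[symmetric] mult.assoc less_imp_le)
  have "ennreal_power (exp_ereal (fst (map_path W x i t \<omega>))) z = ennreal (exp (z * y))"
    using 2(5) by (simp add: exp_ereal_def ennreal_power_def y_def a_def \<tau> exp_powr_real mult.commute)
  also have "\<dots> \<le> ennreal (exp (\<kappa> * t) / m * (exp (z * y - \<kappa> * t) * v $ a))"
  proof (rule ennreal_leI)
    have eq: "exp (\<kappa> * t) / m * (exp (z * y - \<kappa> * t) * v $ a) = exp (z * y) * (v $ a / m)"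
      by (simp add: exp_diff)
    have "exp (z * y) * 1 \<le> exp (z * y) * (v $ a / m)"
      using m by (intro mult_left_mono) auto
    then show "exp (z * y) \<le> exp (\<kappa> * t) / m * (exp (z * y - \<kappa> * t) * v $ a)"
      by (simp only: eq mult_1_right)
  qed
  also have "\<dots> = ennreal (exp (\<kappa> * t) / m) * present x i t n \<omega>"
    unfolding present using m(1) v_pos[of a] by (intro ennreal_mult) (auto intro: less_imp_le)
  also have "\<dots> \<le> ennreal (exp (\<kappa> * t) / m) * (\<Sum>n. present x i t n \<omega>)"
    by (intro mult_left_mono ennreal_le_suminf) auto
  finally show ?thesis .
qed

lemma nn_integral_map_path:
  assumes "0 \<le> t" and m: "0 < m" "\<And>a. m \<le> v $ a" and "0 < z"
  shows "(\<integral>\<^sup>+ \<omega>. ennreal_power (exp_ereal (fst (map_path W x i t \<omega>))) z \<partial>noise W)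
    \<le> ennreal (exp (\<kappa> * t) / m * (exp (z * x) * v $ i))"
proof -
  note [measurable] = present_measurable
  have "(\<integral>\<^sup>+ \<omega>. ennreal_power (exp_ereal (fst (map_path W x i t \<omega>))) z \<partial>noise W)
      \<le> (\<integral>\<^sup>+ \<omega>. ennreal (exp (\<kappa> * t) / m) * (\<Sum>n. present x i t n \<omega>) \<partial>noise W)"
    by (rule nn_integral_mono) (rule map_path_le_present[OF _ assms])
  also have "\<dots> = ennreal (exp (\<kappa> * t) / m) * (\<Sum>n. \<integral>\<^sup>+ \<omega>. present x i t n \<omega> \<partial>noise W)"
    by (simp add: nn_integral_cmult nn_integral_suminf)
  also have "\<dots> \<le> ennreal (exp (\<kappa> * t) / m) * ennreal (exp (z * x) * v $ i)"
    by (rule mult_left_mono[OF suminf_present[OF assms(1)]]) simp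
  also have "\<dots> = ennreal (exp (\<kappa> * t) / m * (exp (z * x) * v $ i))"
    using m(1) v_pos[of i] by (intro ennreal_mult[symmetric]) (auto intro: less_imp_le)
  finally show ?thesis .
qed

end

section \<open>Measurability of the assembled path\<close>

context map_noise
begin

text \<open>The number of completed jumps is a random natural number: with it frozen the formula is
  measurable, and countably many values are then glued. The \<open>max 0\<close> in \<open>F\<close>
  is harmless since the age is nonnegative at the true index.\<close>

lemma map_path_measurable:
  assumes "0 \<le> t"
  shows "map_path W x i t \<in> noise W \<rightarrow>\<^sub>M borel \<Otimes>\<^sub>M count_space UNIV"
proof -
  define N where "N \<omega> = (LEAST n. ereal t < jump_time W i (Suc n) \<omega>)" for \<omega>
  define F where "F n \<omega> = (if (\<exists>n. ereal t < jump_time W i (Suc n) \<omega>) \<and> unkilled i n \<omega> \<and>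
      ereal (t - real_of_ereal (jump_time W i n \<omega>)) < kill W n (jump_chain W i n \<omega>) \<omega>
    then (ereal (jump_position W x i n \<omega>
      + levy W n (jump_chain W i n \<omega>) (max 0 (t - real_of_ereal (jump_time W i n \<omega>))) \<omega>), Some (jump_chain W i n \<omega>))
    else (- \<infinity>, None))" for n \<omega>
  note [measurable] = jump_time_past[THEN block_noise] unkilled_past[THEN block_noise]
    jump_position_past[THEN block_noise] jump_chain_past[THEN block_noise] kill_chain_past[THEN block_noise]
  have L: "(\<lambda>\<omega>. levy W n a (max 0 (t - real_of_ereal (jump_time W i n \<omega>))) \<omega>) \<in> borel_measurable (noise W)" for n a
  proof (rule block_noise, rule levy_compose_block)
    have "jump_time W i n \<in> borel_measurable (block UNIV)"
      by (rule block_mono[OF _ jump_time_past]) simp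
    then show "(\<lambda>\<omega>. t - real_of_ereal (jump_time W i n \<omega>)) \<in> borel_measurable (block UNIV)"
      by measurable
  qed simp
  have [measurable]: "(\<lambda>\<omega>. levy W n (jump_chain W i n \<omega>) (max 0 (t - real_of_ereal (jump_time W i n \<omega>))) \<omega>) \<in> borel_measurable (noise W)" for n
    by (rule measurable_finite_select[where f = "\<lambda>a \<omega>. levy W n a (max 0 (t - real_of_ereal (jump_time W i n \<omega>))) \<omega>", OF L]) measurable
  have "F n \<in> noise W \<rightarrow>\<^sub>M borel \<Otimes>\<^sub>M count_space UNIV" for n
    unfolding F_def by measurable
  moreover have "N \<in> noise W \<rightarrow>\<^sub>M count_space UNIV"
    unfolding N_def by measurable
  ultimately have "(\<lambda>\<omega>. F (N \<omega>) \<omega>) \<in> noise W \<rightarrow>\<^sub>M borel \<Otimes>\<^sub>M count_space UNIV"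
    by (rule measurable_compose_countable)
  moreover have "map_path W x i t \<omega> = F (N \<omega>) \<omega>" if \<omega>: "\<omega> \<in> space (noise W)" for \<omega>
  proof (cases "\<exists>n. ereal t < jump_time W i (Suc n) \<omega>")
    case True
    have "jump_time W i (N \<omega>) \<omega> \<le> ereal t"
    proof (cases "N \<omega>")
      case 0
      then show ?thesis using assms by simp
    next
      case (Suc m)
      then have "\<not> ereal t < jump_time W i (Suc m) \<omega>"
        using not_less_Least[of m "\<lambda>n. ereal t < jump_time W i (Suc n) \<omega>"] by (simp add: N_def)
      then show ?thesis using Suc by (simp del: jump_time.simps)
    qed
    moreover have "0 \<le> jump_time W i (N \<omega>) \<omega>"
      by (rule jump_time_nonneg[OF \<omega>])
    ultimately have "0 \<le> t - real_of_ereal (jump_time W i (N \<omega>) \<omega>)"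
      by (cases "jump_time W i (N \<omega>) \<omega>") auto
    then show ?thesis
      unfolding map_path_def Let_def N_def[symmetric] F_def unkilled_def by (simp add: max_def)
  qed (simp add: map_path_def F_def Let_def)
  ultimately show ?thesis
    by (subst measurable_cong) auto
qed

end

section \<open>Moments of the exponential functional\<close>

context markov_additive_process
begin

text \<open>Half-open blocks partition the half-line, so every time lies strictly before the end of
  its block, which the rational supremum needs.\<close>

lemma exponential_functional_le:
  assumes "0 < d" "0 < p" "\<omega> \<in> space M"
  defines "S \<equiv> \<lambda>n. SUP r\<in>\<rat> \<inter> {real n * d..real n * d + d}. ennreal_power (exp_ereal (\<xi> r \<omega>)) p"
  shows "exponential_functional \<xi> \<omega> \<le> (\<Sum>n. ennreal d * ennreal_power (S n) (1 / p))"
proof -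
  have "exponential_functional \<xi> \<omega>
      \<le> (\<integral>\<^sup>+ s. (\<Sum>n. ennreal_power (S n) (1 / p) * indicator {real n * d..<real n * d + d} s) \<partial>lborel)"
    unfolding exponential_functional_def
  proof (rule nn_integral_mono)
    fix s :: real
    show "exp_ereal (\<xi> s \<omega>) * indicator {0..} s
        \<le> (\<Sum>n. ennreal_power (S n) (1 / p) * indicator {real n * d..<real n * d + d} s)"
    proof (cases "0 \<le> s")
      case True
      define n where "n = nat \<lfloor>s / d\<rfloor>"
      have "real n \<le> s / d" "s / d < real n + 1"
        using True assms(1) by (auto simp: n_def)
      then have s: "real n * d \<le> s" "s < real n * d + d"
        using assms(1) by (auto simp: field_simps)
      have "exp_ereal (\<xi> s \<omega>) = ennreal_power (ennreal_power (exp_ereal (\<xi> s \<omega>)) p) (1 / p)"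
        using assms(2) by (simp add: ennreal_power_inverse)
      also have "\<dots> \<le> ennreal_power (S n) (1 / p)"
        unfolding S_def using assms s by (intro ennreal_power_mono exp_ereal_le_rational_SUP) auto
      also have "\<dots> = ennreal_power (S n) (1 / p) * indicator {real n * d..<real n * d + d} s"
        using s by simp
      also have "\<dots> \<le> (\<Sum>n. ennreal_power (S n) (1 / p) * indicator {real n * d..<real n * d + d} s)"
        by (rule ennreal_le_suminf)
      finally show ?thesis using True by simp
    qed simp
  qed
  also have "\<dots> = (\<Sum>n. \<integral>\<^sup>+ s. ennreal_power (S n) (1 / p) * indicator {real n * d..<real n * d + d} s \<partial>lborel)"
    by (rule nn_integral_suminf) measurable
  also have "\<dots> = (\<Sum>n. ennreal d * ennreal_power (S n) (1 / p))"
    using assms(1) by (simp add: nn_integral_cmult mult.commute)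
  finally show ?thesis .
qed

text \<open>The order of quantifiers matters: \<open>d\<close> depends on the process alone, so
  \<open>q\<close> may later be tuned to \<open>d\<close>. The dominating function \<open>H\<close>
  supplies measurability, and \<open>H\<close> and \<open>K\<close> are common to all starting
  points, so that the bound can be integrated over an initial law.\<close>

lemma exponential_functional_moment_bound:
  "\<exists>d>0. \<forall>p q. 0 < p \<longrightarrow> 1 < q \<longrightarrow> (\<exists>K. \<exists>H\<in>borel_measurable M.
      (\<forall>\<omega>\<in>space M. ennreal_power (exponential_functional \<xi> \<omega>) p \<le> H \<omega>) \<and>
      (\<forall>x i. (\<integral>\<^sup>+ \<omega>. H \<omega> \<partial>P x i)
        \<le> ennreal K * (\<Sum>n. ennreal (q ^ n) * (\<integral>\<^sup>+ \<omega>. ennreal_power (exp_ereal (\<xi> (real n * d + d) \<omega>)) p \<partial>P x i))))"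
proof -
  obtain d where d: "0 < d"
    "\<And>j r. r \<in> {0..d} \<Longrightarrow> 1 / 2 \<le> measure (P 0 j) {\<omega> \<in> space M. ereal (- 1) < \<xi> r \<omega>}"
    using small_time_lower_bound by blast
  show ?thesis
  proof (rule exI[of _ d], intro conjI allI impI)
    show "0 < d" by (rule d(1))
    fix p q :: real assume p: "0 < p" and q: "1 < q"
    obtain K where K: "\<And>a. ennreal_power (\<Sum>n. a n) p \<le> ennreal K * (\<Sum>n. ennreal (q ^ n) * ennreal_power (a n) p)"
      using ennreal_power_suminf_le[OF p q] by blast
    define D where "D n = \<rat> \<inter> {real n * d..real n * d + d}" for n
    define S where "S n \<omega> = (SUP r\<in>D n. ennreal_power (exp_ereal (\<xi> r \<omega>)) p)" for n \<omega>
    define H where "H \<omega> = ennreal K * (\<Sum>n. ennreal (q ^ n) * (ennreal (d powr p) * S n \<omega>))" for \<omega>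
    have D_nonneg: "0 \<le> r" if "r \<in> D n" for r n
      using that d(1) by (auto simp: D_def intro: order_trans[rotated])
    have "countable (D n)" for n
      by (simp add: D_def countable_rat)
    have S_meas [measurable]: "S n \<in> borel_measurable M" for n
      unfolding S_def using measurable_\<xi>[OF D_nonneg]
      by (intro borel_measurable_SUP \<open>countable (D n)\<close>) (auto intro: measurable_compose[OF _ measurable_exp_ereal_power])
    have "H \<in> borel_measurable M" unfolding H_def by measurable
    moreover have "ennreal_power (exponential_functional \<xi> \<omega>) p \<le> H \<omega>" if "\<omega> \<in> space M" for \<omega>
    proof -
      have "ennreal_power (exponential_functional \<xi> \<omega>) p
          \<le> ennreal_power (\<Sum>n. ennreal d * ennreal_power (S n \<omega>) (1 / p)) p"
        unfolding S_def D_def by (rule ennreal_power_mono[OF p exponential_functional_le[OF d(1) p that]])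
      also have "\<dots> \<le> ennreal K * (\<Sum>n. ennreal (q ^ n) * ennreal_power (ennreal d * ennreal_power (S n \<omega>) (1 / p)) p)"
        by (rule K)
      also have "\<dots> \<le> H \<omega>"
        unfolding H_def
      proof (intro mult_left_mono suminf_le)
        fix n
        show "ennreal_power (ennreal d * ennreal_power (S n \<omega>) (1 / p)) p \<le> ennreal (d powr p) * S n \<omega>"
          using ennreal_power_mult[of d p "ennreal_power (S n \<omega>) (1 / p)"] d(1) p
          by (simp add: ennreal_power_inverse)
      qed auto
      finally show ?thesis .
    qed
    \<comment> \<open>\<open>K\<close> comes without a sign; \<open>ennreal\<close> truncates it at
      0, and \<open>max 0 K\<close> permits the constants to be multiplied as reals.\<close>
    moreover have "(\<integral>\<^sup>+ \<omega>. H \<omega> \<partial>P x i) \<le> ennreal (max 0 K * (d powr p * (2 * exp p))) *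
        (\<Sum>n. ennreal (q ^ n) * (\<integral>\<^sup>+ \<omega>. ennreal_power (exp_ereal (\<xi> (real n * d + d) \<omega>)) p \<partial>P x i))" for x i
    proof -
      have "(\<integral>\<^sup>+ \<omega>. S n \<omega> \<partial>P x i)
          \<le> ennreal (2 * exp p) * (\<integral>\<^sup>+ \<omega>. ennreal_power (exp_ereal (\<xi> (real n * d + d) \<omega>)) p \<partial>P x i)" for n
        unfolding S_def using d p
        by (intro moment_maximum[OF d(2) _ _ \<open>countable (D n)\<close>]) (auto simp: D_def)
      then have "(\<Sum>n. ennreal (q ^ n) * (\<integral>\<^sup>+ \<omega>. S n \<omega> \<partial>P x i))
          \<le> (\<Sum>n. ennreal (q ^ n) * (ennreal (2 * exp p) * (\<integral>\<^sup>+ \<omega>. ennreal_power (exp_ereal (\<xi> (real n * d + d) \<omega>)) p \<partial>P x i)))"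
        by (intro suminf_le mult_left_mono) auto
      also have "\<dots> = ennreal (2 * exp p) * (\<Sum>n. ennreal (q ^ n) * (\<integral>\<^sup>+ \<omega>. ennreal_power (exp_ereal (\<xi> (real n * d + d) \<omega>)) p \<partial>P x i))"
        by (subst ennreal_suminf_cmult[symmetric]) (simp add: mult.left_commute)
      finally have le: "ennreal (max 0 K * d powr p) * (\<Sum>n. ennreal (q ^ n) * (\<integral>\<^sup>+ \<omega>. S n \<omega> \<partial>P x i))
          \<le> ennreal (max 0 K * d powr p) * (ennreal (2 * exp p) *
              (\<Sum>n. ennreal (q ^ n) * (\<integral>\<^sup>+ \<omega>. ennreal_power (exp_ereal (\<xi> (real n * d + d) \<omega>)) p \<partial>P x i)))"
        by (rule mult_left_mono) simp
      have "(\<integral>\<^sup>+ \<omega>. H \<omega> \<partial>P x i) = ennreal K * (\<Sum>n. ennreal (q ^ n) * (ennreal (d powr p) * (\<integral>\<^sup>+ \<omega>. S n \<omega> \<partial>P x i)))"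
        unfolding H_def by (simp add: nn_integral_cmult nn_integral_suminf)
      also have "\<dots> = ennreal K * (\<Sum>n. ennreal (d powr p) * (ennreal (q ^ n) * (\<integral>\<^sup>+ \<omega>. S n \<omega> \<partial>P x i)))"
        by (simp add: mult.left_commute)
      also have "\<dots> = ennreal (max 0 K * d powr p) * (\<Sum>n. ennreal (q ^ n) * (\<integral>\<^sup>+ \<omega>. S n \<omega> \<partial>P x i))"
        by (simp add: ennreal_mult mult.assoc)
      also note le
      also have "ennreal (max 0 K * d powr p) * (ennreal (2 * exp p) *
              (\<Sum>n. ennreal (q ^ n) * (\<integral>\<^sup>+ \<omega>. ennreal_power (exp_ereal (\<xi> (real n * d + d) \<omega>)) p \<partial>P x i)))
          = ennreal (max 0 K * (d powr p * (2 * exp p))) *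
              (\<Sum>n. ennreal (q ^ n) * (\<integral>\<^sup>+ \<omega>. ennreal_power (exp_ereal (\<xi> (real n * d + d) \<omega>)) p \<partial>P x i))"
        by (simp add: ennreal_mult mult.assoc)
      finally show ?thesis .
    qed
    ultimately show "\<exists>K. \<exists>H\<in>borel_measurable M.
      (\<forall>\<omega>\<in>space M. ennreal_power (exponential_functional \<xi> \<omega>) p \<le> H \<omega>) \<and>
      (\<forall>x i. (\<integral>\<^sup>+ \<omega>. H \<omega> \<partial>P x i)
        \<le> ennreal K * (\<Sum>n. ennreal (q ^ n) * (\<integral>\<^sup>+ \<omega>. ennreal_power (exp_ereal (\<xi> (real n * d + d) \<omega>)) p \<partial>P x i)))"
      by blast
  qed
qed

text \<open>Equality of the laws on path space is used through its marginal at the single time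
  \<open>t\<close>.\<close>

lemma nn_integral_has_ingredients:
  assumes "has_ingredients P \<xi> \<Theta> W" "ingredients_for Q k W" "0 \<le> t" and [measurable]: "f \<in> borel_measurable borel"
  shows "(\<integral>\<^sup>+ \<omega>. f (\<xi> t \<omega>) \<partial>P x i) = (\<integral>\<^sup>+ \<omega>. f (fst (map_path W x i t \<omega>)) \<partial>noise W)"
proof -
  interpret map_noise Q k W by (unfold_locales) (rule assms)
  have [measurable]: "path_on {0..} \<xi> \<Theta> \<in> P x i \<rightarrow>\<^sub>M path_space {0..}"
    unfolding path_on_def path_space_def
    using measurable_\<xi> measurable_\<Theta> by (intro measurable_restrict measurable_Pair) auto
  have [measurable]: "(\<lambda>\<omega>. \<lambda>t\<in>{0..}. map_path W x i t \<omega>) \<in> noise W \<rightarrow>\<^sub>M path_space {0..}"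
    unfolding path_space_def using map_path_measurable by (intro measurable_restrict) auto
  have "(\<lambda>p. p t) \<in> path_space {0..} \<rightarrow>\<^sub>M borel \<Otimes>\<^sub>M (count_space UNIV :: 'n option measure)"
    unfolding path_space_def by (rule measurable_component_singleton) (use assms(3) in auto)
  from measurable_compose[OF this measurable_fst]
  have [measurable]: "(\<lambda>p. f (fst (p t))) \<in> borel_measurable (path_space {0..} :: (real \<Rightarrow> ereal \<times> 'n option) measure)"
    by measurable
  have "(\<integral>\<^sup>+ \<omega>. f (\<xi> t \<omega>) \<partial>P x i) = (\<integral>\<^sup>+ p. f (fst (p t)) \<partial>distr (P x i) (path_space {0..}) (path_on {0..} \<xi> \<Theta>))"
    using assms(3) by (simp add: nn_integral_distr path_on_def)
  also have "\<dots> = (\<integral>\<^sup>+ p. f (fst (p t)) \<partial>distr (noise W) (path_space {0..}) (\<lambda>\<omega>. \<lambda>t\<in>{0..}. map_path W x i t \<omega>))"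
    using assms(1) by (simp add: has_ingredients_def)
  also have "\<dots> = (\<integral>\<^sup>+ \<omega>. f (fst (map_path W x i t \<omega>)) \<partial>noise W)"
    using assms(3) by (simp add: nn_integral_distr)
  finally show ?thesis .
qed

end

theorem proposition2p6:
  fixes M :: "'a measure"
    and P :: "real \<Rightarrow> 'n::finite \<Rightarrow> 'a measure"
    and \<xi> :: "real \<Rightarrow> 'a \<Rightarrow> ereal"
    and \<Theta> :: "real \<Rightarrow> 'a \<Rightarrow> 'n option"
    and Q :: "real^'n^'n"
    and k :: "'n \<Rightarrow> real"
    and W :: "('w, 'n) map_ingredients"
    and chi :: "real \<Rightarrow> real"
    and \<gamma> :: real
  assumes "markov_additive_process M P \<xi> \<Theta>"
    and "irreducible_intensity_matrix Q"
    and "ingredients_for Q k W"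
    and "has_ingredients P \<xi> \<Theta> W"
    and "\<And>z. matrix_exponent_defined W z \<Longrightarrow> is_leading_eigenvalue (matrix_exponent Q W z) (chi z)"
    and "0 < \<gamma>"
    and "\<And>z. z \<in> {0..\<gamma>} \<Longrightarrow> matrix_exponent_defined W z"
    and "chi \<gamma> < 0"
  shows "(\<forall>x i. finite_moment (P x i) \<gamma> (exponential_functional \<xi>)) \<and>
         (\<forall>\<mu>. \<mu> \<in> space (prob_algebra state_space) \<and>
               (\<integral>\<^sup>+ (x, i). ennreal (exp (\<gamma> * x)) \<partial>\<mu>) < \<infinity> \<longrightarrow>
               finite_moment (initial_law P \<mu>) \<gamma> (exponential_functional \<xi>))"
proof -
  interpret markov_additive_process M P \<xi> \<Theta> by fact
  have defined: "matrix_exponent_defined W \<gamma>" using assms(6,7) by simp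
  have Q: "\<And>i j. i \<noteq> j \<Longrightarrow> 0 \<le> Q $ i $ j" "\<And>i. (\<Sum>j\<in>UNIV. Q $ i $ j) = 0"
    using assms(2) by (auto simp: irreducible_intensity_matrix_def)
  have "0 \<le> matrix_exponent Q W \<gamma> $ i $ j" if "i \<noteq> j" for i j
    using that Q(1)[OF that] by (simp add: matrix_exponent_def jump_transform_def)
  then obtain v \<kappa> where v: "\<kappa> < 0" "\<And>i. 0 < v $ i" "\<And>i. (matrix_exponent Q W \<gamma> *v v) $ i \<le> \<kappa> * v $ i"
    using leading_eigenvalue_negative_subsolution[OF assms(5)[OF defined] assms(8)] by blast
  interpret map_noise_subsolution Q k W \<gamma> \<kappa> v
    using assms(3) Q defined v by unfold_locales auto
  define m where "m = Min (range (($) v))"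
  have m: "0 < m" "\<And>a. m \<le> v $ a" using v(2) by (auto simp: m_def)
  \<comment> \<open>Bounds all quotients \<open>v $ i / m\<close> at once, so the moment bound no
    longer depends on the initial state of the chain.\<close>
  define B where "B = (\<Sum>i\<in>UNIV. v $ i) / m"
  have "0 \<le> B" using m(1) v(2) by (auto simp: B_def intro!: divide_nonneg_pos sum_nonneg intro: less_imp_le)
  have moment: "(\<integral>\<^sup>+ \<omega>. ennreal_power (exp_ereal (\<xi> t \<omega>)) \<gamma> \<partial>P x i) \<le> ennreal (exp (\<kappa> * t) * (B * exp (\<gamma> * x)))"
    if "0 \<le> t" for t x i
  proof -
    have "(\<integral>\<^sup>+ \<omega>. ennreal_power (exp_ereal (\<xi> t \<omega>)) \<gamma> \<partial>P x i)
        = (\<integral>\<^sup>+ \<omega>. ennreal_power (exp_ereal (fst (map_path W x i t \<omega>))) \<gamma> \<partial>noise W)"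
      by (rule nn_integral_has_ingredients[OF assms(4,3) that measurable_exp_ereal_power])
    also have "\<dots> \<le> ennreal (exp (\<kappa> * t) / m * (exp (\<gamma> * x) * v $ i))"
      by (rule nn_integral_map_path[OF that m assms(6)])
    also have "\<dots> \<le> ennreal (exp (\<kappa> * t) * (B * exp (\<gamma> * x)))"
    proof (rule ennreal_leI)
      have "v $ i \<le> (\<Sum>i\<in>UNIV. v $ i)"
        using v(2) by (intro member_le_sum) (auto intro: less_imp_le)
      then have "exp (\<kappa> * t) * exp (\<gamma> * x) * (v $ i / m) \<le> exp (\<kappa> * t) * exp (\<gamma> * x) * B"
        unfolding B_def using m(1) by (intro mult_left_mono divide_right_mono) auto
      then show "exp (\<kappa> * t) / m * (exp (\<gamma> * x) * v $ i) \<le> exp (\<kappa> * t) * (B * exp (\<gamma> * x))"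
        by (simp add: mult_ac)
    qed
    finally show ?thesis .
  qed
  obtain d where d: "0 < d" and bound: "\<And>p q. 0 < p \<Longrightarrow> 1 < q \<Longrightarrow> \<exists>K. \<exists>H\<in>borel_measurable M.
      (\<forall>\<omega>\<in>space M. ennreal_power (exponential_functional \<xi> \<omega>) p \<le> H \<omega>) \<and>
      (\<forall>x i. (\<integral>\<^sup>+ \<omega>. H \<omega> \<partial>P x i)
        \<le> ennreal K * (\<Sum>n. ennreal (q ^ n) * (\<integral>\<^sup>+ \<omega>. ennreal_power (exp_ereal (\<xi> (real n * d + d) \<omega>)) p \<partial>P x i)))"
    using exponential_functional_moment_bound by blast
  \<comment> \<open>The moments at the block ends decay like \<open>exp (\<kappa> * d)\<close> to
    the power \<open>n\<close>. Half of this rate pays for the weights \<open>q ^ n\<close>, and the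
    other half leaves the convergent geometric series in \<open>\<rho>\<close>.\<close>
  define q where "q = exp (- \<kappa> * d / 2)"
  define \<rho> where "\<rho> = exp (\<kappa> * d / 2)"
  have q: "1 < q" using v(1) d by (simp add: q_def mult_neg_pos)
  have \<rho>: "0 < \<rho>" "\<rho> < 1" using v(1) d by (simp_all add: \<rho>_def mult_neg_pos)
  obtain K H where H [measurable]: "H \<in> borel_measurable M"
    and H_ge: "\<And>\<omega>. \<omega> \<in> space M \<Longrightarrow> ennreal_power (exponential_functional \<xi> \<omega>) \<gamma> \<le> H \<omega>"
    and H_int: "\<And>x i. (\<integral>\<^sup>+ \<omega>. H \<omega> \<partial>P x i)
        \<le> ennreal K * (\<Sum>n. ennreal (q ^ n) * (\<integral>\<^sup>+ \<omega>. ennreal_power (exp_ereal (\<xi> (real n * d + d) \<omega>)) \<gamma> \<partial>P x i))"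
    using bound[OF assms(6) q] by blast
  \<comment> \<open>Free of the starting point: the position enters only through the factor
    \<open>exp (\<gamma> * x)\<close>, whose integrability under the initial law is assumed.\<close>
  define c where "c = max 0 K * (B * exp (\<kappa> * d) * (1 / (1 - \<rho>)))"
  have H_le: "(\<integral>\<^sup>+ \<omega>. H \<omega> \<partial>P x i) \<le> ennreal c * ennreal (exp (\<gamma> * x))" for x i
  proof -
    have "(\<Sum>n. ennreal (q ^ n) * (\<integral>\<^sup>+ \<omega>. ennreal_power (exp_ereal (\<xi> (real n * d + d) \<omega>)) \<gamma> \<partial>P x i))
        \<le> (\<Sum>n. ennreal (B * exp (\<kappa> * d) * exp (\<gamma> * x) * \<rho> ^ n))"
    proof (intro suminf_le)
      fix n
      have "ennreal (q ^ n) * (\<integral>\<^sup>+ \<omega>. ennreal_power (exp_ereal (\<xi> (real n * d + d) \<omega>)) \<gamma> \<partial>P x i)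
          \<le> ennreal (q ^ n) * ennreal (exp (\<kappa> * (real n * d + d)) * (B * exp (\<gamma> * x)))"
        using d by (intro mult_left_mono moment) auto
      also have "\<dots> = ennreal (q ^ n * (exp (\<kappa> * (real n * d + d)) * (B * exp (\<gamma> * x))))"
        using q \<open>0 \<le> B\<close> by (intro ennreal_mult[symmetric]) auto
      also have "q ^ n * (exp (\<kappa> * (real n * d + d)) * (B * exp (\<gamma> * x))) = B * exp (\<kappa> * d) * exp (\<gamma> * x) * \<rho> ^ n"
      proof -
        have "q ^ n * exp (\<kappa> * (real n * d + d)) = exp (\<kappa> * d) * \<rho> ^ n"
          unfolding q_def \<rho>_def exp_of_nat_mult[symmetric] exp_add[symmetric]
          by (simp add: field_simps)
        then show ?thesis by (simp add: mult.left_commute mult.assoc)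
      qed
      finally show "ennreal (q ^ n) * (\<integral>\<^sup>+ \<omega>. ennreal_power (exp_ereal (\<xi> (real n * d + d) \<omega>)) \<gamma> \<partial>P x i)
          \<le> ennreal (B * exp (\<kappa> * d) * exp (\<gamma> * x) * \<rho> ^ n)" .
    qed auto
    also have "\<dots> = ennreal (B * exp (\<kappa> * d) * exp (\<gamma> * x) * (1 / (1 - \<rho>)))"
      using \<rho> \<open>0 \<le> B\<close> by (intro suminf_ennreal_eq sums_mult geometric_sums) auto
    finally have "ennreal K * (\<Sum>n. ennreal (q ^ n) * (\<integral>\<^sup>+ \<omega>. ennreal_power (exp_ereal (\<xi> (real n * d + d) \<omega>)) \<gamma> \<partial>P x i))
        \<le> ennreal (max 0 K) * ennreal (B * exp (\<kappa> * d) * exp (\<gamma> * x) * (1 / (1 - \<rho>)))"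
      by (intro mult_mono) auto
    also have "\<dots> = ennreal (max 0 K * (B * exp (\<kappa> * d) * exp (\<gamma> * x) * (1 / (1 - \<rho>))))"
      using \<rho> \<open>0 \<le> B\<close> by (intro ennreal_mult[symmetric]) auto
    also have "\<dots> = ennreal (c * exp (\<gamma> * x))"
      by (simp add: c_def mult_ac)
    also have "\<dots> = ennreal c * ennreal (exp (\<gamma> * x))"
      using \<rho> \<open>0 \<le> B\<close> by (intro ennreal_mult) (auto simp: c_def)
    finally show ?thesis using H_int[of x i] by (rule order_trans[rotated])
  qed
  show ?thesis
  proof (intro conjI allI impI)
    fix x i
    have "(\<integral>\<^sup>+ \<omega>. ennreal_power (exponential_functional \<xi> \<omega>) \<gamma> \<partial>P x i) \<le> (\<integral>\<^sup>+ \<omega>. H \<omega> \<partial>P x i)"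
      by (rule nn_integral_mono) (simp add: H_ge)
    also have "\<dots> \<le> ennreal c * ennreal (exp (\<gamma> * x))" by (rule H_le)
    also have "\<dots> < \<infinity>" by (simp add: ennreal_mult_less_top)
    finally show "finite_moment (P x i) \<gamma> (exponential_functional \<xi>)"
      by (simp add: finite_moment_def)
  next
    fix \<mu> :: "(real \<times> 'n) measure"
    assume "\<mu> \<in> space (prob_algebra state_space) \<and> (\<integral>\<^sup>+ (x, i). ennreal (exp (\<gamma> * x)) \<partial>\<mu>) < \<infinity>"
    then have \<mu>: "sets \<mu> = sets state_space" "prob_space \<mu>"
      and fin: "(\<integral>\<^sup>+ (x, i). ennreal (exp (\<gamma> * x)) \<partial>\<mu>) < \<infinity>"
      by (auto simp: space_prob_algebra)
    interpret \<mu>: prob_space \<mu> by fact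
    have ker: "(\<lambda>(x, i). P x i) \<in> \<mu> \<rightarrow>\<^sub>M subprob_algebra M"
      using measurable_prob_algebraD[OF kernel] \<mu>(1) by (simp cong: measurable_cong_sets)
    have sets: "sets (initial_law P \<mu>) = sets M"
      unfolding initial_law_def by (rule sets_bind[OF _ \<mu>.not_empty]) auto
    \<comment> \<open>Monotonicity asks no measurability of the smaller integrand; the passage to
      the measurable \<open>H\<close> is what allows conditioning on the initial state.\<close>
    have "(\<integral>\<^sup>+ \<omega>. ennreal_power (exponential_functional \<xi> \<omega>) \<gamma> \<partial>initial_law P \<mu>) \<le> (\<integral>\<^sup>+ \<omega>. H \<omega> \<partial>initial_law P \<mu>)"
      using sets_eq_imp_space_eq[OF sets] by (intro nn_integral_mono H_ge) simp
    also have "\<dots> = (\<integral>\<^sup>+ y. \<integral>\<^sup>+ \<omega>. H \<omega> \<partial>(case y of (x, i) \<Rightarrow> P x i) \<partial>\<mu>)"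
      unfolding initial_law_def by (rule nn_integral_bind[OF H ker])
    also have "\<dots> \<le> (\<integral>\<^sup>+ y. ennreal c * (case y of (x, i) \<Rightarrow> ennreal (exp (\<gamma> * x))) \<partial>\<mu>)"
      using H_le by (intro nn_integral_mono) auto
    also have "\<dots> = ennreal c * (\<integral>\<^sup>+ (x, i). ennreal (exp (\<gamma> * x)) \<partial>\<mu>)"
    proof (rule nn_integral_cmult)
      have "(\<lambda>(x, i). ennreal (exp (\<gamma> * x))) \<in> borel_measurable (state_space :: (real \<times> 'n) measure)"
        unfolding state_space_def by measurable
      then show "(\<lambda>(x, i). ennreal (exp (\<gamma> * x))) \<in> borel_measurable \<mu>"
        using \<mu>(1) by (simp cong: measurable_cong_sets)
    qed
    also have "\<dots> < \<infinity>" using fin by (simp add: ennreal_mult_less_top)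
    finally show "finite_moment (initial_law P \<mu>) \<gamma> (exponential_functional \<xi>)"
      by (simp add: finite_moment_def)
  qed
qed

end
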